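(* Let $\lambda>0$ be fixed, let $d=1$, and for each $n$ suppose that $X_0^{(n)}$ is in the stationary distribution (and thus so is $X_t^{(n)}$ for each time $t$). There exists an integer-valued function $m=m(n)$ with $m(n)=(1+o(1))\frac{\ln n}{\ln\ln n}$ as $n\to\infty$ such that the following hold. (a) A.a.s. the maximum load $M^{(n)}$ in equilibrium is $m(n)$ or $m(n)-1$. (b) For any constant $K>0$, $\min_{0\le t\le n^K}M_t^{(n)}\ge m(n)-3$ a.a.s. (c) For any constant $K>0$, $$\Big(\max_{0\le t\le n^K}M_t^{(n)}\Big)\frac{\ln\ln n}{\ln n}\to K+1\quad\text{in probability as } n\to\infty.$$
   Context: The model ($n$-bin system): let $\lambda>0$ and let $d,n$ be positive integers. There are $n$ bins. Balls arrive in a Poisson process at rate $\lambda n$. Upon arrival each ball chooses $d$ bins independently and uniformly at random (with replacement), and is placed into a least loaded bin among those chosen (load = number of balls in the bin); if there is more than one chosen bin with least load, the ball is placed in the first such bin chosen. (For $d=1$ the ball is simply placed in a uniformly random bin.) Balls have independent exponential lifetimes with mean $1$, after which they disappear. $X_t^{(n)}(j)$ is the number of balls in bin $j$ at time $t$, and $X_t^{(n)}=(X_t^{(n)}(1),\dots,X_t^{(n)}(n))$ is the load vector, a continuous-time Markov chain on $(\mathbb{Z}^+)^n$ with a unique stationary distribution. $M_t^{(n)}=\max_j X_t^{(n)}(j)$ is the maximum load at time $t$; $M^{(n)}$ denotes the maximum load in equilibrium (i.e. $M_t^{(n)}$ at any fixed time for the stationary process). "A.a.s." (asymptotically almost surely)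 means with probability tending to $1$ as $n\to\infty$. *)

theory Defs
  imports "HOL-Probability.Probability" "HOL-Library.Landau_Symbols"
begin

text \<open>
  The randomness of one system, with bins \<open>0, \<dots>, n - 1\<close> and the arriving balls numbered
  \<open>0, 1, \<dots>\<close> in order of arrival:
  \<^item> \<open>init \<omega> j\<close>: the number of balls in bin \<open>j\<close> at time 0;
  \<^item> \<open>residual j i\<close>: the remaining lifetime at time 0 of the \<open>i\<close>-th ball initially in bin \<open>j\<close>
    (only used for \<open>i < init \<omega> j\<close>);
  \<^item> \<open>gap k\<close>: the time between the arrivals of balls \<open>k - 1\<close> and \<open>k\<close> (\<open>gap 0\<close> starts at time 0);
  \<^item> \<open>choice k r\<close>: the \<open>r\<close>-th bin chosen by ball \<open>k\<close>;
  \<^item> \<open>lifetime k\<close>: the lifetime of ball \<open>k\<close>.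
\<close>

record 'a bin_data =
  pspace :: "'a measure"
  init :: "'a \<Rightarrow> nat \<Rightarrow> nat"
  residual :: "nat \<Rightarrow> nat \<Rightarrow> 'a \<Rightarrow> real"
  gap :: "nat \<Rightarrow> 'a \<Rightarrow> real"
  choice :: "nat \<Rightarrow> nat \<Rightarrow> 'a \<Rightarrow> nat"
  lifetime :: "nat \<Rightarrow> 'a \<Rightarrow> real"

definition arrival :: "'a bin_data \<Rightarrow> nat \<Rightarrow> 'a \<Rightarrow> real" where
  "arrival S k \<omega> = (\<Sum>i\<le>k. gap S i \<omega>)"

text \<open>The first bin of least load \<open>ld\<close> in the sequence \<open>c 0, \<dots>, c (d - 1)\<close>.\<close>

definition first_least :: "nat \<Rightarrow> (nat \<Rightarrow> nat) \<Rightarrow> (nat \<Rightarrow> nat) \<Rightarrow> nat" where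
  "first_least d c ld = c (LEAST r. r < d \<and> (\<forall>s<d. ld (c r) \<le> ld (c s)))"

context notes conj_cong[fundef_cong] begin

text \<open>
  The bin receiving ball \<open>k\<close> when each ball chooses \<open>d\<close> bins: the loads compared are those that
  ball \<open>k\<close> finds on arrival, made up of initial balls and of earlier arrivals \<open>i < k\<close>.
\<close>

fun bin_of :: "'a bin_data \<Rightarrow> nat \<Rightarrow> 'a \<Rightarrow> nat \<Rightarrow> nat" where
  "bin_of S d \<omega> k = first_least d (\<lambda>r. choice S k r \<omega>)
     (\<lambda>j. card {i. i < init S \<omega> j \<and> arrival S k \<omega> < residual S j i \<omega>}
        + card {i. i < k \<and> bin_of S d \<omega> i = j \<and> arrival S k \<omega> < arrival S i \<omega> + lifetime S i \<omega>})"

end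

declare bin_of.simps[simp del]

definition load :: "'a bin_data \<Rightarrow> nat \<Rightarrow> real \<Rightarrow> 'a \<Rightarrow> nat \<Rightarrow> nat" where
  "load S d t \<omega> j =
     card {i. i < init S \<omega> j \<and> t < residual S j i \<omega>}
   + card {k. bin_of S d \<omega> k = j \<and> arrival S k \<omega> \<le> t \<and> t < arrival S k \<omega> + lifetime S k \<omega>}"

definition max_load :: "'a bin_data \<Rightarrow> nat \<Rightarrow> nat \<Rightarrow> real \<Rightarrow> 'a \<Rightarrow> nat" where
  "max_load S n d t \<omega> = (MAX j\<in>{..<n}. load S d t \<omega> j)"

definition load_space :: "nat \<Rightarrow> (nat \<Rightarrow> nat) measure" where
  "load_space n = (\<Pi>\<^sub>M j\<in>{..<n}. count_space UNIV)"

text \<open>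
  Since the random inputs take values in different types, their joint independence is stated
  for the sigma-algebras they generate (cf. \<open>indep_vars_def2\<close>).
\<close>

datatype source = Init | Residual nat nat | Gap nat | Choice nat nat | Lifetime nat

fun source_events :: "'a bin_data \<Rightarrow> nat \<Rightarrow> source \<Rightarrow> 'a set set" where
  "source_events S n Init = {init S -` A \<inter> space (pspace S) | A. A \<in> sets (load_space n)}"
| "source_events S n (Residual j i) = {residual S j i -` A \<inter> space (pspace S) | A. A \<in> sets borel}"
| "source_events S n (Gap k) = {gap S k -` A \<inter> space (pspace S) | A. A \<in> sets borel}"
| "source_events S n (Choice k r) = {choice S k r -` A \<inter> space (pspace S) | A. A \<in> sets (count_space UNIV)}"
| "source_events S n (Lifetime k) = {lifetime S k -` A \<inter> space (pspace S) | A. A \<in> sets borel}"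

definition sources :: "nat \<Rightarrow> nat \<Rightarrow> source set" where
  "sources n d = {Init} \<union> {Residual j i | j i. j < n} \<union> range Gap
     \<union> {Choice k r | k r. r < d} \<union> range Lifetime"

text \<open>
  The \<open>n\<close>-bin system with parameters \<open>lam\<close> and \<open>d\<close> and an arbitrary initial law. The arrivals form
  a Poisson process of rate \<open>lam * n\<close>, given by its i.i.d. exponential interarrival times. As
  lifetimes are memoryless, balls present at time 0 have exponential remaining lifetimes too.
\<close>

definition bin_system :: "real \<Rightarrow> nat \<Rightarrow> nat \<Rightarrow> 'a bin_data \<Rightarrow> bool" where
  "bin_system lam n d S \<longleftrightarrow>
     0 < lam \<and> 0 < n \<and> 0 < d \<and>
     prob_space (pspace S) \<and>
     init S \<in> measurable (pspace S) (load_space n) \<and>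
     (\<forall>j<n. \<forall>i. distributed (pspace S) lborel (residual S j i) (exponential_density 1)) \<and>
     (\<forall>k. distributed (pspace S) lborel (gap S k) (exponential_density (lam * real n))) \<and>
     (\<forall>k. \<forall>r<d. choice S k r \<in> measurable (pspace S) (count_space UNIV) \<and>
        distr (pspace S) (count_space UNIV) (choice S k r) = measure_pmf (pmf_of_set {..<n})) \<and>
     (\<forall>k. distributed (pspace S) lborel (lifetime S k) (exponential_density 1)) \<and>
     prob_space.indep_sets (pspace S) (source_events S n) (sources n d)"

definition load_law :: "'a bin_data \<Rightarrow> nat \<Rightarrow> nat \<Rightarrow> real \<Rightarrow> (nat \<Rightarrow> nat) measure" where
  "load_law S n d t = distr (pspace S) (load_space n) (\<lambda>\<omega>. \<lambda>j\<in>{..<n}. load S d t \<omega> j)"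

text \<open>The initial law is stationary for the chain of load vectors.\<close>

definition stationary :: "'a bin_data \<Rightarrow> nat \<Rightarrow> nat \<Rightarrow> bool" where
  "stationary S n d \<longleftrightarrow>
     (\<forall>t\<ge>0. load_law S n d t = distr (pspace S) (load_space n) (init S))"

text \<open>
  Asymptotically almost surely, for a family of events \<open>E n\<close> on spaces \<open>M n\<close>. Events about all
  times in an interval may fail to be measurable on the null event that arrivals accumulate,
  so probabilities are taken in the completion; a set not measurable there gets value 0, which
  only makes the notion stronger.
\<close>

definition aas :: "(nat \<Rightarrow> 'a measure) \<Rightarrow> (nat \<Rightarrow> 'a \<Rightarrow> bool) \<Rightarrow> bool" where
  "aas M E \<longleftrightarrow>
     (\<lambda>n. measure (completion (M n)) {\<omega> \<in> space (M n). E n \<omega>}) \<longlonglongrightarrow> 1"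

definition tendsto_in_prob :: "(nat \<Rightarrow> 'a measure) \<Rightarrow> (nat \<Rightarrow> 'a \<Rightarrow> real) \<Rightarrow> real \<Rightarrow> bool" where
  "tendsto_in_prob M Y c \<longleftrightarrow> (\<forall>\<epsilon>>0. aas M (\<lambda>n \<omega>. \<bar>Y n \<omega> - c\<bar> < \<epsilon>))"

end

theory Submission
  imports Defs "HOL-Real_Asymp.Real_Asymp"
begin

text \<open>
  For \<open>d = 1\<close> the arrivals, marked with bin and lifetime, form a Poisson process. If \<open>g\<close> is a bounded
  function of arrival time and marks, equal to 1 at late times, the products of \<open>g\<close> over the first
  \<open>m\<close> balls, multiplied by \<open>V\<close> at the last arrival time, form a martingale as soon as \<open>V\<close> solves the
  linear equation \<open>V' = \<nu> (V - G V)\<close>, \<open>\<nu>\<close> being the arrival rate and \<open>G\<close> the mean of \<open>g\<close> over the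
  marks. This gives the joint generating function of the numbers of balls in disjoint regions, so that
  these numbers are independent Poisson variables.

  Hence the balls arriving in \<open>[0, t]\<close> and present at \<open>t\<close> give independent Poisson loads, and
  letting \<open>t\<close> tend to infinity the stationary maximum load is the maximum of \<open>n\<close> independent Poisson
  variables. Between consecutive points of a fine grid a load exceeds its value at the left
  end, or falls below its value at the right end, by at most the number of arrivals in its bin. This
  yields (b) with a grid so fine that at most one ball per bin arrives between grid points, and the upper
  bound in (c) with spacing \<open>n powr - \<delta>\<close>, where boundedly many do. For the lower bound in (c) the balls
  arriving in \<open>(i, i + 1]\<close> and still present at \<open>i + 1\<close> are independent for different \<open>i\<close>.
\<close>

subsection \<open>Generating functions and independence\<close>

text \<open>Windows are fixed in time, the product over balls by index: after a fixed number of
  balls the next gap and marks are independent of the past. The factor \<open>V\<close> stands for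
  the balls not yet seen: \<open>V s\<close> is the expected product of \<open>g\<close> over all
  balls arriving after \<open>s\<close>, and conditioning on the next arrival gives its equation.

  Write m for \<open>level lam n\<close>. Up to constant factors, n lam^k / k! is the expected
  number of bins of load at least k; a step down from k multiplies it by k / lam. It is at least
  sqrt m / lam at m - 1 and of order at least m^(3/2) at m - 2. As ln n is asymptotic to m ln m, the
  bound at m - 2 makes failure at a given time less likely than any power of 1/n, which a
  polynomially fine grid needs; the bound at m - 1 is too weak for this. The ball lost between grid
  points then gives m - 3.

  In (c), lam^k / k! is n^(-c + o(1)) for k about c ln n / ln ln n, whatever \<open>lam\<close> is;
  n bins at about n^K separate times give the threshold c = K + 1. The fine grid of (b) would
  multiply the union bound by a power of n and spoil this constant; spacing
  \<open>n powr - \<delta>\<close> costs only \<delta> in the exponent.\<close>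

text \<open>Induction on \<open>k\<close>, dividing by \<open>x\<close>. The shifted series is known
  to vanish only for x \<noteq> 0; its constant term is recovered as the limit at 0.\<close>

lemma powser_eq_0_coeffs:
  fixes c :: "nat \<Rightarrow> real"
  assumes "\<And>x. \<bar>x\<bar> < 1 \<Longrightarrow> (\<lambda>n. c n * x ^ n) sums 0"
  shows "c k = 0"
  using assms
proof (induction k arbitrary: c)
  case 0
  have "(\<lambda>n. c n * 0 ^ n) sums 0" by (rule 0) simp
  then show ?case using powser_sums_zero[of c] sums_unique2 by blast
next
  case (Suc k)
  have s0: "(\<lambda>n. c n * 0 ^ n) sums 0" by (rule Suc.prems) simp
  then have c0: "c 0 = 0" using powser_sums_zero[of c] sums_unique2 by blast
  have *: "(\<lambda>n. c (Suc n) * x ^ n) sums 0" if "\<bar>x\<bar> < 1" "x \<noteq> 0" for x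
  proof -
    have "(\<lambda>n. c (Suc n) * x ^ Suc n) sums 0"
      using Suc.prems[OF that(1)] c0 by (subst sums_Suc_iff) simp
    then have "(\<lambda>n. inverse x * (c (Suc n) * x ^ Suc n)) sums (inverse x * 0)"
      by (rule sums_mult)
    then show ?thesis using that by (simp add: field_simps)
  qed
  have "((\<lambda>_. 0) \<longlongrightarrow> c (Suc 0)) (at (0::real))"
    by (rule powser_limit_0_strong[of 1 "\<lambda>n. c (Suc n)"]) (use * in auto)
  then have c1: "c (Suc 0) = 0"
    by (simp add: tendsto_const_iff)
  have **: "(\<lambda>n. c (Suc n) * x ^ n) sums 0" if "\<bar>x\<bar> < 1" for x
    using *[OF that] powser_sums_zero[of "\<lambda>n. c (Suc n)"] c1 by (cases "x = 0") auto
  show ?case by (rule Suc.IH[of "\<lambda>n. c (Suc n)"]) (use ** in auto)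
qed

text \<open>The probability that a Poisson variable of mean \<mu> is strictly below
  \<open>k\<close>, so that \<open>1 - poisson_cdf \<mu> k\<close> is the tail from \<open>k\<close>
  on.\<close>

definition poisson_cdf :: "real \<Rightarrow> nat \<Rightarrow> real" where
  "poisson_cdf \<mu> k = (\<Sum>x<k. exp (-\<mu>) * \<mu> ^ x / fact x)"

text \<open>The weight \<open>Y\<close> carries the indicators and powers of the other counts, so
  that a joint generating function can be expanded in one variable at a time. Since |z| < 1, a
  geometric series justifies the exchange of sum and expectation.\<close>

lemma (in prob_space) expectation_mult_powser:
  fixes Y :: "'a \<Rightarrow> real" and N :: "'a \<Rightarrow> nat"
  assumes [measurable]: "Y \<in> borel_measurable M" "N \<in> measurable M (count_space UNIV)"
    and Y: "\<And>\<omega>. \<bar>Y \<omega>\<bar> \<le> 1" and z: "\<bar>z\<bar> < 1"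
  shows "(\<lambda>k. expectation (\<lambda>\<omega>. Y \<omega> * indicator {k} (N \<omega>)) * z ^ k) sums expectation (\<lambda>\<omega>. Y \<omega> * z ^ N \<omega>)"
proof -
  let ?f = "\<lambda>k \<omega>. Y \<omega> * indicator {k} (N \<omega>) * z ^ k"
  have bnd: "\<bar>Y \<omega> * indicator {k} (N \<omega>)\<bar> \<le> 1" for k \<omega>
    using Y[of \<omega>] by (auto simp: indicator_def)
  have bnd2: "\<bar>?f k \<omega>\<bar> \<le> \<bar>z\<bar> ^ k" for k \<omega>
    using mult_right_mono[OF bnd, of "\<bar>z\<bar>^k"] by (simp add: abs_mult power_abs)
  have int: "integrable M (?f k)" for k
  proof (rule integrable_const_bound[where B="\<bar>z\<bar>^k"])
    show "AE \<omega> in M. norm (?f k \<omega>) \<le> \<bar>z\<bar>^k" unfolding real_norm_def by (intro AE_I2 bnd2)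
    have "(\<lambda>\<omega>. indicator {k} (N \<omega>) :: real) \<in> borel_measurable M"
      by (rule measurable_compose[OF assms(2)]) simp
    then show "?f k \<in> borel_measurable M"
      by (intro borel_measurable_times assms(1) borel_measurable_const)
  qed
  have sums: "(\<lambda>k. ?f k \<omega>) sums (Y \<omega> * z ^ N \<omega>)" for \<omega>
  proof -
    have "(\<lambda>k. if k = N \<omega> then Y \<omega> * z ^ k else 0) sums (Y \<omega> * z ^ N \<omega>)"
      using sums_single[of "N \<omega>" "\<lambda>k. Y \<omega> * z ^ k"] by simp
    then show ?thesis by (rule sums_cong[THEN iffD1, rotated]) (auto simp: indicator_def)
  qed
  have "(\<lambda>k. \<integral>\<omega>. ?f k \<omega> \<partial>M) sums (\<integral>\<omega>. (\<Sum>k. ?f k \<omega>) \<partial>M)"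
  proof (rule sums_integral)
    show "AE \<omega> in M. summable (\<lambda>k. norm (?f k \<omega>))"
    proof (rule AE_I2)
      fix \<omega>
      have "summable (\<lambda>k. \<bar>z\<bar>^k)" using z by (simp add: summable_geometric)
      moreover have "norm (norm (?f k \<omega>)) \<le> \<bar>z\<bar>^k" for k using bnd2[of \<omega> k] by (simp only: real_norm_def abs_abs)
      ultimately show "summable (\<lambda>k. norm (?f k \<omega>))" by (rule summable_comparison_test')
    qed
    show "summable (\<lambda>k. \<integral>\<omega>. norm (?f k \<omega>) \<partial>M)"
    proof (rule summable_comparison_test'[of "\<lambda>k. \<bar>z\<bar>^k" 0])
      show "summable (\<lambda>k. \<bar>z\<bar>^k)" using z by (simp add: summable_geometric)
      fix k :: nat
      have "(\<integral>\<omega>. norm (?f k \<omega>) \<partial>M) \<le> (\<integral>\<omega>. \<bar>z\<bar>^k \<partial>M)"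
      proof (rule integral_mono[OF integrable_norm[OF int]])
        show "norm (?f k \<omega>) \<le> \<bar>z\<bar>^k" for \<omega> unfolding real_norm_def by (rule bnd2)
      qed simp
      then show "norm (\<integral>\<omega>. norm (?f k \<omega>) \<partial>M) \<le> \<bar>z\<bar>^k"
        by (simp add: prob_space integral_nonneg_AE)
    qed
  qed (rule int)
  moreover have "(\<integral>\<omega>. (\<Sum>k. ?f k \<omega>) \<partial>M) = expectation (\<lambda>\<omega>. Y \<omega> * z ^ N \<omega>)"
    using sums_unique[OF sums] by simp
  moreover have "(\<integral>\<omega>. ?f k \<omega> \<partial>M) = expectation (\<lambda>\<omega>. Y \<omega> * indicator {k} (N \<omega>)) * z ^ k" for k
    by simp
  ultimately show ?thesis by simp
qed

text \<open>Comparing coefficients with the exponential series identifies each weighted point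
  probability. The constant \<open>C\<close> is the contribution of the other counts, which does not
  depend on \<open>z\<close>.\<close>

lemma (in prob_space) expectation_indicator_from_pgf:
  fixes Y :: "'a \<Rightarrow> real" and N :: "'a \<Rightarrow> nat"
  assumes [measurable]: "Y \<in> borel_measurable M" "N \<in> measurable M (count_space UNIV)"
    and Y: "\<And>\<omega>. \<bar>Y \<omega>\<bar> \<le> 1"
    and pgf: "\<And>z. \<bar>z\<bar> \<le> 1 \<Longrightarrow> expectation (\<lambda>\<omega>. Y \<omega> * z ^ N \<omega>) = C * exp (- ((1 - z) * \<mu>))"
  shows "expectation (\<lambda>\<omega>. Y \<omega> * indicator {..<k} (N \<omega>)) = C * poisson_cdf \<mu> k"
proof -
  have eq: "expectation (\<lambda>\<omega>. Y \<omega> * indicator {x} (N \<omega>)) = C * (exp (-\<mu>) * \<mu> ^ x / fact x)" for x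
  proof -
    let ?c = "\<lambda>x. expectation (\<lambda>\<omega>. Y \<omega> * indicator {x} (N \<omega>)) - C * (exp (-\<mu>) * \<mu> ^ x / fact x)"
    have "?c x = 0"
    proof (rule powser_eq_0_coeffs)
      fix z :: real assume z: "\<bar>z\<bar> < 1"
      have "(\<lambda>n. (\<mu> * z) ^ n /\<^sub>R fact n) sums exp (\<mu> * z)"
        by (rule exp_converges)
      then have "(\<lambda>n. C * exp (-\<mu>) * ((\<mu> * z) ^ n /\<^sub>R fact n)) sums (C * exp (-\<mu>) * exp (\<mu> * z))"
        by (rule sums_mult)
      also have "C * exp (-\<mu>) * exp (\<mu> * z) = C * exp (- ((1 - z) * \<mu>))"
        by (simp add: exp_add[symmetric] algebra_simps)
      also have "\<dots> = expectation (\<lambda>\<omega>. Y \<omega> * z ^ N \<omega>)" using pgf[of z] z by simp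
      finally have *: "(\<lambda>n. C * (exp (-\<mu>) * \<mu> ^ n / fact n) * z ^ n) sums expectation (\<lambda>\<omega>. Y \<omega> * z ^ N \<omega>)"
        by (simp add: power_mult_distrib field_simps)
      show "(\<lambda>n. ?c n * z ^ n) sums 0"
        using sums_diff[OF expectation_mult_powser[OF assms(1,2) Y z] *]
        by (simp add: left_diff_distrib)
    qed
    then show ?thesis by simp
  qed
  have "expectation (\<lambda>\<omega>. Y \<omega> * indicator {..<k} (N \<omega>)) = expectation (\<lambda>\<omega>. \<Sum>x<k. Y \<omega> * indicator {x} (N \<omega>))"
    by (rule Bochner_Integration.integral_cong[OF refl]) (auto simp: indicator_def sum_distrib_left[symmetric])
  also have "\<dots> = (\<Sum>x<k. expectation (\<lambda>\<omega>. Y \<omega> * indicator {x} (N \<omega>)))"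
    by (intro Bochner_Integration.integral_sum integrable_const_bound[where B=1])
       (use Y in \<open>auto simp: indicator_def\<close>)
  also have "\<dots> = C * poisson_cdf \<mu> k"
    by (simp add: eq poisson_cdf_def sum_distrib_left)
  finally show ?thesis .
qed

lemma (in prob_space) prob_from_joint_pgf:
  fixes N :: "'l \<Rightarrow> 'a \<Rightarrow> nat" and \<mu> :: "'l \<Rightarrow> real" and \<kappa> :: "'l \<Rightarrow> nat"
  assumes L: "finite L"
    and N: "\<And>l. l \<in> L \<Longrightarrow> N l \<in> measurable M (count_space UNIV)"
    and pgf: "\<And>z. (\<And>l. \<bar>z l\<bar> \<le> 1) \<Longrightarrow>
      expectation (\<lambda>\<omega>. \<Prod>l\<in>L. z l ^ N l \<omega>) = (\<Prod>l\<in>L. exp (- ((1 - z l) * \<mu> l)))"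
  shows "prob {\<omega>\<in>space M. \<forall>l\<in>L. N l \<omega> < \<kappa> l} = (\<Prod>l\<in>L. poisson_cdf (\<mu> l) (\<kappa> l))"
proof -
  \<comment> \<open>The counts are converted one by one: those in \<open>A\<close> already enter
    through indicators, those in \<open>L - A\<close> still through powers of \<open>z\<close>.
    Adding \<open>a\<close> to \<open>A\<close> varies only the coordinate \<open>z a\<close> and
    treats all other factors as the weight \<open>Y\<close>.\<close>
  have main: "A \<subseteq> L \<Longrightarrow> (\<forall>z. (\<forall>l. \<bar>z l\<bar> \<le> 1) \<longrightarrow>
      expectation (\<lambda>\<omega>. (\<Prod>l\<in>A. indicator {..<\<kappa> l} (N l \<omega>)) * (\<Prod>l\<in>L-A. z l ^ N l \<omega>)) =
       (\<Prod>l\<in>A. poisson_cdf (\<mu> l) (\<kappa> l)) * (\<Prod>l\<in>L-A. exp (- ((1 - z l) * \<mu> l))))"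
    if "finite A" for A
    using that
  proof (induction A rule: finite_induct)
    case empty
    then show ?case using pgf by simp
  next
    case (insert a A)
    show ?case
    proof (intro allI impI)
      fix z :: "'l \<Rightarrow> real" assume z: "\<forall>l. \<bar>z l\<bar> \<le> 1"
      have aL: "a \<in> L" and AL: "A \<subseteq> L" using insert by auto
      have LA: "L - A = insert a (L - insert a A)" using insert by auto
      have fin: "finite (L - insert a A)" using L by auto
      define Y where "Y \<omega> = (\<Prod>l\<in>A. indicator {..<\<kappa> l} (N l \<omega>)) * (\<Prod>l\<in>L-insert a A. z l ^ N l \<omega>)" for \<omega>
      define C where "C = (\<Prod>l\<in>A. poisson_cdf (\<mu> l) (\<kappa> l)) * (\<Prod>l\<in>L-insert a A. exp (- ((1 - z l) * \<mu> l)))"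
      have mN: "N l \<in> measurable M (count_space UNIV)" if "l \<in> L" for l using that by (rule N)
      have Nf: "(\<lambda>\<omega>. f (N l \<omega>)) \<in> borel_measurable M" if "l \<in> L" for l and f :: "nat \<Rightarrow> real"
        by (rule measurable_compose[OF mN[OF that]]) simp
      have Ym: "Y \<in> borel_measurable M" unfolding Y_def
        by (intro borel_measurable_times borel_measurable_prod Nf[of _ "\<lambda>k. indicator {..<\<kappa> _} k"] Nf[of _ "\<lambda>k. z _ ^ k"]) (use AL in auto)
      have Y1: "\<bar>Y \<omega>\<bar> \<le> 1" for \<omega>
      proof -
        have "\<bar>Y \<omega>\<bar> = (\<Prod>l\<in>A. \<bar>indicator {..<\<kappa> l} (N l \<omega>)\<bar>) * (\<Prod>l\<in>L-insert a A. \<bar>z l\<bar> ^ N l \<omega>)"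
          by (simp add: Y_def abs_mult abs_prod power_abs)
        also have "\<dots> \<le> 1 * 1"
          using z by (intro mult_mono prod_le_1 prod_nonneg) (auto simp: indicator_def power_le_one)
        finally show ?thesis by simp
      qed
      have "expectation (\<lambda>\<omega>. Y \<omega> * indicator {..<\<kappa> a} (N a \<omega>)) = C * poisson_cdf (\<mu> a) (\<kappa> a)"
      proof (rule expectation_indicator_from_pgf[OF Ym N[OF aL] Y1])
        fix w :: real assume w: "\<bar>w\<bar> \<le> 1"
        define z' where "z' = z(a := w)"
        have z': "\<forall>l. \<bar>z' l\<bar> \<le> 1" using z w by (auto simp: z'_def)
        have 1: "(\<Prod>l\<in>L-A. z' l ^ N l \<omega>) = w ^ N a \<omega> * (\<Prod>l\<in>L-insert a A. z l ^ N l \<omega>)" for \<omega>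
          unfolding LA using fin by (subst prod.insert) (auto simp: z'_def intro!: prod.cong)
        have 2: "(\<Prod>l\<in>L-A. exp (- ((1 - z' l) * \<mu> l))) = exp (- ((1 - w) * \<mu> a)) * (\<Prod>l\<in>L-insert a A. exp (- ((1 - z l) * \<mu> l)))"
          unfolding LA using fin by (subst prod.insert) (auto simp: z'_def intro!: prod.cong)
        show "expectation (\<lambda>\<omega>. Y \<omega> * w ^ N a \<omega>) = C * exp (- ((1 - w) * \<mu> a))"
          using insert.IH[OF AL, rule_format, of z'] z' unfolding 1 2 by (simp add: Y_def C_def mult_ac)
      qed
      then show "expectation (\<lambda>\<omega>. (\<Prod>l\<in>insert a A. indicator {..<\<kappa> l} (N l \<omega>)) * (\<Prod>l\<in>L-insert a A. z l ^ N l \<omega>)) =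
       (\<Prod>l\<in>insert a A. poisson_cdf (\<mu> l) (\<kappa> l)) * (\<Prod>l\<in>L-insert a A. exp (- ((1 - z l) * \<mu> l)))"
        using insert.hyps by (simp add: Y_def C_def mult_ac)
    qed
  qed
  have "{\<omega>\<in>space M. \<forall>l\<in>L. N l \<omega> < \<kappa> l} \<in> events"
  proof (rule sets.sets_Collect_finite_All[OF _ L])
    fix l assume "l \<in> L"
    then have "N l -` {..<\<kappa> l} \<inter> space M \<in> events" by (intro measurable_sets[OF N]) auto
    also have "N l -` {..<\<kappa> l} \<inter> space M = {\<omega> \<in> space M. N l \<omega> < \<kappa> l}" by auto
    finally show "{\<omega> \<in> space M. N l \<omega> < \<kappa> l} \<in> events" .
  qed
  then have "prob {\<omega>\<in>space M. \<forall>l\<in>L. N l \<omega> < \<kappa> l} = expectation (indicator {\<omega>\<in>space M. \<forall>l\<in>L. N l \<omega> < \<kappa> l})"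
    by simp
  also have "\<dots> = expectation (\<lambda>\<omega>. (\<Prod>l\<in>L. indicator {..<\<kappa> l} (N l \<omega>)))"
  proof (rule Bochner_Integration.integral_cong[OF refl])
    fix \<omega> assume "\<omega> \<in> space M"
    then show "indicator {\<omega>\<in>space M. \<forall>l\<in>L. N l \<omega> < \<kappa> l} \<omega> = (\<Prod>l\<in>L. indicat_real {..<\<kappa> l} (N l \<omega>))"
      using L by (cases "\<forall>l\<in>L. N l \<omega> < \<kappa> l") (auto simp: indicator_def prod_zero_iff)
  qed
  \<comment> \<open>For \<open>A = L\<close> no power is left, so any \<open>z\<close> bounded by 1
    will do.\<close>
  also have "\<dots> = (\<Prod>l\<in>L. poisson_cdf (\<mu> l) (\<kappa> l))"
    using main[OF L subset_refl, rule_format, of "\<lambda>_. 0"] by simp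
  finally show ?thesis .
qed

text \<open>Fubini for the product law. It allows averaging over a new ball while the past is
  frozen.\<close>

lemma (in prob_space) indep_var_expectation_iterated:
  fixes f :: "'b \<times> 'b \<Rightarrow> real"
  assumes ind: "indep_var S X T Y"
    and f[measurable]: "f \<in> borel_measurable (S \<Otimes>\<^sub>M T)"
    and B: "\<And>x. \<bar>f x\<bar> \<le> B"
  shows "expectation (\<lambda>\<omega>. f (X \<omega>, Y \<omega>)) = expectation (\<lambda>\<omega>. expectation (\<lambda>\<omega>'. f (X \<omega>, Y \<omega>')))"
proof -
  from ind have rv[measurable]: "random_variable S X" "random_variable T Y"
    and eq: "distr M S X \<Otimes>\<^sub>M distr M T Y = distr M (S \<Otimes>\<^sub>M T) (\<lambda>x. (X x, Y x))"
    by (auto simp: indep_var_distribution_eq)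
  interpret X: prob_space "distr M S X" by (rule prob_space_distr) simp
  interpret Y: prob_space "distr M T Y" by (rule prob_space_distr) simp
  interpret XY: pair_prob_space "distr M S X" "distr M T Y" ..
  have "expectation (\<lambda>\<omega>. f (X \<omega>, Y \<omega>)) = integral\<^sup>L (distr M (S \<Otimes>\<^sub>M T) (\<lambda>x. (X x, Y x))) f"
    by (subst integral_distr) auto
  also have "\<dots> = integral\<^sup>L (distr M S X \<Otimes>\<^sub>M distr M T Y) f" by (simp add: eq)
  also have "\<dots> = (\<integral>x. (\<integral>y. f (x, y) \<partial>distr M T Y) \<partial>distr M S X)"
    by (rule XY.integral_fst'[symmetric])
       (rule XY.P.integrable_const_bound[where B=B], use B in auto)
  also have "\<dots> = expectation (\<lambda>\<omega>. \<integral>y. f (X \<omega>, y) \<partial>distr M T Y)"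
    by (subst integral_distr) (auto intro!: Y.borel_measurable_lebesgue_integral)
  also have "\<dots> = expectation (\<lambda>\<omega>. expectation (\<lambda>\<omega>'. f (X \<omega>, Y \<omega>')))"
  proof (rule Bochner_Integration.integral_cong[OF refl])
    fix \<omega> assume "\<omega> \<in> space M"
    then have "X \<omega> \<in> space S" using measurable_space[OF rv(1)] by simp
    then show "(\<integral>y. f (X \<omega>, y) \<partial>distr M T Y) = expectation (\<lambda>\<omega>'. f (X \<omega>, Y \<omega>'))"
      by (subst integral_distr) auto
  qed
  finally show ?thesis .
qed

subsection \<open>The marked arrival process\<close>

text \<open>The differential equation says exactly that
  \<open>- exp (- x * \<nu>) * V (a + x)\<close> is a primitive of the density times
  \<open>h (a + x)\<close>. Beyond \<open>T\<close> the integrand is the bare exponential tail,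
  which cancels the boundary term at the far end. The finite set \<open>E\<close> admits kinks of
  \<open>V\<close> at the ends of time windows.\<close>

lemma (in prob_space) exponential_expectation_ode:
  fixes V h :: "real \<Rightarrow> real"
  assumes X: "distributed M lborel X (exponential_density \<nu>)" and \<nu>: "\<nu> > 0"
    and E: "finite E" and V: "continuous_on UNIV V"
    and V': "\<And>s. s \<notin> E \<Longrightarrow> (V has_real_derivative \<nu> * (V s - h s)) (at s)"
    and h[measurable]: "h \<in> borel_measurable borel" and h1: "\<And>s. \<bar>h s\<bar> \<le> 1"
    and T: "\<And>s. s \<ge> T \<Longrightarrow> h s = 1" "\<And>s. s \<ge> T \<Longrightarrow> V s = 1"
  shows "expectation (\<lambda>\<omega>. h (a + X \<omega>)) = V a"
proof -
  have Xm[measurable]: "X \<in> borel_measurable M" using X by (simp add: distributed_def)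
  \<comment> \<open>The waiting time after which \<open>a + x\<close> has passed \<open>T\<close>;
    it is 0 when \<open>a\<close> lies beyond \<open>T\<close> already.\<close>
  define b where "b = max 0 (T - a)"
  have b: "b \<ge> 0" "\<And>x. x \<ge> b \<Longrightarrow> a + x \<ge> T" by (auto simp: b_def)
  have "expectation (\<lambda>\<omega>. h (a + X \<omega>)) = expectation (\<lambda>\<omega>. indicator {..b} (X \<omega>) * h (a + X \<omega>) + indicator {b<..} (X \<omega>))"
    using b T by (intro Bochner_Integration.integral_cong) (auto simp: indicator_def)
  also have "\<dots> = expectation (\<lambda>\<omega>. indicator {..b} (X \<omega>) * h (a + X \<omega>)) + expectation (\<lambda>\<omega>. indicator {b<..} (X \<omega>))"
    using h1 by (intro Bochner_Integration.integral_add integrable_const_bound[where B=1]) (auto simp: indicator_def)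
  also have "expectation (\<lambda>\<omega>. indicator {b<..} (X \<omega>)) = expectation (indicator {\<omega>\<in>space M. b < X \<omega>})"
    by (intro Bochner_Integration.integral_cong) (auto simp: indicator_def)
  also have "\<dots> = exp (- b * \<nu>)"
    using exponential_distributedD_gt[OF X b(1) \<nu>] by simp
  also have "expectation (\<lambda>\<omega>. indicator {..b} (X \<omega>) * h (a + X \<omega>))
      = (\<integral>x. exponential_density \<nu> x * (indicator {..b} x * h (a + x)) \<partial>lborel)"
    by (rule distributed_integral[OF X, symmetric]) (use \<nu> in \<open>auto simp: exponential_density_nonneg\<close>)
  also have "\<dots> = (LBINT x:{0..b}. \<nu> * exp (- x * \<nu>) * h (a + x))"
    unfolding set_lebesgue_integral_def
    by (intro Bochner_Integration.integral_cong) (auto simp: indicator_def exponential_density_def)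
  also have "\<dots> = integral {0..b} (\<lambda>x. \<nu> * exp (- x * \<nu>) * h (a + x))"
  proof (rule set_borel_integral_eq_integral(2))
    show "set_integrable lborel {0..b} (\<lambda>x. \<nu> * exp (- x * \<nu>) * h (a + x))"
      unfolding set_integrable_def
    proof (rule integrableI_bounded_set_indicator[where B=\<nu>])
      show "AE x in lborel. x \<in> {0..b} \<longrightarrow> norm (\<nu> * exp (- x * \<nu>) * h (a + x)) \<le> \<nu>"
      proof (intro AE_I2 impI)
        fix x assume "x \<in> {0..b}"
        then have "exp (- x * \<nu>) * \<bar>h (a + x)\<bar> \<le> 1 * 1" using \<nu> h1 by (intro mult_mono) auto
        then show "norm (\<nu> * exp (- x * \<nu>) * h (a + x)) \<le> \<nu>" using \<nu> by (simp add: abs_mult)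
      qed
    qed (auto simp: emeasure_lborel_Icc b(1))
  qed
  also have "\<dots> = - exp (- b * \<nu>) * V (a + b) - (- exp (- 0 * \<nu>) * V (a + 0))"
  proof (rule integral_unique, rule fundamental_theorem_of_calculus_interior_strong)
    show "finite ((\<lambda>s. s - a) ` E)" using E by simp
    show "continuous_on {0..b} (\<lambda>x. - exp (- x * \<nu>) * V (a + x))"
      by (intro continuous_intros continuous_on_compose2[OF V]) auto
    fix x assume "x \<in> {0<..<b} - (\<lambda>s. s - a) ` E"
    then have "a + x \<notin> E" by (metis DiffE add_diff_cancel_left' imageI)
    from V'[OF this] have "((\<lambda>x. V (a + x)) has_real_derivative \<nu> * (V (a + x) - h (a + x))) (at x)"
      using DERIV_shift[of V _ x a] by (simp add: add.commute)
    then have "((\<lambda>x. - exp (- x * \<nu>) * V (a + x)) has_real_derivative \<nu> * exp (- x * \<nu>) * h (a + x)) (at x)"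
      by (auto intro!: derivative_eq_intros simp: algebra_simps)
    then show "((\<lambda>x. - exp (- x * \<nu>) * V (a + x)) has_vector_derivative \<nu> * exp (- x * \<nu>) * h (a + x)) (at x)"
      by (simp add: has_real_derivative_iff_has_vector_derivative)
  qed (use b in auto)
  finally show ?thesis using b T by simp
qed

section \<open>Inputs of the one-choice system and their independence\<close>

locale one_choice_system =
  fixes lam :: real and n :: nat and S :: "'a bin_data"
  assumes sys: "bin_system lam n 1 S"
begin

sublocale prob_space "pspace S" using sys by (simp add: bin_system_def)

abbreviation "M \<equiv> pspace S"

lemma lam_pos: "lam > 0" and n_pos: "n > 0"
  using sys by (auto simp: bin_system_def)

lemma init_measurable[measurable]: "init S \<in> measurable M (load_space n)"
  using sys by (simp add: bin_system_def)

lemma residual_distributed: "j < n \<Longrightarrow> distributed M lborel (residual S j i) (exponential_density 1)"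
  using sys by (simp add: bin_system_def)

lemma gap_distributed: "distributed M lborel (gap S k) (exponential_density (lam * real n))"
  using sys by (simp add: bin_system_def)

lemma lifetime_distributed: "distributed M lborel (lifetime S k) (exponential_density 1)"
  using sys by (simp add: bin_system_def)

lemma residual_measurable[measurable]: "j < n \<Longrightarrow> residual S j i \<in> borel_measurable M"
  using residual_distributed by (auto simp: distributed_def)

lemma gap_measurable[measurable]: "gap S k \<in> borel_measurable M"
  using gap_distributed by (auto simp: distributed_def)

lemma lifetime_measurable[measurable]: "lifetime S k \<in> borel_measurable M"
  using lifetime_distributed by (auto simp: distributed_def)

lemma choice_measurable[measurable]: "choice S k 0 \<in> measurable M (count_space UNIV)"
  using sys by (simp add: bin_system_def)

lemma arrival_measurable[measurable]: "arrival S k \<in> borel_measurable M"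
  unfolding arrival_def[abs_def] by measurable

lemma prob_choice:
  assumes "j < n"
  shows "prob {\<omega>\<in>space M. choice S k 0 \<omega> = j} = 1 / real n"
proof -
  have "prob {\<omega>\<in>space M. choice S k 0 \<omega> = j} = measure (distr M (count_space UNIV) (choice S k 0)) {j}"
    by (subst measure_distr) (auto intro!: arg_cong[where f=prob])
  also have "\<dots> = pmf (pmf_of_set {..<n}) j"
    using sys by (simp add: bin_system_def measure_pmf_single)
  finally show ?thesis using assms by (subst (asm) pmf_of_set) auto
qed

text \<open>With a single chosen bin the comparison of loads is vacuous, so the recursion through
  earlier balls disappears and different bins no longer interact.\<close>

lemma bin_of_eq: "bin_of S 1 \<omega> k = choice S k 0 \<omega>"
proof -
  have "(LEAST r. r < Suc 0 \<and> Q r) = 0" if "Q 0" for Q :: "nat \<Rightarrow> bool"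
    using that by (intro Least_equality) auto
  then show ?thesis by (subst bin_of.simps) (simp add: first_least_def)
qed

text \<open>A common real-valued form of the inputs that drive the arrivals: independence of the
  generated sigma-algebras then becomes an \<open>indep_vars\<close> statement, from which disjoint
  blocks of inputs can be split off.\<close>

fun source_value :: "source \<Rightarrow> 'a \<Rightarrow> real" where
  "source_value (Gap k) = gap S k"
| "source_value (Choice k r) = (\<lambda>\<omega>. real (choice S k r \<omega>))"
| "source_value (Lifetime k) = lifetime S k"
| "source_value _ = (\<lambda>_. 0)"

lemma indep_source_value:
  "indep_vars (\<lambda>_. borel) source_value (range Gap \<union> range (\<lambda>k. Choice k 0) \<union> range Lifetime)" (is "indep_vars _ _ ?J")
proof -
  have "indep_sets (source_events S n) (sources n 1)"
    using sys by (simp add: bin_system_def)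
  then have "indep_sets (\<lambda>i. {source_value i -` A \<inter> space M |A. A \<in> sets borel}) ?J"
  proof (rule indep_sets_mono)
    show "?J \<subseteq> sources n 1" by (auto simp: sources_def)
    fix i assume i: "i \<in> ?J"
    have choice: "(\<lambda>\<omega>. real (choice S k 0 \<omega>)) -` A = choice S k 0 -` (real -` A)" for A k
      by auto
    from i have "(\<exists>k. i = Gap k) \<or> (\<exists>k. i = Choice k 0) \<or> (\<exists>k. i = Lifetime k)" by auto
    then consider k where "i = Gap k" | k where "i = Choice k 0" | k where "i = Lifetime k" by metis
    then show "{source_value i -` A \<inter> space M |A. A \<in> sets borel} \<subseteq> source_events S n i"
    proof cases
      case 2
      show ?thesis
      proof
        fix B assume "B \<in> {source_value i -` A \<inter> space M |A. A \<in> sets borel}"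
        then obtain A where "B = choice S k 0 -` (real -` A) \<inter> space M" using 2 choice by auto
        then show "B \<in> source_events S n i" unfolding 2 source_events.simps
          by (intro CollectI exI[of _ "real -` A"]) simp
      qed
    qed simp_all
  qed
  then show ?thesis unfolding indep_vars_def2 by auto
qed

end

lemma measurable_triple_compose:
  fixes g :: "real \<Rightarrow> real \<Rightarrow> real \<Rightarrow> real"
  assumes "(\<lambda>(s, c, l). g s c l) \<in> borel_measurable (borel \<Otimes>\<^sub>M borel \<Otimes>\<^sub>M borel)"
    and "s \<in> borel_measurable N" "c \<in> borel_measurable N" "l \<in> borel_measurable N"
  shows "(\<lambda>x. g (s x) (c x) (l x)) \<in> borel_measurable N"
proof -
  have "(\<lambda>x. (s x, c x, l x)) \<in> N \<rightarrow>\<^sub>M (borel \<Otimes>\<^sub>M borel \<Otimes>\<^sub>M borel)" using assms by measurable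
  from measurable_compose[OF this assms(1)] show ?thesis by simp
qed

lemma abs_prod_le_1:
  fixes f :: "'b \<Rightarrow> real"
  assumes "\<And>i. i \<in> A \<Longrightarrow> \<bar>f i\<bar> \<le> 1"
  shows "\<bar>prod f A\<bar> \<le> 1"
  unfolding abs_prod using assms by (intro prod_le_1) auto

lemma abs_mult_le_1: "\<bar>x\<bar> \<le> 1 \<Longrightarrow> \<bar>y\<bar> \<le> 1 \<Longrightarrow> \<bar>x * y\<bar> \<le> (1::real)"
  by (simp add: abs_mult mult_le_one)

context one_choice_system begin

text \<open>Passing from \<open>m\<close> to \<open>Suc m\<close> balls, averaging over the marks of
  ball \<open>m\<close> replaces its factor by \<open>G\<close>, and averaging over the gap before
  it turns \<open>G * V\<close> at its arrival back into \<open>V\<close> at the previous arrival,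
  by \<open>H\<close>. So the expectation does not depend on \<open>m\<close>.\<close>

lemma martingale:
  fixes g :: "real \<Rightarrow> real \<Rightarrow> real \<Rightarrow> real" and V G :: "real \<Rightarrow> real"
  assumes g: "(\<lambda>(s, c, l). g s c l) \<in> borel_measurable (borel \<Otimes>\<^sub>M borel \<Otimes>\<^sub>M borel)"
    and g1: "\<And>s c l. \<bar>g s c l\<bar> \<le> 1"
    and V: "V \<in> borel_measurable borel" and V1: "\<And>s. \<bar>V s\<bar> \<le> 1"
    and G: "\<And>k s. expectation (\<lambda>\<omega>. g s (real (choice S k 0 \<omega>)) (lifetime S k \<omega>)) = G s"
    and G_m: "G \<in> borel_measurable borel" and G1: "\<And>s. \<bar>G s\<bar> \<le> 1"
    and H: "\<And>k a. expectation (\<lambda>\<omega>. G (a + gap S k \<omega>) * V (a + gap S k \<omega>)) = V a"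
  shows "expectation (\<lambda>\<omega>. (\<Prod>k<m. g (arrival S k \<omega>) (real (choice S k 0 \<omega>)) (lifetime S k \<omega>))
            * V (\<Sum>i<m. gap S i \<omega>)) = V 0"
proof (induction m)
  case 0
  then show ?case by (simp add: prob_space)
next
  case (Suc m)
  let ?J = "range Gap \<union> range (\<lambda>k. Choice k 0) \<union> range Lifetime"
  define past where "past = Gap ` {..<m} \<union> (\<lambda>k. Choice k 0) ` {..<m} \<union> Lifetime ` {..<m}"
  define arr where "arr x k = (\<Sum>i\<le>k. x (Gap i))" for x :: "source \<Rightarrow> real" and k
  define prd where "prd x = (\<Prod>k<m. g (arr x k) (x (Choice k 0)) (x (Lifetime k)))" for x :: "source \<Rightarrow> real"
  let ?X = "\<lambda>A \<omega>. restrict (\<lambda>i. source_value i \<omega>) A"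
  have prd1: "\<bar>prd x\<bar> \<le> 1" for x unfolding prd_def by (intro abs_prod_le_1 g1)
  have comp: "(\<lambda>x. x i) \<in> borel_measurable (PiM A (\<lambda>_. borel))" if "i \<in> A" for i and A :: "source set"
    using measurable_component_singleton[OF that, of "\<lambda>_. borel"] by simp
  have arr_m: "(\<lambda>x. arr x k) \<in> borel_measurable (PiM A (\<lambda>_. borel))" if "Gap ` {..k} \<subseteq> A" for k A
    unfolding arr_def using that by (intro borel_measurable_sum comp) auto
  have prd_m: "prd \<in> borel_measurable (PiM A (\<lambda>_. borel))" if "past \<subseteq> A" for A
  proof -
    have "(\<lambda>x. g (arr x k) (x (Choice k 0)) (x (Lifetime k))) \<in> borel_measurable (PiM A (\<lambda>_. borel))" if "k < m" for k
      using \<open>past \<subseteq> A\<close> that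
      by (intro measurable_triple_compose[OF g] arr_m comp) (auto simp: past_def)
    then show ?thesis unfolding prd_def[abs_def] by (intro borel_measurable_prod) auto
  qed
  have prd_eq: "prd (?X A \<omega>) = (\<Prod>k<m. g (arrival S k \<omega>) (real (choice S k 0 \<omega>)) (lifetime S k \<omega>))"
    if "past \<subseteq> A" for A \<omega>
    unfolding prd_def
  proof (rule prod.cong[OF refl])
    fix k assume "k \<in> {..<m}"
    then have "Choice k 0 \<in> A" "Lifetime k \<in> A" "\<And>i. i \<le> k \<Longrightarrow> Gap i \<in> A" using that by (auto simp: past_def)
    then show "g (arr (?X A \<omega>) k) (?X A \<omega> (Choice k 0)) (?X A \<omega> (Lifetime k)) =
        g (arrival S k \<omega>) (real (choice S k 0 \<omega>)) (lifetime S k \<omega>)"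
      by (simp add: arr_def arrival_def)
  qed
  \<comment> \<open>First split: the bin and lifetime of ball \<open>m\<close> against everything up
    to and including its arrival time.\<close>
  let ?A1 = "insert (Gap m) past" and ?B1 = "{Choice m 0, Lifetime m}"
  let ?f1 = "\<lambda>(x, y). prd x * (g (arr x m) (y (Choice m 0)) (y (Lifetime m)) * V (arr x m))"
  have ind1: "indep_var (PiM ?A1 (\<lambda>_. borel)) (?X ?A1) (PiM ?B1 (\<lambda>_. borel)) (?X ?B1)"
    by (rule indep_var_restrict[OF indep_source_value]) (auto simp: past_def)
  have f1m: "?f1 \<in> borel_measurable (PiM ?A1 (\<lambda>_. borel) \<Otimes>\<^sub>M PiM ?B1 (\<lambda>_. borel))"
  proof -
    have 1: "(\<lambda>p. prd (fst p)) \<in> borel_measurable (PiM ?A1 (\<lambda>_. borel) \<Otimes>\<^sub>M PiM ?B1 (\<lambda>_. borel))"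
      by (rule measurable_compose[OF measurable_fst prd_m]) auto
    have 2: "(\<lambda>p. arr (fst p) m) \<in> borel_measurable (PiM ?A1 (\<lambda>_. borel) \<Otimes>\<^sub>M PiM ?B1 (\<lambda>_. borel))"
      by (rule measurable_compose[OF measurable_fst arr_m]) (auto simp: past_def)
    have 3: "(\<lambda>p. snd p i :: real) \<in> borel_measurable (PiM ?A1 (\<lambda>_. borel) \<Otimes>\<^sub>M PiM ?B1 (\<lambda>_. borel))" if "i \<in> ?B1" for i
      by (rule measurable_compose[OF measurable_snd comp[OF that]])
    show ?thesis unfolding case_prod_beta
      by (intro borel_measurable_times measurable_triple_compose[OF g] 1 2 3 measurable_compose[OF 2 V]) auto
  qed
  have f11: "\<bar>?f1 p\<bar> \<le> 1" for p
    unfolding case_prod_beta by (intro abs_mult_le_1 prd1 g1 V1)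
  have gapA1: "arr (?X ?A1 \<omega>) m = arrival S m \<omega>" for \<omega>
    unfolding arr_def arrival_def by (intro sum.cong) (auto simp: past_def)
  have "expectation (\<lambda>\<omega>. (\<Prod>k<Suc m. g (arrival S k \<omega>) (real (choice S k 0 \<omega>)) (lifetime S k \<omega>)) * V (\<Sum>i<Suc m. gap S i \<omega>))
      = expectation (\<lambda>\<omega>. ?f1 (?X ?A1 \<omega>, ?X ?B1 \<omega>))"
  proof (rule Bochner_Integration.integral_cong[OF refl])
    fix \<omega>
    have "(\<Sum>i<Suc m. gap S i \<omega>) = arrival S m \<omega>"
      by (simp add: arrival_def lessThan_Suc_atMost)
    then show "(\<Prod>k<Suc m. g (arrival S k \<omega>) (real (choice S k 0 \<omega>)) (lifetime S k \<omega>)) * V (\<Sum>i<Suc m. gap S i \<omega>)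
      = ?f1 (?X ?A1 \<omega>, ?X ?B1 \<omega>)"
      using prd_eq[of ?A1 \<omega>] gapA1[of \<omega>] by (simp add: subset_insertI)
  qed
  also have "\<dots> = expectation (\<lambda>\<omega>. expectation (\<lambda>\<omega>'. ?f1 (?X ?A1 \<omega>, ?X ?B1 \<omega>')))"
    by (rule indep_var_expectation_iterated[OF ind1 f1m f11])
  also have "\<dots> = expectation (\<lambda>\<omega>. prd (?X ?A1 \<omega>) * (G (arrival S m \<omega>) * V (arrival S m \<omega>)))"
  proof (rule Bochner_Integration.integral_cong[OF refl])
    fix \<omega>
    have "expectation (\<lambda>\<omega>'. ?f1 (?X ?A1 \<omega>, ?X ?B1 \<omega>'))
        = expectation (\<lambda>\<omega>'. (prd (?X ?A1 \<omega>) * V (arrival S m \<omega>)) *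
            g (arrival S m \<omega>) (real (choice S m 0 \<omega>')) (lifetime S m \<omega>'))"
      using gapA1[of \<omega>] by (intro Bochner_Integration.integral_cong[OF refl]) simp
    also have "\<dots> = prd (?X ?A1 \<omega>) * (G (arrival S m \<omega>) * V (arrival S m \<omega>))"
      by (simp add: G)
    finally show "expectation (\<lambda>\<omega>'. ?f1 (?X ?A1 \<omega>, ?X ?B1 \<omega>')) = \<dots>" .
  qed
  \<comment> \<open>Second split: the gap before ball \<open>m\<close> against the earlier balls.
    The marks of ball \<open>m\<close> have already been averaged out.\<close>
  also have "\<dots> = expectation (\<lambda>\<omega>. (\<lambda>(x, y). prd x * (G ((\<Sum>i<m. x (Gap i)) + y (Gap m)) * V ((\<Sum>i<m. x (Gap i)) + y (Gap m))))
       (?X past \<omega>, ?X {Gap m} \<omega>))" (is "_ = expectation (\<lambda>\<omega>. ?f2 (_ \<omega>, _ \<omega>))")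
  proof (rule Bochner_Integration.integral_cong[OF refl])
    fix \<omega>
    have "(\<Sum>i<m. ?X past \<omega> (Gap i)) + ?X {Gap m} \<omega> (Gap m) = arrival S m \<omega>"
      by (simp add: arrival_def lessThan_Suc_atMost[symmetric]) (auto simp: past_def intro!: sum.cong)
    then show "prd (?X ?A1 \<omega>) * (G (arrival S m \<omega>) * V (arrival S m \<omega>)) = ?f2 (?X past \<omega>, ?X {Gap m} \<omega>)"
      using prd_eq[of ?A1 \<omega>] prd_eq[of past \<omega>] by (simp add: subset_insertI del: restrict_apply)
  qed
  also have "\<dots> = expectation (\<lambda>\<omega>. expectation (\<lambda>\<omega>'. ?f2 (?X past \<omega>, ?X {Gap m} \<omega>')))"
  proof (rule indep_var_expectation_iterated)
    show "indep_var (PiM past (\<lambda>_. borel)) (?X past) (PiM {Gap m} (\<lambda>_. borel)) (?X {Gap m})"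
      by (rule indep_var_restrict[OF indep_source_value]) (auto simp: past_def)
    show "?f2 \<in> borel_measurable (PiM past (\<lambda>_. borel) \<Otimes>\<^sub>M PiM {Gap m} (\<lambda>_. borel))"
    proof -
      have 1: "(\<lambda>p. prd (fst p)) \<in> borel_measurable (PiM past (\<lambda>_. borel) \<Otimes>\<^sub>M PiM {Gap m} (\<lambda>_. borel))"
        by (rule measurable_compose[OF measurable_fst prd_m]) auto
      have 2: "(\<lambda>p. (\<Sum>i<m. fst p (Gap i)) + snd p (Gap m) :: real) \<in> borel_measurable (PiM past (\<lambda>_. borel) \<Otimes>\<^sub>M PiM {Gap m} (\<lambda>_. borel))"
      proof (intro borel_measurable_add borel_measurable_sum)
        show "(\<lambda>p. fst p (Gap i) :: real) \<in> borel_measurable (PiM past (\<lambda>_. borel) \<Otimes>\<^sub>M PiM {Gap m} (\<lambda>_. borel))"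
          if "i \<in> {..<m}" for i
          by (rule measurable_compose[OF measurable_fst comp]) (use that in \<open>auto simp: past_def\<close>)
        show "(\<lambda>p. snd p (Gap m) :: real) \<in> borel_measurable (PiM past (\<lambda>_. borel) \<Otimes>\<^sub>M PiM {Gap m} (\<lambda>_. borel))"
          by (rule measurable_compose[OF measurable_snd comp]) auto
      qed
      show ?thesis unfolding case_prod_beta
        by (intro borel_measurable_times 1 measurable_compose[OF 2 V] measurable_compose[OF 2 G_m])
    qed
    show "\<bar>?f2 p\<bar> \<le> 1" for p
      unfolding case_prod_beta by (intro abs_mult_le_1 prd1 G1 V1)
  qed
  also have "\<dots> = expectation (\<lambda>\<omega>. prd (?X past \<omega>) * V (\<Sum>i<m. gap S i \<omega>))"
  proof (rule Bochner_Integration.integral_cong[OF refl])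
    fix \<omega>
    have eq: "(\<Sum>i<m. ?X past \<omega> (Gap i)) = (\<Sum>i<m. gap S i \<omega>)"
      by (auto simp: past_def intro!: sum.cong)
    show "expectation (\<lambda>\<omega>'. ?f2 (?X past \<omega>, ?X {Gap m} \<omega>')) = prd (?X past \<omega>) * V (\<Sum>i<m. gap S i \<omega>)"
      unfolding prod.case eq by (simp add: H)
  qed
  also have "\<dots> = V 0"
    using Suc.IH by (simp add: prd_eq)
  finally show ?case .
qed

end

section \<open>Arrivals do not accumulate\<close>

lemma exponential_density_mult_exp:
  "exponential_density \<nu> x * exp (- x) = \<nu> / (\<nu> + 1) * exponential_density (\<nu> + 1) x" if "\<nu> > 0"
  using that by (simp add: exponential_density_def exp_add[symmetric] field_simps)

lemma (in prob_space) expectation_exp_minus_exponential: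
  assumes X: "distributed M lborel X (exponential_density \<nu>)" and \<nu>: "\<nu> > 0"
  shows "expectation (\<lambda>\<omega>. exp (- X \<omega>)) = \<nu> / (\<nu> + 1)"
proof -
  interpret E: prob_space "density lborel (exponential_density (\<nu> + 1))"
    using \<nu> by (intro prob_space_exponential_density) simp
  have "expectation (\<lambda>\<omega>. exp (- X \<omega>)) = (\<integral>x. exponential_density \<nu> x * exp (- x) \<partial>lborel)"
    by (rule distributed_integral[OF X, symmetric]) (use \<nu> in \<open>auto simp: exponential_density_nonneg\<close>)
  also have "\<dots> = \<nu> / (\<nu> + 1) * (\<integral>x. exponential_density (\<nu> + 1) x \<partial>lborel)"
    using \<nu> by (simp add: exponential_density_mult_exp)
  also have "(\<integral>x. exponential_density (\<nu> + 1) x \<partial>lborel) = (\<integral>x. 1 \<partial>density lborel (exponential_density (\<nu> + 1)))"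
    by (subst integral_density) (use \<nu> in \<open>auto simp: exponential_density_nonneg\<close>)
  also have "\<dots> = 1" using E.prob_space by simp
  finally show ?thesis by simp
qed

context one_choice_system begin

text \<open>The almost sure event on which all pathwise arguments run. Without the second clause
  infinitely many balls could arrive in bounded time, and \<open>card\<close> of an infinite set is
  0.\<close>

definition regular :: "'a \<Rightarrow> bool" where
  "regular \<omega> \<longleftrightarrow> (\<forall>k. 0 < gap S k \<omega> \<and> 0 < lifetime S k \<omega>) \<and> (\<forall>T::nat. \<exists>k. real T < arrival S k \<omega>)"

lemma rate_pos: "lam * real n > 0" using lam_pos n_pos by simp

lemma expectation_exp_minus_arrival:
  "expectation (\<lambda>\<omega>. exp (- arrival S m \<omega>)) = (lam * real n / (lam * real n + 1)) ^ Suc m"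
proof -
  have "indep_vars (\<lambda>_. borel) source_value (Gap ` {..m})"
    by (rule indep_vars_subset[OF indep_source_value]) auto
  then have ind: "indep_vars (\<lambda>_. borel) (\<lambda>i \<omega>. exp (- source_value i \<omega>)) (Gap ` {..m})"
    by (rule indep_vars_compose2[where Y="\<lambda>_ x. exp (- x)"]) auto
  have "integrable M (\<lambda>\<omega>. exp (- gap S k \<omega>))" for k
  proof (rule integrable_const_bound[where B=1])
    have "AE \<omega> in M. 0 \<le> gap S k \<omega>"
    proof (rule distributed_AE2[OF gap_distributed, THEN iffD2])
      show "AE x in lborel. 0 < ennreal (exponential_density (lam * real n) x) \<longrightarrow> 0 \<le> x"
        by (intro AE_I2) (auto simp: exponential_density_def)
    qed auto
    then show "AE \<omega> in M. norm (exp (- gap S k \<omega>)) \<le> 1" by eventually_elim simp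
  qed measurable
  then have "expectation (\<lambda>\<omega>. \<Prod>i\<in>Gap ` {..m}. exp (- source_value i \<omega>)) = (\<Prod>i\<in>Gap ` {..m}. expectation (\<lambda>\<omega>. exp (- source_value i \<omega>)))"
    by (intro indep_vars_lebesgue_integral ind) auto
  then have "expectation (\<lambda>\<omega>. \<Prod>k\<in>{..m}. exp (- gap S k \<omega>)) = (\<Prod>k\<in>{..m}. expectation (\<lambda>\<omega>. exp (- gap S k \<omega>)))"
    by (simp add: prod.reindex inj_on_def)
  also have "\<dots> = (\<Prod>k\<in>{..m}. lam * real n / (lam * real n + 1))"
    using expectation_exp_minus_exponential[OF gap_distributed rate_pos] by simp
  finally show ?thesis by (simp add: arrival_def exp_sum sum_negf[symmetric])
qed

lemma AE_gap_lifetime_pos: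
  "AE \<omega> in M. \<forall>k. 0 < gap S k \<omega> \<and> 0 < lifetime S k \<omega>"
proof -
  have pos: "AE \<omega> in M. 0 < X \<omega>" if X: "distributed M lborel X (exponential_density l)" and l: "0 < l" for X l
  proof -
    have [measurable]: "X \<in> borel_measurable M" using X by (simp add: distributed_def)
    have "prob {\<omega>\<in>space M. 0 < X \<omega>} = 1" using exponential_distributedD_gt[OF X order_refl l] by simp
    then show ?thesis by (subst (asm) prob_Collect_eq_1) auto
  qed
  show ?thesis
    by (subst AE_all_countable) (auto intro!: AE_conjI pos[OF gap_distributed rate_pos] pos[OF lifetime_distributed])
qed

text \<open>Markov's inequality for \<open>exp (- arrival S m \<omega>)\<close>: its mean is a power
  of some \<open>r < 1\<close>, so the probability that ball \<open>m\<close> arrives by time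
  \<open>T\<close> decays geometrically in \<open>m\<close>.\<close>

lemma AE_regular: "AE \<omega> in M. regular \<omega>"
proof -
  define r where "r = lam * real n / (lam * real n + 1)"
  have r: "0 \<le> r" "r < 1" using rate_pos by (auto simp: r_def)
  have "AE \<omega> in M. \<exists>k. real T < arrival S k \<omega>" for T :: nat
  proof -
    let ?B = "{\<omega>\<in>space M. \<forall>k. arrival S k \<omega> \<le> real T}"
    have Bm: "?B \<in> events" by measurable
    have le: "prob ?B \<le> exp (real T) * r ^ Suc m" for m
    proof -
      have int: "integrable M (\<lambda>\<omega>. exp (- arrival S m \<omega>))"
      proof (rule integrable_const_bound[where B=1])
        show "AE \<omega> in M. norm (exp (- arrival S m \<omega>)) \<le> 1"
          using AE_gap_lifetime_pos
        proof eventually_elim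
          case (elim \<omega>)
          then have "0 \<le> arrival S m \<omega>" unfolding arrival_def by (intro sum_nonneg) (auto intro: less_imp_le)
          then show ?case by simp
        qed
      qed measurable
      have "prob ?B = expectation (indicator ?B)" using Bm by simp
      also have "\<dots> \<le> expectation (\<lambda>\<omega>. exp (real T) * exp (- arrival S m \<omega>))"
      proof (rule integral_mono)
        show "integrable M (indicator ?B :: 'a \<Rightarrow> real)" using Bm by (intro integrable_real_indicator) (simp_all add: less_top[symmetric])
        show "integrable M (\<lambda>\<omega>. exp (real T) * exp (- arrival S m \<omega>))" using int by simp
        show "indicator ?B \<omega> \<le> exp (real T) * exp (- arrival S m \<omega>)" for \<omega>
          by (auto simp: indicator_def exp_add[symmetric] simp flip: exp_minus)
      qed
      also have "\<dots> = exp (real T) * r ^ Suc m"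
        using expectation_exp_minus_arrival[of m] by (simp add: r_def)
      finally show ?thesis .
    qed
    have "(\<lambda>m. exp (real T) * r ^ Suc m) \<longlonglongrightarrow> exp (real T) * 0"
      using r by (intro tendsto_mult tendsto_const LIMSEQ_Suc LIMSEQ_realpow_zero) auto
    then have "prob ?B \<le> 0"
      using le by (intro LIMSEQ_le_const[of "\<lambda>m. exp (real T) * r ^ Suc m"]) auto
    then have "prob ?B = 0" using measure_nonneg[of M ?B] by linarith
    then have "AE \<omega> in M. \<not> (\<forall>k. arrival S k \<omega> \<le> real T)"
      using Bm by (subst (asm) prob_Collect_eq_0) auto
    then show ?thesis by eventually_elim (auto simp: not_le)
  qed
  then have "AE \<omega> in M. \<forall>T::nat. \<exists>k. real T < arrival S k \<omega>" by (subst AE_all_countable) simp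
  with AE_gap_lifetime_pos show ?thesis by eventually_elim (simp add: regular_def)
qed

lemma regular_measurable[measurable]: "Measurable.pred M regular"
  unfolding regular_def[abs_def] by measurable

lemma arrival_mono:
  assumes "regular \<omega>" "i \<le> k" shows "arrival S i \<omega> \<le> arrival S k \<omega>"
  unfolding arrival_def using assms by (intro sum_mono2) (auto simp: regular_def intro: less_imp_le)

lemma arrival_pos: "regular \<omega> \<Longrightarrow> 0 < arrival S k \<omega>"
  unfolding arrival_def by (intro sum_pos) (auto simp: regular_def)

lemma arrival_eventually_gt:
  assumes "regular \<omega>"
  obtains m where "\<And>k. k \<ge> m \<Longrightarrow> T < arrival S k \<omega>"
proof -
  obtain N :: nat where "T \<le> real N" using real_arch_simple by blast
  moreover obtain m where "real N < arrival S m \<omega>" using assms by (auto simp: regular_def)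
  ultimately show ?thesis using arrival_mono[OF assms] by (intro that[of m]) (meson le_less_trans less_le_trans)
qed

lemma finite_arrivals: "regular \<omega> \<Longrightarrow> finite {k. arrival S k \<omega> \<le> T}"
proof -
  assume "regular \<omega>"
  then obtain m where m: "\<And>k. k \<ge> m \<Longrightarrow> T < arrival S k \<omega>" using arrival_eventually_gt by blast
  have "{k. arrival S k \<omega> \<le> T} \<subseteq> {..<m}"
  proof
    fix k assume "k \<in> {k. arrival S k \<omega> \<le> T}"
    then have "\<not> m \<le> k" using m[of k] by auto
    then show "k \<in> {..<m}" by simp
  qed
  then show ?thesis using finite_subset by blast
qed

text \<open>For \<open>\<tau> x = x\<close> ball \<open>k\<close> arrives in the window and is still present at its end \<open>u\<close>; for \<open>\<tau> = 0\<close> it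
  just arrives in the window, since lifetimes are positive.\<close>

definition in_region :: "(real \<Rightarrow> real) \<Rightarrow> real \<Rightarrow> real \<Rightarrow> nat \<Rightarrow> nat \<Rightarrow> 'a \<Rightarrow> bool" where
  "in_region \<tau> v u j k \<omega> \<longleftrightarrow> choice S k 0 \<omega> = j \<and> v < arrival S k \<omega> \<and> arrival S k \<omega> \<le> u
     \<and> \<tau> (u - arrival S k \<omega>) < lifetime S k \<omega>"

definition region_count :: "(real \<Rightarrow> real) \<Rightarrow> real \<Rightarrow> real \<Rightarrow> nat \<Rightarrow> 'a \<Rightarrow> nat" where
  "region_count \<tau> v u j \<omega> = card {k. in_region \<tau> v u j k \<omega>}"

lemma in_region_measurable:
  assumes [measurable]: "\<tau> \<in> borel_measurable borel"
  shows "Measurable.pred M (in_region \<tau> v u j k)"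
  unfolding in_region_def[abs_def] by measurable

lemma region_count_measurable:
  assumes "\<tau> \<in> borel_measurable borel"
  shows "region_count \<tau> v u j \<in> measurable M (count_space UNIV)"
  unfolding region_count_def[abs_def]
  using in_region_measurable[OF assms] by (intro measurable_card) (simp add: pred_def)

lemma prob_choice_lifetime:
  assumes "j < n" "0 \<le> a"
  shows "prob {\<omega>\<in>space M. choice S k 0 \<omega> = j \<and> a < lifetime S k \<omega>} = exp (- a) / real n"
proof -
  define A where "A i = (case i of Choice _ _ \<Rightarrow> {real j} | _ \<Rightarrow> {a<..})" for i
  have "prob (\<Inter>i\<in>{Choice k 0, Lifetime k}. source_value i -` A i \<inter> space M)
      = (\<Prod>i\<in>{Choice k 0, Lifetime k}. prob (source_value i -` A i \<inter> space M))"
    by (rule indep_varsD[OF indep_source_value]) (auto simp: A_def)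
  also have "(\<Inter>i\<in>{Choice k 0, Lifetime k}. source_value i -` A i \<inter> space M) =
      {\<omega>\<in>space M. choice S k 0 \<omega> = j \<and> a < lifetime S k \<omega>}" by (auto simp: A_def)
  finally have prod: "prob {\<omega>\<in>space M. choice S k 0 \<omega> = j \<and> a < lifetime S k \<omega>} =
      (\<Prod>i\<in>{Choice k 0, Lifetime k}. prob (source_value i -` A i \<inter> space M))" .
  have 1: "source_value (Choice k 0) -` A (Choice k 0) \<inter> space M = {\<omega>\<in>space M. choice S k 0 \<omega> = j}"
    by (auto simp: A_def)
  have 2: "source_value (Lifetime k) -` A (Lifetime k) \<inter> space M = {\<omega>\<in>space M. a < lifetime S k \<omega>}"
    by (auto simp: A_def)
  show ?thesis
    using prod 1 2 prob_choice[OF assms(1), of k] exponential_distributedD_gt[OF lifetime_distributed assms(2)]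
    by simp
qed

end

text \<open>At most one factor differs from 1. This linearises the product over disjoint regions, so
  that its mean over the marks follows from linearity of expectation.\<close>

lemma prod_if_disjoint:
  fixes z :: "'l \<Rightarrow> 'b::comm_ring_1"
  assumes "finite L" "\<And>l l'. l \<in> L \<Longrightarrow> l' \<in> L \<Longrightarrow> R l \<Longrightarrow> R l' \<Longrightarrow> l = l'"
  shows "(\<Prod>l\<in>L. if R l then z l else 1) = 1 - (\<Sum>l\<in>L. if R l then 1 - z l else 0)"
proof (cases "\<exists>l\<in>L. R l")
  case True
  then obtain a where a: "a \<in> L" "R a" by blast
  have iff: "R l \<longleftrightarrow> l = a" if "l \<in> L" for l using assms(2)[OF that a(1)] a by blast
  have "(\<Prod>l\<in>L. if R l then z l else 1) = (\<Prod>l\<in>L. if l = a then z l else 1)"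
    by (intro prod.cong) (auto simp: iff)
  moreover have "(\<Sum>l\<in>L. if R l then 1 - z l else 0) = (\<Sum>l\<in>L. if l = a then 1 - z l else 0)"
    by (intro sum.cong) (auto simp: iff)
  ultimately show ?thesis using a(1) assms(1) by (simp add: prod.delta' sum.delta')
next
  case False
  then have "(\<Prod>l\<in>L. if R l then z l else 1) = 1" "(\<Sum>l\<in>L. if R l then 1 - z l else 0) = 0"
    by (auto intro!: prod.neutral sum.neutral)
  then show ?thesis by simp
qed

section \<open>Independent Poisson counts in disjoint regions\<close>

context one_choice_system begin

text \<open>A ball arriving a time \<open>x\<close> before the end of its window counts with
  probability \<open>exp (- \<tau> x)\<close>, so the antiderivative \<Psi> yields the mean
  \<open>lam * \<Psi> (u l - v l)\<close>. Windows are half-open, hence those of one bin may share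
  an end point and still be disjoint.\<close>

lemma joint_region_prob:
  fixes v u :: "'l \<Rightarrow> real" and j \<kappa> :: "'l \<Rightarrow> nat" and \<tau> \<Psi> :: "real \<Rightarrow> real"
  assumes L: "finite L"
    and vu: "\<And>l. l \<in> L \<Longrightarrow> 0 \<le> v l" "\<And>l. l \<in> L \<Longrightarrow> v l \<le> u l"
    and j: "\<And>l. l \<in> L \<Longrightarrow> j l < n"
    and disj: "\<And>l l'. l \<in> L \<Longrightarrow> l' \<in> L \<Longrightarrow> l \<noteq> l' \<Longrightarrow> j l \<noteq> j l' \<or> u l \<le> v l' \<or> u l' \<le> v l"
    and \<tau>: "\<tau> \<in> borel_measurable borel" "\<And>x. x \<ge> 0 \<Longrightarrow> \<tau> x \<ge> 0"
    and \<Psi>: "\<And>x. (\<Psi> has_real_derivative exp (- \<tau> x)) (at x)" "\<Psi> 0 = 0"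
  shows "prob {\<omega>\<in>space M. \<forall>l\<in>L. region_count \<tau> (v l) (u l) (j l) \<omega> < \<kappa> l}
      = (\<Prod>l\<in>L. poisson_cdf (lam * \<Psi> (u l - v l)) (\<kappa> l))"
proof (rule prob_from_joint_pgf[OF L])
  show "random_variable (count_space UNIV) (region_count \<tau> (v l) (u l) (j l))" for l
    by (rule region_count_measurable[OF \<tau>(1)])
  fix z :: "'l \<Rightarrow> real" assume z: "\<And>l. \<bar>z l\<bar> \<le> 1"
  have z1: "0 \<le> 1 - z l" for l using z[of l] by auto
  define \<nu> where "\<nu> = lam * real n"
  have \<nu>: "\<nu> > 0" using rate_pos by (simp add: \<nu>_def)
  have \<Psi>0: "0 \<le> \<Psi> x" if "0 \<le> x" for x
    using DERIV_nonneg_imp_nondecreasing[OF that, of \<Psi>] \<Psi> by (metis exp_ge_zero)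
  have \<Psi>_cont: "continuous_on UNIV \<Psi>"
    using \<Psi>(1) by (intro continuous_at_imp_continuous_on ballI DERIV_isCont) auto
  define R where "R l s c y \<longleftrightarrow> c = real (j l) \<and> v l < s \<and> s \<le> u l \<and> \<tau> (u l - s) < y" for l s c y
  define g where "g s c y = (\<Prod>l\<in>L. if R l s c y then z l else 1)" for s c y
  \<comment> \<open>\<open>\<phi> l s\<close> is the intensity at which balls enter region
    \<open>l\<close> at time \<open>s\<close>, and \<open>\<Phi> l s\<close> the mean number still
    to enter after \<open>s\<close>; thus \<Phi> has derivative -\<phi> away from the window ends,
    and \<open>V s\<close> is the generating function of the counts still to come.\<close>
  define \<phi> where "\<phi> l s = (if v l < s \<and> s \<le> u l then lam * exp (- \<tau> (u l - s)) else 0)" for l s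
  define \<Phi> where "\<Phi> l s = lam * \<Psi> (u l - max (v l) (min (u l) s))" for l s
  define G where "G s = 1 - (\<Sum>l\<in>L. (1 - z l) * \<phi> l s) / \<nu>" for s
  define V where "V s = exp (- (\<Sum>l\<in>L. (1 - z l) * \<Phi> l s))" for s
  have R_disj: "l = l'" if "l \<in> L" "l' \<in> L" "R l s c y" "R l' s c y" for l l' s c y
    using disj[OF that(1,2)] that(3,4) by (force simp: R_def)
  have g_eq: "g s c y = 1 - (\<Sum>l\<in>L. if R l s c y then 1 - z l else 0)" for s c y
    unfolding g_def by (rule prod_if_disjoint[OF L]) (rule R_disj)
  have g_m: "(\<lambda>(s, c, y). g s c y) \<in> borel_measurable (borel \<Otimes>\<^sub>M borel \<Otimes>\<^sub>M borel)"
  proof -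
    note \<tau>(1)[measurable]
    have [measurable]: "Measurable.pred (borel \<Otimes>\<^sub>M borel \<Otimes>\<^sub>M borel) (\<lambda>p. R l (fst p) (fst (snd p)) (snd (snd p)))" for l
      unfolding R_def by measurable
    show ?thesis unfolding g_def case_prod_beta by measurable
  qed
  have g1: "\<bar>g s c y\<bar> \<le> 1" for s c y
    unfolding g_def by (intro abs_prod_le_1) (auto simp: z)
  have \<Phi>0: "0 \<le> \<Phi> l s" if "l \<in> L" for l s
    unfolding \<Phi>_def using lam_pos vu[OF that] by (intro mult_nonneg_nonneg \<Psi>0) auto
  have V01: "0 < V s" "V s \<le> 1" for s
    unfolding V_def using z1 \<Phi>0 by (auto intro!: sum_nonneg)
  have V1: "\<bar>V s\<bar> \<le> 1" for s using V01[of s] by linarith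
  have V_cont: "continuous_on UNIV V"
    unfolding V_def \<Phi>_def by (intro continuous_intros continuous_on_compose2[OF \<Psi>_cont]) auto
  have G_eq: "expectation (\<lambda>\<omega>. g s (real (choice S k 0 \<omega>)) (lifetime S k \<omega>)) = G s" for k s
  proof -
    let ?A = "\<lambda>l. {\<omega>\<in>space M. choice S k 0 \<omega> = j l \<and> \<tau> (u l - s) < lifetime S k \<omega>}"
    have Am: "?A l \<in> events" for l by measurable
    have "expectation (\<lambda>\<omega>. g s (real (choice S k 0 \<omega>)) (lifetime S k \<omega>))
        = expectation (\<lambda>\<omega>. 1 - (\<Sum>l\<in>L. (if v l < s \<and> s \<le> u l then 1 - z l else 0) * indicator (?A l) \<omega>))"
    proof (rule Bochner_Integration.integral_cong[OF refl])
      fix \<omega> assume "\<omega> \<in> space M"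
      then have "(if R l s (real (choice S k 0 \<omega>)) (lifetime S k \<omega>) then 1 - z l else 0) =
          (if v l < s \<and> s \<le> u l then 1 - z l else 0) * indicator (?A l) \<omega>" for l
        by (auto simp: R_def indicator_def)
      then show "g s (real (choice S k 0 \<omega>)) (lifetime S k \<omega>) =
         1 - (\<Sum>l\<in>L. (if v l < s \<and> s \<le> u l then 1 - z l else 0) * indicator (?A l) \<omega>)"
        by (simp only: g_eq)
    qed
    also have "\<dots> = 1 - (\<Sum>l\<in>L. (if v l < s \<and> s \<le> u l then 1 - z l else 0) * prob (?A l))"
      using Am by (subst Bochner_Integration.integral_diff)
        (auto simp: prob_space less_top[symmetric] intro!: integrable_mult_right integrable_real_indicator)
    also have "\<dots> = G s"
    proof -
      have "(if v l < s \<and> s \<le> u l then 1 - z l else 0) * prob (?A l) = (1 - z l) * \<phi> l s / \<nu>" if "l \<in> L" for l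
      proof (cases "v l < s \<and> s \<le> u l")
        case True
        then have "prob (?A l) = exp (- \<tau> (u l - s)) / real n"
          by (intro prob_choice_lifetime j[OF that] \<tau>(2)) simp
        then show ?thesis using True lam_pos n_pos by (simp add: \<phi>_def \<nu>_def)
      qed (auto simp: \<phi>_def)
      then show ?thesis unfolding G_def by (simp add: sum_divide_distrib)
    qed
    finally show ?thesis .
  qed
  have G_m: "G \<in> borel_measurable borel"
    unfolding G_def \<phi>_def using \<tau>(1) by measurable
  have G1: "\<bar>G s\<bar> \<le> 1" for s
  proof -
    have "\<bar>expectation (\<lambda>\<omega>. g s (real (choice S 0 0 \<omega>)) (lifetime S 0 \<omega>))\<bar> \<le> expectation (\<lambda>\<omega>. \<bar>g s (real (choice S 0 0 \<omega>)) (lifetime S 0 \<omega>)\<bar>)"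
      by (rule integral_abs_bound)
    also have "\<dots> \<le> expectation (\<lambda>\<omega>. 1)"
    proof (rule integral_mono)
      have "(\<lambda>\<omega>. g s (real (choice S 0 0 \<omega>)) (lifetime S 0 \<omega>)) \<in> borel_measurable M"
        by (rule measurable_triple_compose[OF g_m]) measurable
      then show "integrable M (\<lambda>\<omega>. \<bar>g s (real (choice S 0 0 \<omega>)) (lifetime S 0 \<omega>)\<bar>)"
        by (intro integrable_const_bound[where B=1]) (auto simp: g1)
    qed (auto simp: g1)
    finally show ?thesis by (simp add: G_eq prob_space)
  qed
  \<comment> \<open>\<open>T\<close> has to lie strictly beyond every window end: the sum of the
    absolute values bounds each \<open>u l\<close>, also for empty \<open>L\<close>, and the summand
    1 makes the inequality strict. \<open>E\<close> collects the kinks of \<Phi>.\<close>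
  have H: "expectation (\<lambda>\<omega>. G (a + gap S k \<omega>) * V (a + gap S k \<omega>)) = V a" for k a
  proof (rule exponential_expectation_ode[where h="\<lambda>s. G s * V s" and T="1 + (\<Sum>l\<in>L. \<bar>u l\<bar>)" and E="v ` L \<union> u ` L"])
    show "distributed M lborel (gap S k) (exponential_density \<nu>)" unfolding \<nu>_def by (rule gap_distributed)
    show "finite (v ` L \<union> u ` L)" using L by simp
    show "(\<lambda>s. G s * V s) \<in> borel_measurable borel"
      using borel_measurable_continuous_onI[OF V_cont] G_m by measurable
    show "\<bar>G s * V s\<bar> \<le> 1" for s by (intro abs_mult_le_1 G1 V1)
    fix s :: real assume s: "s \<notin> v ` L \<union> u ` L"
    have \<Phi>': "(\<Phi> l has_real_derivative - \<phi> l s) (at s)" if l: "l \<in> L" for l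
    proof -
      have ne: "s \<noteq> v l" "s \<noteq> u l" using s l by auto
      consider "s < v l" | "v l < s" "s < u l" | "u l < s" using ne by linarith
      then show ?thesis
      proof cases
        case 1
        have "((\<lambda>s. lam * \<Psi> (u l - v l)) has_real_derivative 0) (at s)" by simp
        then have "(\<Phi> l has_real_derivative 0) (at s)"
          by (rule has_field_derivative_transform_within_open[where S="{..<v l}"])
             (use 1 vu(2)[OF l] in \<open>auto simp: \<Phi>_def\<close>)
        then show ?thesis using 1 by (simp add: \<phi>_def)
      next
        case 2
        have "((\<lambda>s. lam * \<Psi> (u l - s)) has_real_derivative lam * (exp (- \<tau> (u l - s)) * (- 1))) (at s)"
          by (intro DERIV_cmult DERIV_chain2[OF \<Psi>(1)]) (auto intro!: derivative_eq_intros)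
        then have "(\<Phi> l has_real_derivative lam * (exp (- \<tau> (u l - s)) * (- 1))) (at s)"
          by (rule has_field_derivative_transform_within_open[where S="{v l<..<u l}"])
             (use 2 in \<open>auto simp: \<Phi>_def\<close>)
        then show ?thesis using 2 by (simp add: \<phi>_def)
      next
        case 3
        have "((\<lambda>s. 0) has_real_derivative 0) (at s)" by simp
        then have "(\<Phi> l has_real_derivative 0) (at s)"
          by (rule has_field_derivative_transform_within_open[where S="{u l<..}"])
             (use 3 vu(2)[OF l] in \<open>auto simp: \<Phi>_def \<Psi>(2) max_def\<close>)
        then show ?thesis using 3 by (simp add: \<phi>_def)
      qed
    qed
    have "(V has_real_derivative exp (- (\<Sum>l\<in>L. (1 - z l) * \<Phi> l s)) * (- (\<Sum>l\<in>L. (1 - z l) * (- \<phi> l s)))) (at s)"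
      unfolding V_def by (intro DERIV_fun_exp DERIV_minus DERIV_sum DERIV_cmult \<Phi>')
    also have "exp (- (\<Sum>l\<in>L. (1 - z l) * \<Phi> l s)) * (- (\<Sum>l\<in>L. (1 - z l) * (- \<phi> l s))) = \<nu> * (V s - G s * V s)"
    proof -
      have "(\<Sum>l\<in>L. (1 - z l) * (- \<phi> l s)) = - (\<Sum>l\<in>L. (1 - z l) * \<phi> l s)"
        by (simp add: sum_negf)
      then have "- (\<Sum>l\<in>L. (1 - z l) * (- \<phi> l s)) = \<nu> * (1 - G s)"
        using \<nu> unfolding G_def by simp
      moreover have "exp (- (\<Sum>l\<in>L. (1 - z l) * \<Phi> l s)) = V s" by (simp only: V_def)
      ultimately have "exp (- (\<Sum>l\<in>L. (1 - z l) * \<Phi> l s)) * (- (\<Sum>l\<in>L. (1 - z l) * (- \<phi> l s))) = V s * (\<nu> * (1 - G s))"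
        by (simp only:)
      also have "\<dots> = \<nu> * (V s - G s * V s)" by (simp add: right_diff_distrib)
      finally show ?thesis .
    qed
    finally show "(V has_real_derivative \<nu> * (V s - G s * V s)) (at s)" .
  next
    fix s :: real assume s: "1 + (\<Sum>l\<in>L. \<bar>u l\<bar>) \<le> s"
    have su: "u l < s" if "l \<in> L" for l
    proof -
      have "\<bar>u l\<bar> \<le> (\<Sum>l\<in>L. \<bar>u l\<bar>)" using L that by (intro member_le_sum) auto
      then show ?thesis using s by linarith
    qed
    have "\<phi> l s = 0" "\<Phi> l s = 0" if "l \<in> L" for l
      using su[OF that] vu(2)[OF that] by (auto simp: \<phi>_def \<Phi>_def \<Psi>(2) max_def)
    then have "G s = 1" "V s = 1" by (auto simp: G_def V_def)
    then show "G s * V s = 1" "V s = 1" by auto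
  qed (use \<nu> V_cont in auto)
  have V_large: "V s = 1" if s: "1 + (\<Sum>l\<in>L. \<bar>u l\<bar>) \<le> s" for s
  proof -
    have "\<Phi> l s = 0" if "l \<in> L" for l
    proof -
      have "\<bar>u l\<bar> \<le> (\<Sum>l\<in>L. \<bar>u l\<bar>)" using L that by (intro member_le_sum) auto
      then have "u l < s" using s by linarith
      then show ?thesis using vu(2)[OF that] by (auto simp: \<Phi>_def \<Psi>(2) max_def)
    qed
    then show ?thesis by (simp add: V_def)
  qed
  let ?c = "\<lambda>m \<omega>. (\<Prod>k<m. g (arrival S k \<omega>) (real (choice S k 0 \<omega>)) (lifetime S k \<omega>)) * V (\<Sum>i<m. gap S i \<omega>)"
  let ?N = "\<lambda>l. region_count \<tau> (v l) (u l) (j l)"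
  have m1: "expectation (?c m) = V 0" for m
    by (rule martingale[OF g_m g1 _ V1 G_eq G_m G1 H]) (rule borel_measurable_continuous_onI[OF V_cont])
  \<comment> \<open>The expectations are all equal to \<open>V 0\<close>. On a regular path the
    integrand becomes constant in \<open>m\<close> once all windows are closed, and its value there
    is the product sought.\<close>
  have "(\<lambda>m. expectation (?c m)) \<longlonglongrightarrow> expectation (\<lambda>\<omega>. \<Prod>l\<in>L. z l ^ ?N l \<omega>)"
  proof (rule integral_dominated_convergence[where w="\<lambda>_. 1"])
    have "(\<lambda>\<omega>. z l ^ ?N l \<omega>) \<in> borel_measurable M" for l
      by (rule measurable_compose[OF region_count_measurable[OF \<tau>(1)]]) simp
    then show "(\<lambda>\<omega>. \<Prod>l\<in>L. z l ^ ?N l \<omega>) \<in> borel_measurable M" by (intro borel_measurable_prod)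
    show "?c m \<in> borel_measurable M" for m
    proof (intro borel_measurable_times borel_measurable_prod)
      show "(\<lambda>\<omega>. g (arrival S k \<omega>) (real (choice S k 0 \<omega>)) (lifetime S k \<omega>)) \<in> borel_measurable M" for k
        by (rule measurable_triple_compose[OF g_m]) measurable
      show "(\<lambda>\<omega>. V (\<Sum>i<m. gap S i \<omega>)) \<in> borel_measurable M"
        by (rule measurable_compose[OF _ borel_measurable_continuous_onI[OF V_cont]]) measurable
    qed
    show "AE \<omega> in M. norm (?c m \<omega>) \<le> 1" for m
      unfolding real_norm_def by (intro AE_I2 abs_mult_le_1 abs_prod_le_1 g1 V1)
    show "AE \<omega> in M. (\<lambda>m. ?c m \<omega>) \<longlonglongrightarrow> (\<Prod>l\<in>L. z l ^ ?N l \<omega>)"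
      using AE_regular
    proof eventually_elim
      case (elim \<omega>)
      obtain m0 where m0: "\<And>k. k \<ge> m0 \<Longrightarrow> 1 + (\<Sum>l\<in>L. \<bar>u l\<bar>) < arrival S k \<omega>"
        using arrival_eventually_gt[OF elim] by blast
      have "?c m \<omega> = (\<Prod>l\<in>L. z l ^ ?N l \<omega>)" if m: "m > m0" for m
      proof -
        \<comment> \<open>\<open>V\<close> is evaluated at the arrival of ball \<open>m - 1\<close>,
          which is why \<open>m > m0\<close> is required.\<close>
        obtain m' where m': "m = Suc m'" "m' \<ge> m0" using m by (cases m) auto
        have "(\<Sum>i<m. gap S i \<omega>) = arrival S m' \<omega>" by (simp add: m' arrival_def lessThan_Suc_atMost del: sum.lessThan_Suc)
        then have V1: "V (\<Sum>i<m. gap S i \<omega>) = 1" using m0[OF m'(2)] by (simp add: V_large)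
        have Reg: "R l (arrival S k \<omega>) (real (choice S k 0 \<omega>)) (lifetime S k \<omega>) \<longleftrightarrow> in_region \<tau> (v l) (u l) (j l) k \<omega>" for l k
          by (simp add: R_def in_region_def)
        have "(\<Prod>k<m. g (arrival S k \<omega>) (real (choice S k 0 \<omega>)) (lifetime S k \<omega>))
          = (\<Prod>l\<in>L. \<Prod>k<m. if in_region \<tau> (v l) (u l) (j l) k \<omega> then z l else 1)"
          unfolding g_def Reg by (rule prod.swap)
        also have "\<dots> = (\<Prod>l\<in>L. z l ^ ?N l \<omega>)"
        proof (rule prod.cong[OF refl])
          fix l assume l: "l \<in> L"
          have "k < m" if "in_region \<tau> (v l) (u l) (j l) k \<omega>" for k
          proof (rule ccontr)
            assume "\<not> k < m"
            then have "1 + (\<Sum>l\<in>L. \<bar>u l\<bar>) < arrival S k \<omega>" using m by (intro m0) simp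
            moreover have "\<bar>u l\<bar> \<le> (\<Sum>l\<in>L. \<bar>u l\<bar>)" using L l by (intro member_le_sum) auto
            ultimately show False using that by (auto simp: in_region_def)
          qed
          then have eq: "{..<m} \<inter> {k. in_region \<tau> (v l) (u l) (j l) k \<omega>} = {k. in_region \<tau> (v l) (u l) (j l) k \<omega>}" by auto
          have "(\<Prod>k<m. if in_region \<tau> (v l) (u l) (j l) k \<omega> then z l else 1)
            = (\<Prod>k\<in>{..<m} \<inter> {k. in_region \<tau> (v l) (u l) (j l) k \<omega>}. z l)"
            by (subst prod.inter_restrict) auto
          then show "(\<Prod>k<m. if in_region \<tau> (v l) (u l) (j l) k \<omega> then z l else 1) = z l ^ ?N l \<omega>"
            by (simp add: eq region_count_def)
        qed
        finally show ?thesis by (simp add: V1)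
      qed
      then have "eventually (\<lambda>m. ?c m \<omega> = (\<Prod>l\<in>L. z l ^ ?N l \<omega>)) sequentially"
        unfolding eventually_at_top_dense by blast
      then show ?case by (rule tendsto_eventually)
    qed
  qed auto
  then have "expectation (\<lambda>\<omega>. \<Prod>l\<in>L. z l ^ ?N l \<omega>) = V 0"
    unfolding m1 by (simp add: LIMSEQ_const_iff)
  also have "V 0 = exp (\<Sum>l\<in>L. - ((1 - z l) * (lam * \<Psi> (u l - v l))))"
  proof -
    have "\<Phi> l 0 = lam * \<Psi> (u l - v l)" if "l \<in> L" for l
      using vu[OF that] by (simp add: \<Phi>_def)
    then show ?thesis by (simp add: V_def sum_negf)
  qed
  also have "\<dots> = (\<Prod>l\<in>L. exp (- ((1 - z l) * (lam * \<Psi> (u l - v l)))))"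
    by (rule exp_sum[OF L])
  finally show "expectation (\<lambda>\<omega>. \<Prod>l\<in>L. z l ^ ?N l \<omega>) = \<dots>" .
qed

end

subsection \<open>Poisson tails and pathwise load estimates\<close>

declare One_nat_def [simp del]

text \<open>The lower bound keeps only the first term of the tail. The upper bound uses (i + k)!
  \<ge> i! k!, which splits off the first term and leaves a full exponential series.\<close>

lemma poisson_cdf_tail_bounds:
  assumes "\<mu> \<ge> 0"
  shows "exp (-\<mu>) * (\<mu> ^ k / fact k) \<le> 1 - poisson_cdf \<mu> k"
    and "1 - poisson_cdf \<mu> k \<le> \<mu> ^ k / fact k"
proof -
  let ?a = "\<lambda>x. \<mu> ^ x / fact x"
  have s: "?a sums exp \<mu>" using exp_converges[of \<mu>] by (simp add: field_simps)
  then have sum: "summable ?a" and ex: "exp \<mu> = suminf ?a" by (auto simp: sums_iff)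
  have shift: "summable (\<lambda>i. ?a (i + k))" using sum by (subst summable_iff_shift)
  have split: "exp \<mu> = (\<Sum>i. ?a (i + k)) + (\<Sum>x<k. ?a x)"
    unfolding ex by (rule suminf_split_initial_segment[OF sum])
  have tail: "1 - poisson_cdf \<mu> k = exp (-\<mu>) * (\<Sum>i. ?a (i + k))"
  proof -
    have "poisson_cdf \<mu> k = exp (-\<mu>) * (\<Sum>x<k. ?a x)"
      unfolding poisson_cdf_def by (simp add: sum_distrib_left)
    also have "(\<Sum>x<k. ?a x) = exp \<mu> - (\<Sum>i. ?a (i + k))" using split by simp
    finally show ?thesis by (simp add: right_diff_distrib flip: exp_add)
  qed
  have "?a k = (\<Sum>i\<in>{0}. ?a (i + k))" by simp
  also have "\<dots> \<le> (\<Sum>i. ?a (i + k))" using assms by (intro sum_le_suminf shift) auto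
  finally show "exp (-\<mu>) * (\<mu> ^ k / fact k) \<le> 1 - poisson_cdf \<mu> k"
    unfolding tail by (intro mult_left_mono) auto
  have "(\<Sum>i. ?a (i + k)) \<le> (\<Sum>i. ?a k * ?a i)"
  proof (rule suminf_le[OF _ shift])
    fix i
    have "fact i * fact k \<le> (fact (i + k) :: real)"
      using fact_fact_dvd_fact[of i k] by (metis dvd_imp_le fact_gt_zero of_nat_fact of_nat_le_iff of_nat_mult)
    then have "\<mu> ^ (i + k) / fact (i + k) \<le> \<mu> ^ (i + k) / (fact i * fact k)"
      using assms by (intro divide_left_mono) auto
    then show "?a (i + k) \<le> ?a k * ?a i" by (simp add: power_add mult_ac)
  qed (use sum in \<open>rule summable_mult\<close>)
  also have "\<dots> = ?a k * exp \<mu>" unfolding ex by (rule suminf_mult[OF sum])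
  finally have "exp (-\<mu>) * (\<Sum>i. ?a (i + k)) \<le> exp (-\<mu>) * (?a k * exp \<mu>)" by (intro mult_left_mono) auto
  also have "\<dots> = ?a k" by (simp add: field_simps flip: exp_add)
  finally show "1 - poisson_cdf \<mu> k \<le> \<mu> ^ k / fact k" unfolding tail .
qed

lemma poisson_cdf_bounds:
  assumes "\<mu> \<ge> 0"
  shows "0 \<le> poisson_cdf \<mu> k" "poisson_cdf \<mu> k \<le> 1"
proof -
  show "0 \<le> poisson_cdf \<mu> k" unfolding poisson_cdf_def using assms by (intro sum_nonneg) simp
  have "0 \<le> exp (-\<mu>) * (\<mu> ^ k / fact k)" using assms by simp
  then show "poisson_cdf \<mu> k \<le> 1" using poisson_cdf_tail_bounds(1)[OF assms, of k] by linarith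
qed

text \<open>From 1 - x \<le> exp (-x). The left side is the probability that \<open>N\<close>
  independent Poisson counts all stay below \<open>k\<close>; the companion bound below is the union
  bound, in the form of Bernoulli's inequality.\<close>

lemma poisson_cdf_power_le:
  assumes "\<mu> \<ge> 0"
  shows "poisson_cdf \<mu> k ^ N \<le> exp (- (real N * (exp (-\<mu>) * (\<mu> ^ k / fact k))))"
proof -
  have "poisson_cdf \<mu> k \<le> 1 - exp (-\<mu>) * (\<mu> ^ k / fact k)" using poisson_cdf_tail_bounds(1)[OF assms, of k] by simp
  also have "\<dots> \<le> exp (- (exp (-\<mu>) * (\<mu> ^ k / fact k)))" using exp_ge_add_one_self[of "- (exp (-\<mu>) * (\<mu> ^ k / fact k))"] by simp
  finally have "poisson_cdf \<mu> k ^ N \<le> exp (- (exp (-\<mu>) * (\<mu> ^ k / fact k))) ^ N"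
    by (intro power_mono poisson_cdf_bounds assms)
  then show ?thesis by (simp add: exp_of_nat_mult[symmetric])
qed

lemma one_minus_poisson_cdf_power_le:
  assumes "\<mu> \<ge> 0"
  shows "1 - poisson_cdf \<mu> k ^ N \<le> real N * (\<mu> ^ k / fact k)"
proof -
  have "1 + real N * (poisson_cdf \<mu> k - 1) \<le> (1 + (poisson_cdf \<mu> k - 1)) ^ N"
    using poisson_cdf_bounds[OF assms, of k] by (intro Bernoulli_inequality) simp
  then have "1 - poisson_cdf \<mu> k ^ N \<le> real N * (1 - poisson_cdf \<mu> k)" by (simp add: algebra_simps)
  also have "\<dots> \<le> real N * (\<mu> ^ k / fact k)" by (intro mult_left_mono poisson_cdf_tail_bounds assms) simp
  finally show ?thesis .
qed

text \<open>The two differences of \<open>A\<close> and \<open>B\<close> lie in a null set. For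
  events over a whole time interval, \<open>B\<close> will be a countable description that is
  correct on regular paths.\<close>

lemma in_sets_completion_AE:
  assumes A: "A \<subseteq> space M" and B: "B \<in> sets M" and eq: "AE x in M. x \<in> A \<longleftrightarrow> x \<in> B"
  shows "A \<in> sets (completion M)"
proof -
  from eq obtain N where N: "N \<in> null_sets M" "{x\<in>space M. \<not> (x \<in> A \<longleftrightarrow> x \<in> B)} \<subseteq> N"
    by (auto simp: eventually_ae_filter)
  have "A - B \<subseteq> N" "B - A \<subseteq> N" using N(2) A sets.sets_into_space[OF B] by auto
  then have "A - B \<in> sets (completion M)" "B - A \<in> sets (completion M)"
    using N(1) null_sets_completion by blast+
  then have "(B - (B - A)) \<union> (A - B) \<in> sets (completion M)" using B by auto
  moreover have "(B - (B - A)) \<union> (A - B) = A" by auto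
  ultimately show ?thesis by simp
qed

section \<open>Loads along a path, and measurability of extrema over time\<close>

context one_choice_system begin

lemma load_eq: "load S 1 t \<omega> j =
     card {i. i < init S \<omega> j \<and> t < residual S j i \<omega>}
   + card {k. choice S k 0 \<omega> = j \<and> arrival S k \<omega> \<le> t \<and> t < arrival S k \<omega> + lifetime S k \<omega>}"
  unfolding load_def bin_of_eq ..

lemma init_component_measurable:
  assumes "j < n" shows "(\<lambda>\<omega>. init S \<omega> j) \<in> measurable M (count_space UNIV)"
  using measurable_compose[OF init_measurable, of "\<lambda>x. x j" "count_space UNIV"] assms
  by (simp add: load_space_def)

lemma load_measurable:
  assumes j: "j < n" shows "(\<lambda>\<omega>. load S 1 t \<omega> j) \<in> measurable M (count_space UNIV)"
proof -
  note [measurable] = init_component_measurable[OF j] residual_measurable[OF j]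
  have "(\<lambda>\<omega>. card {i. i < init S \<omega> j \<and> t < residual S j i \<omega>}) \<in> measurable M (count_space UNIV)"
    by (rule measurable_card) simp
  moreover have "(\<lambda>\<omega>. card {k. choice S k 0 \<omega> = j \<and> arrival S k \<omega> \<le> t \<and> t < arrival S k \<omega> + lifetime S k \<omega>}) \<in> measurable M (count_space UNIV)"
    by (rule measurable_card) simp
  ultimately show ?thesis unfolding load_eq by measurable
qed

lemma max_load_le_iff: "max_load S n 1 t \<omega> \<le> k \<longleftrightarrow> (\<forall>j<n. load S 1 t \<omega> j \<le> k)"
  unfolding max_load_def using n_pos by (subst Max_le_iff) auto

lemma max_load_less_iff: "max_load S n 1 t \<omega> < k \<longleftrightarrow> (\<forall>j<n. load S 1 t \<omega> j < k)"
  unfolding max_load_def using n_pos by (subst Max_less_iff) auto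

lemma max_load_measurable[measurable]: "max_load S n 1 t \<in> measurable M (count_space UNIV)"
proof -
  have le: "{\<omega>\<in>space M. max_load S n 1 t \<omega> \<le> k} \<in> events" for k
  proof -
    have "{\<omega>\<in>space M. load S 1 t \<omega> j \<le> k} \<in> events" if "j < n" for j
      using load_measurable[OF that, of t] by measurable
    then have "{\<omega>\<in>space M. \<forall>j\<in>{..<n}. load S 1 t \<omega> j \<le> k} \<in> events"
      by (intro sets.sets_Collect_finite_All) auto
    then show ?thesis by (simp only: max_load_le_iff Ball_def lessThan_iff)
  qed
  show ?thesis
    unfolding measurable_count_space_eq2_countable
  proof safe
    fix k
    have "max_load S n 1 t -` {k} \<inter> space M = {\<omega>\<in>space M. max_load S n 1 t \<omega> \<le> k} - (if k = 0 then {} else {\<omega>\<in>space M. max_load S n 1 t \<omega> \<le> k - 1})"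
      by auto
    then show "max_load S n 1 t -` {k} \<inter> space M \<in> events"
      using le[of k] le[of "k - 1"] by (cases "k = 0") auto
  qed auto
qed

lemma finite_present:
  assumes "regular \<omega>"
  shows "finite {k. choice S k 0 \<omega> = j \<and> arrival S k \<omega> \<le> t \<and> t < arrival S k \<omega> + lifetime S k \<omega>}"
  by (rule finite_subset[OF _ finite_arrivals[OF assms, of t]]) auto

lemma finite_in_region: "regular \<omega> \<Longrightarrow> finite {k. in_region \<tau> v u j k \<omega>}"
  by (rule finite_subset[OF _ finite_arrivals[of \<omega> u]]) (auto simp: in_region_def)

lemma present_eq_region_count:
  assumes "regular \<omega>"
  shows "card {k. choice S k 0 \<omega> = j \<and> arrival S k \<omega> \<le> t \<and> t < arrival S k \<omega> + lifetime S k \<omega>}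
      = region_count (\<lambda>x. x) 0 t j \<omega>"
  unfolding region_count_def in_region_def using arrival_pos[OF assms]
  by (intro arg_cong[where f=card]) auto

lemma region_count_le_load:
  assumes "regular \<omega>"
  shows "region_count (\<lambda>x. x) v u j \<omega> \<le> load S 1 u \<omega> j"
proof -
  have "region_count (\<lambda>x. x) v u j \<omega> \<le> card {k. choice S k 0 \<omega> = j \<and> arrival S k \<omega> \<le> u \<and> u < arrival S k \<omega> + lifetime S k \<omega>}"
    unfolding region_count_def in_region_def by (intro card_mono finite_present assms) auto
  then show ?thesis unfolding load_eq by simp
qed

text \<open>A ball present at \<open>u\<close> was present at \<open>v\<close> or arrived in
  between; departures only lower the load. Read forwards this bounds a rise after \<open>v\<close>,
  read backwards it bounds a fall before \<open>u\<close>.\<close>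

lemma load_le_load_plus_arrivals:
  assumes reg: "regular \<omega>" and vu: "v \<le> u"
  shows "load S 1 u \<omega> j \<le> load S 1 v \<omega> j + region_count (\<lambda>_. 0) v u j \<omega>"
proof -
  have "card {i. i < init S \<omega> j \<and> u < residual S j i \<omega>} \<le> card {i. i < init S \<omega> j \<and> v < residual S j i \<omega>}"
    using vu by (intro card_mono) auto
  moreover have "card {k. choice S k 0 \<omega> = j \<and> arrival S k \<omega> \<le> u \<and> u < arrival S k \<omega> + lifetime S k \<omega>}
    \<le> card ({k. choice S k 0 \<omega> = j \<and> arrival S k \<omega> \<le> v \<and> v < arrival S k \<omega> + lifetime S k \<omega>} \<union> {k. in_region (\<lambda>_. 0) v u j k \<omega>})"
    using vu reg by (intro card_mono finite_UnI finite_present finite_in_region) (auto simp: in_region_def regular_def)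
  moreover have "\<dots> \<le> card {k. choice S k 0 \<omega> = j \<and> arrival S k \<omega> \<le> v \<and> v < arrival S k \<omega> + lifetime S k \<omega>} + card {k. in_region (\<lambda>_. 0) v u j k \<omega>}"
    by (rule card_Un_le)
  ultimately show ?thesis unfolding load_eq region_count_def by linarith
qed

lemma max_load_le_plus:
  assumes "regular \<omega>" "v \<le> u" "\<And>j. j < n \<Longrightarrow> region_count (\<lambda>_. 0) v u j \<omega> \<le> c"
  shows "max_load S n 1 u \<omega> \<le> max_load S n 1 v \<omega> + c"
proof -
  have "load S 1 u \<omega> j \<le> max_load S n 1 v \<omega> + c" if "j < n" for j
    using load_le_load_plus_arrivals[OF assms(1,2), of j] assms(3)[OF that]
      max_load_le_iff[of v \<omega> "max_load S n 1 v \<omega>"] that by fastforce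
  then show ?thesis by (simp add: max_load_le_iff)
qed

lemma region_count_mono:
  assumes "regular \<omega>" "v' \<le> v" "u \<le> u'"
  shows "region_count (\<lambda>_. 0) v u j \<omega> \<le> region_count (\<lambda>_. 0) v' u' j \<omega>"
  unfolding region_count_def using assms(2,3) by (intro card_mono finite_in_region assms(1)) (auto simp: in_region_def)

text \<open>Gives meaning to \<open>Min\<close> and \<open>Max\<close> over an uncountable set of
  times: the maximum load can exceed its initial value by at most the number of arrivals up to
  \<open>T\<close>.\<close>

lemma finite_range_max_load:
  assumes "regular \<omega>"
  shows "finite ((\<lambda>t. max_load S n 1 t \<omega>) ` {0..T})"
proof -
  define c where "c = (\<Sum>j<n. region_count (\<lambda>_. 0) 0 T j \<omega>)"
  have "max_load S n 1 t \<omega> \<le> max_load S n 1 0 \<omega> + c" if "t \<in> {0..T}" for t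
  proof (rule max_load_le_plus[OF assms])
    fix j assume "j < n"
    then have "region_count (\<lambda>_. 0) 0 T j \<omega> \<le> c" unfolding c_def by (intro member_le_sum) auto
    then show "region_count (\<lambda>_. 0) 0 t j \<omega> \<le> c"
      using region_count_mono[OF assms, of 0 0 t T j] that by auto
  qed (use that in auto)
  then have "(\<lambda>t. max_load S n 1 t \<omega>) ` {0..T} \<subseteq> {..max_load S n 1 0 \<omega> + c}" by auto
  then show ?thesis using finite_subset by blast
qed

text \<open>Presence at \<open>t\<close> is decided by comparisons with fixed times, and each of
  these is stable immediately to the right of \<open>t\<close>. Only the finitely many balls
  arriving by \<open>t + 1\<close> and the finitely many initial balls are involved.\<close>

lemma load_right_constant:
  assumes reg: "regular \<omega>"
  shows "eventually (\<lambda>s. load S 1 s \<omega> j = load S 1 t \<omega> j) (at_right t)"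
proof -
  have lt: "eventually (\<lambda>s. s < a \<longleftrightarrow> t < a) (at_right t)" for a
  proof (cases "t < a")
    case True
    then have "eventually (\<lambda>s. s < a) (at_right t)" by (auto simp: eventually_at_right_field)
    then show ?thesis by eventually_elim (use True in auto)
  next
    case False
    have "eventually (\<lambda>s. t < s) (at_right t)" by (simp add: eventually_at_right_less)
    then show ?thesis by eventually_elim (use False in auto)
  qed
  have le: "eventually (\<lambda>s. a \<le> s \<longleftrightarrow> a \<le> t) (at_right t)" for a
    using lt[of a] by eventually_elim auto
  have "eventually (\<lambda>s. \<forall>i\<in>{..<init S \<omega> j}. s < residual S j i \<omega> \<longleftrightarrow> t < residual S j i \<omega>) (at_right t)"
    by (intro eventually_ball_finite ballI lt) auto
  moreover have "eventually (\<lambda>s. \<forall>k\<in>{k. arrival S k \<omega> \<le> t + 1}. (arrival S k \<omega> \<le> s \<longleftrightarrow> arrival S k \<omega> \<le> t) \<and>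
      (s < arrival S k \<omega> + lifetime S k \<omega> \<longleftrightarrow> t < arrival S k \<omega> + lifetime S k \<omega>)) (at_right t)"
    by (intro eventually_ball_finite ballI eventually_conj lt le finite_arrivals[OF reg])
  moreover have "eventually (\<lambda>s. s < t + 1) (at_right t)" by (auto simp: eventually_at_right_field intro!: exI[of _ "t + 1"])
  moreover have "eventually (\<lambda>s. t < s) (at_right t)" by (simp add: eventually_at_right_less)
  ultimately show ?thesis
  proof eventually_elim
    case (elim s)
    have 1: "{i. i < init S \<omega> j \<and> s < residual S j i \<omega>} = {i. i < init S \<omega> j \<and> t < residual S j i \<omega>}"
      using elim(1) by auto
    have "arrival S k \<omega> \<le> s \<and> s < arrival S k \<omega> + lifetime S k \<omega> \<longleftrightarrow> arrival S k \<omega> \<le> t \<and> t < arrival S k \<omega> + lifetime S k \<omega>" for k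
    proof (cases "arrival S k \<omega> \<le> t + 1")
      case True then show ?thesis using elim(2) by blast
    next
      case False then show ?thesis using elim(3,4) by auto
    qed
    with 1 show ?case by (simp add: load_eq)
  qed
qed

lemma max_load_right_constant:
  assumes reg: "regular \<omega>"
  shows "eventually (\<lambda>s. max_load S n 1 s \<omega> = max_load S n 1 t \<omega>) (at_right t)"
proof -
  have "eventually (\<lambda>s. \<forall>j\<in>{..<n}. load S 1 s \<omega> j = load S 1 t \<omega> j) (at_right t)"
    by (intro eventually_ball_finite ballI load_right_constant reg) auto
  then show ?thesis by eventually_elim (simp add: max_load_def)
qed

text \<open>Every value is taken again at a rational time just to the right. The end point
  \<open>T\<close> is added because nothing to its right lies in the interval.\<close>

lemma range_max_load_countable:
  assumes reg: "regular \<omega>"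
  shows "(\<lambda>t. max_load S n 1 t \<omega>) ` {0..T} = (\<lambda>t. max_load S n 1 t \<omega>) ` ({0..T} \<inter> insert T \<rat>)"
proof (intro equalityI subsetI)
  fix x assume "x \<in> (\<lambda>t. max_load S n 1 t \<omega>) ` {0..T}"
  then obtain t where t: "0 \<le> t" "t \<le> T" "x = max_load S n 1 t \<omega>" by auto
  show "x \<in> (\<lambda>t. max_load S n 1 t \<omega>) ` ({0..T} \<inter> insert T \<rat>)"
  proof (cases "t = T")
    case True then show ?thesis using t by auto
  next
    case False
    then have "t < T" using t by simp
    obtain b where b: "b > t" "\<And>s. s > t \<Longrightarrow> s < b \<Longrightarrow> max_load S n 1 s \<omega> = x"
      using max_load_right_constant[OF reg, of t] t(3) by (auto simp: eventually_at_right_field)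
    obtain s where "s \<in> \<rat>" "t < s" "s < min b T" using Rats_dense_in_real[of t "min b T"] b(1) \<open>t < T\<close> by auto
    then show ?thesis using b(2)[of s] t by (intro image_eqI[of _ _ s]) auto
  qed
qed auto

text \<open>Covers \<open>Min\<close> with \<le> and \<open>Max\<close> with \<ge>: the extremum is
  the unique member of the range that is related by \<open>R\<close> to all members, a condition on
  countably many times.\<close>

lemma measurable_over_range:
  assumes T: "0 \<le> T"
    and F: "\<And>A. finite A \<Longrightarrow> A \<noteq> {} \<Longrightarrow> F A \<in> A \<and> (\<forall>x\<in>A. R (F A) x)"
    and R: "\<And>x y. R x y \<Longrightarrow> R y x \<Longrightarrow> x = y"
  shows "{\<omega>\<in>space M. P (F ((\<lambda>t. max_load S n 1 t \<omega>) ` {0..T}))} \<in> sets (completion M)"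
proof (rule in_sets_completion_AE)
  define Q where "Q = {0..T} \<inter> insert T \<rat>"
  have Q: "countable Q" unfolding Q_def by (simp add: countable_rat countable_Int2)
  have Q0: "Q \<noteq> {}" using T by (auto simp: Q_def)
  let ?B = "{\<omega>\<in>space M. \<exists>x. P x \<and> (\<forall>t\<in>Q. R x (max_load S n 1 t \<omega>)) \<and> (\<exists>t\<in>Q. max_load S n 1 t \<omega> = x)}"
  show "?B \<in> events"
    using Q by measurable
  show "AE \<omega> in M. \<omega> \<in> {\<omega>\<in>space M. P (F ((\<lambda>t. max_load S n 1 t \<omega>) ` {0..T}))} \<longleftrightarrow> \<omega> \<in> ?B"
    using AE_regular
  proof eventually_elim
    case (elim \<omega>)
    let ?I = "(\<lambda>t. max_load S n 1 t \<omega>) ` Q"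
    have I: "(\<lambda>t. max_load S n 1 t \<omega>) ` {0..T} = ?I" unfolding Q_def by (rule range_max_load_countable[OF elim])
    have "finite ?I" using finite_range_max_load[OF elim, of T] unfolding I .
    then have FI: "F ?I \<in> ?I" "\<forall>x\<in>?I. R (F ?I) x" using F[of ?I] Q0 by auto
    have "P (F ?I) \<longleftrightarrow> (\<exists>x. P x \<and> (\<forall>t\<in>Q. R x (max_load S n 1 t \<omega>)) \<and> (\<exists>t\<in>Q. max_load S n 1 t \<omega> = x))"
    proof
      assume "P (F ?I)"
      then show "\<exists>x. P x \<and> (\<forall>t\<in>Q. R x (max_load S n 1 t \<omega>)) \<and> (\<exists>t\<in>Q. max_load S n 1 t \<omega> = x)"
        using FI by (intro exI[of _ "F ?I"]) auto
    next
      assume "\<exists>x. P x \<and> (\<forall>t\<in>Q. R x (max_load S n 1 t \<omega>)) \<and> (\<exists>t\<in>Q. max_load S n 1 t \<omega> = x)"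
      then obtain x where x: "P x" "\<forall>y\<in>?I. R x y" "x \<in> ?I" by auto
      then have "x = F ?I" using FI by (intro R) auto
      then show "P (F ?I)" using x by simp
    qed
    then have "P (F ((\<lambda>t. max_load S n 1 t \<omega>) ` {0..T})) \<longleftrightarrow>
        (\<exists>x. P x \<and> (\<forall>t\<in>Q. R x (max_load S n 1 t \<omega>)) \<and> (\<exists>t\<in>Q. max_load S n 1 t \<omega> = x))"
      by (simp only: I)
    then show ?case by (simp only: mem_Collect_eq)
  qed
qed auto

lemma measurable_MIN_max_load:
  "0 \<le> T \<Longrightarrow> {\<omega>\<in>space M. P (MIN t\<in>{0..T}. max_load S n 1 t \<omega>)} \<in> sets (completion M)"
  by (rule measurable_over_range[where R="(\<le>)"]) auto

lemma measurable_MAX_max_load: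
  "0 \<le> T \<Longrightarrow> {\<omega>\<in>space M. P (MAX t\<in>{0..T}. max_load S n 1 t \<omega>)} \<in> sets (completion M)"
  by (rule measurable_over_range[where R="(\<ge>)"]) auto


section \<open>Probabilities of load and arrival events\<close>

lemma prob_present_less:
  assumes "0 \<le> t"
  shows "prob {\<omega>\<in>space M. \<forall>j<n. region_count (\<lambda>x. x) 0 t j \<omega> < k} = poisson_cdf (lam * (1 - exp (- t))) k ^ n"
proof -
  have "prob {\<omega>\<in>space M. \<forall>j\<in>{..<n}. region_count (\<lambda>x. x) 0 t j \<omega> < k}
      = (\<Prod>j\<in>{..<n}. poisson_cdf (lam * (1 - exp (- (t - 0)))) k)"
    by (rule joint_region_prob[where v="\<lambda>_. 0" and u="\<lambda>_. t" and j="\<lambda>j. j" and \<Psi>="\<lambda>x. 1 - exp (- x)"])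
       (use assms in \<open>auto intro!: derivative_eq_intros\<close>)
  then show ?thesis by (simp add: Ball_def)
qed

lemma prob_arrivals_ge:
  assumes "0 \<le> v" "v \<le> u" "j < n"
  shows "prob {\<omega>\<in>space M. b \<le> region_count (\<lambda>_. 0) v u j \<omega>} \<le> (lam * (u - v)) ^ b"
proof -
  let ?N = "region_count (\<lambda>_. 0) v u j"
  have m: "?N \<in> measurable M (count_space UNIV)" by (rule region_count_measurable) simp
  have "prob {\<omega>\<in>space M. \<forall>l\<in>{()}. ?N \<omega> < b} = (\<Prod>l\<in>{()}. poisson_cdf (lam * (u - v)) b)"
    by (rule joint_region_prob[where v="\<lambda>_. v" and u="\<lambda>_. u" and j="\<lambda>_. j" and \<Psi>="\<lambda>x. x"])
       (use assms in auto)
  then have eq: "prob {\<omega>\<in>space M. ?N \<omega> < b} = poisson_cdf (lam * (u - v)) b" by simp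
  have "{\<omega>\<in>space M. ?N \<omega> < b} \<in> events" using m by measurable
  then have "prob (space M - {\<omega>\<in>space M. ?N \<omega> < b}) = 1 - poisson_cdf (lam * (u - v)) b"
    by (simp add: prob_compl eq)
  also have "space M - {\<omega>\<in>space M. ?N \<omega> < b} = {\<omega>\<in>space M. b \<le> ?N \<omega>}" by auto
  also have "1 - poisson_cdf (lam * (u - v)) b \<le> (lam * (u - v)) ^ b / fact b"
    using assms lam_pos by (intro poisson_cdf_tail_bounds) simp
  also have "\<dots> \<le> (lam * (u - v)) ^ b"
    using assms lam_pos divide_left_mono[of 1 "fact b" "(lam * (u - v)) ^ b"] by (simp add: fact_ge_1)
  finally show ?thesis .
qed

lemma prob_grid_arrivals_ge:
  assumes "0 \<le> h"
  shows "prob {\<omega>\<in>space M. \<exists>i<G. \<exists>j<n. b \<le> region_count (\<lambda>_. 0) (h * real i) (h * real (Suc i)) j \<omega>}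
     \<le> real G * real n * (lam * h) ^ b"
proof -
  let ?A = "\<lambda>(i, j). {\<omega>\<in>space M. b \<le> region_count (\<lambda>_. 0) (h * real i) (h * real (Suc i)) j \<omega>}"
  have "region_count (\<lambda>_. 0) v u j \<in> measurable M (count_space UNIV)" for v u j by (rule region_count_measurable) simp
  then have ev: "?A p \<in> events" for p by (cases p) simp
  have "prob {\<omega>\<in>space M. \<exists>i<G. \<exists>j<n. b \<le> region_count (\<lambda>_. 0) (h * real i) (h * real (Suc i)) j \<omega>}
      = prob (\<Union>p\<in>{..<G} \<times> {..<n}. ?A p)" by (intro arg_cong[where f=prob]) auto
  also have "\<dots> \<le> (\<Sum>p\<in>{..<G} \<times> {..<n}. prob (?A p))"
    using ev by (intro finite_measure_subadditive_finite) auto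
  also have "\<dots> \<le> (\<Sum>p\<in>{..<G} \<times> {..<n}. (lam * h) ^ b)"
  proof (rule sum_mono)
    fix p assume "p \<in> {..<G} \<times> {..<n}"
    then obtain i j where p: "p = (i, j)" "j < n" by auto
    have "h * real i \<le> h * real (Suc i)" using assms by (intro mult_left_mono) auto
    from prob_arrivals_ge[OF _ this p(2), of b] assms
    show "prob (?A p) \<le> (lam * h) ^ b" by (simp add: p(1) algebra_simps)
  qed
  also have "\<dots> = real G * real n * (lam * h) ^ b" by (simp add: card_cartesian_product)
  finally show ?thesis .
qed

text \<open>Loads at different times are correlated, but balls of disjoint windows are not. The
  price is the smaller mean \<open>lam * (1 - exp (- 1))\<close>, which does not affect the leading
  order of the maximum.\<close>

lemma prob_no_large_batch:
  "prob {\<omega>\<in>space M. \<forall>i<G. \<forall>j<n. region_count (\<lambda>x. x) (real i) (real (Suc i)) j \<omega> < k}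
     = poisson_cdf (lam * (1 - exp (- 1))) k ^ (G * n)"
proof -
  have "prob {\<omega>\<in>space M. \<forall>p\<in>{..<G} \<times> {..<n}. region_count (\<lambda>x. x) (real (fst p)) (real (Suc (fst p))) (snd p) \<omega> < k}
      = (\<Prod>p\<in>{..<G} \<times> {..<n}. poisson_cdf (lam * (1 - exp (- (real (Suc (fst p)) - real (fst p))))) k)"
    by (rule joint_region_prob[where v="\<lambda>p. real (fst p)" and u="\<lambda>p. real (Suc (fst p))" and j="snd" and \<Psi>="\<lambda>x. 1 - exp (- x)"])
       (auto intro!: derivative_eq_intros)
  moreover have "{\<omega>\<in>space M. \<forall>p\<in>{..<G} \<times> {..<n}. region_count (\<lambda>x. x) (real (fst p)) (real (Suc (fst p))) (snd p) \<omega> < k}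
     = {\<omega>\<in>space M. \<forall>i<G. \<forall>j<n. region_count (\<lambda>x. x) (real i) (real (Suc i)) j \<omega> < k}" by auto
  ultimately show ?thesis by (simp add: card_cartesian_product)
qed

lemma poisson_cdf_tendsto:
  "(f \<longlongrightarrow> \<mu>) F \<Longrightarrow> ((\<lambda>x. poisson_cdf (f x) k) \<longlongrightarrow> poisson_cdf \<mu> k) F"
  unfolding poisson_cdf_def by (intro tendsto_intros) auto

text \<open>The initial balls die out, so by stationarity the law of the load vector is the limit of the
  law of the balls that arrived after time 0, which are independent Poisson counts.\<close>

lemma prob_max_load_less:
  assumes stat: "stationary S n 1" and t: "0 \<le> t"
  shows "prob {\<omega>\<in>space M. max_load S n 1 t \<omega> < k} = poisson_cdf lam k ^ n"
proof -
  define p where "p t = prob {\<omega>\<in>space M. max_load S n 1 t \<omega> < k}" for t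
  let ?B = "{f\<in>space (load_space n). \<forall>j\<in>{..<n}. f j < k}"
  have B: "?B \<in> sets (load_space n)"
  proof (rule sets.sets_Collect_finite_All)
    fix j assume j: "j \<in> {..<n}"
    have "(\<lambda>f. f j) \<in> measurable (load_space n) (count_space UNIV)"
      unfolding load_space_def by (rule measurable_component_singleton[OF j])
    then show "{f\<in>space (load_space n). f j < k} \<in> sets (load_space n)" by measurable
  qed simp
  have p_law: "p t = measure (load_law S n 1 t) ?B" if "0 \<le> t" for t
  proof -
    have m: "(\<lambda>\<omega>. \<lambda>j\<in>{..<n}. load S 1 t \<omega> j) \<in> measurable M (load_space n)"
      unfolding load_space_def by (rule measurable_restrict) (use load_measurable in auto)
    have "measure (load_law S n 1 t) ?B = prob ((\<lambda>\<omega>. \<lambda>j\<in>{..<n}. load S 1 t \<omega> j) -` ?B \<inter> space M)"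
      unfolding load_law_def by (rule measure_distr[OF m B])
    also have "(\<lambda>\<omega>. \<lambda>j\<in>{..<n}. load S 1 t \<omega> j) -` ?B \<inter> space M = {\<omega>\<in>space M. max_load S n 1 t \<omega> < k}"
      using measurable_space[OF m] by (auto simp: max_load_less_iff)
    finally show ?thesis by (simp add: p_def)
  qed
  have const: "p (real N) = p t" for N
    using stat t p_law[OF t] p_law[of "real N"] by (simp add: stationary_def)
  define q where "q N = prob {\<omega>\<in>space M. \<forall>j<n. region_count (\<lambda>x. x) 0 (real N) j \<omega> < k}" for N :: nat
  have "(\<lambda>N. poisson_cdf (lam * (1 - exp (- real N))) k ^ n) \<longlonglongrightarrow> poisson_cdf (lam * (1 - 0)) k ^ n"
    by (intro tendsto_power poisson_cdf_tendsto tendsto_mult tendsto_diff tendsto_const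
        filterlim_compose[OF exp_at_bot] filterlim_compose[OF filterlim_uminus_at_bot_at_top] filterlim_real_sequentially)
  then have q_lim: "q \<longlonglongrightarrow> poisson_cdf lam k ^ n"
    unfolding q_def by (simp add: prob_present_less)
  \<comment> \<open>The event that some initial ball is still alive at time \<open>N\<close>. These
    events decrease to the empty set because each outcome has finitely many initial balls, so no
    estimate on the initial law is called for. Off \<open>D N\<close> the load consists of new balls
    only, whence \<open>q N - prob (D N) \<le> p (real N) \<le> q N\<close>.\<close>
  define D where "D N = {\<omega>\<in>space M. \<exists>j<n. \<exists>i<init S \<omega> j. real N < residual S j i \<omega>}" for N :: nat
  have D_ev: "D N \<in> events" for N
  proof -
    have "{\<omega>\<in>space M. \<exists>i<init S \<omega> j. real N < residual S j i \<omega>} \<in> events" if "j < n" for j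
    proof -
      note [measurable] = init_component_measurable[OF that] residual_measurable[OF that]
      have "{\<omega>\<in>space M. \<exists>i. i < init S \<omega> j \<and> real N < residual S j i \<omega>} \<in> events" by measurable
      then show ?thesis by simp
    qed
    then have "{\<omega>\<in>space M. \<exists>j\<in>{..<n}. \<exists>i<init S \<omega> j. real N < residual S j i \<omega>} \<in> events"
      by (intro sets.sets_Collect_finite_Ex) auto
    then show ?thesis by (simp only: D_def Bex_def lessThan_iff)
  qed
  have "(\<lambda>N. prob (D N)) \<longlonglongrightarrow> prob (\<Inter>N. D N)"
  proof (rule finite_Lim_measure_decseq)
    show "range D \<subseteq> events" using D_ev by auto
    show "decseq D" unfolding decseq_def D_def by (auto intro: order.strict_trans1 of_nat_mono)
  qed
  moreover have "(\<Inter>N. D N) = {}"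
  proof (intro equals0I)
    fix \<omega> assume \<omega>: "\<omega> \<in> (\<Inter>N. D N)"
    define c where "c = (\<Sum>j<n. \<Sum>i<init S \<omega> j. \<bar>residual S j i \<omega>\<bar>)"
    obtain N :: nat where N: "c \<le> real N" using real_arch_simple by blast
    from \<omega> have "\<omega> \<in> D N" by blast
    then obtain j i where ji: "j < n" "i < init S \<omega> j" "real N < residual S j i \<omega>" by (auto simp: D_def)
    have "\<bar>residual S j i \<omega>\<bar> \<le> (\<Sum>i<init S \<omega> j. \<bar>residual S j i \<omega>\<bar>)"
      using ji(2) by (intro member_le_sum) auto
    also have "\<dots> \<le> c" unfolding c_def
      using ji(1) by (intro member_le_sum[of j "{..<n}" "\<lambda>j. \<Sum>i<init S \<omega> j. \<bar>residual S j i \<omega>\<bar>"]) (auto intro!: sum_nonneg)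
    finally show False using ji(3) N by linarith
  qed
  ultimately have D_lim: "(\<lambda>N. prob (D N)) \<longlonglongrightarrow> 0" by simp
  let ?R = "\<lambda>N. {\<omega>\<in>space M. \<forall>j<n. region_count (\<lambda>x. x) 0 (real N) j \<omega> < k}"
  let ?X = "\<lambda>N. {\<omega>\<in>space M. max_load S n 1 (real N) \<omega> < k}"
  have R_ev: "?R N \<in> events" for N
  proof -
    have "{\<omega>\<in>space M. region_count (\<lambda>x. x) 0 (real N) j \<omega> < k} \<in> events" for j
      using region_count_measurable[of "\<lambda>x. x" 0 "real N" j] by measurable
    then have "{\<omega>\<in>space M. \<forall>j\<in>{..<n}. region_count (\<lambda>x. x) 0 (real N) j \<omega> < k} \<in> events"
      by (intro sets.sets_Collect_finite_All) auto
    then show ?thesis by (simp only: Ball_def lessThan_iff)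
  qed
  have X_ev: "?X N \<in> events" for N by measurable
  have pq: "p (real N) \<le> q N" for N
    unfolding p_def q_def
  proof (rule finite_measure_mono_AE[OF _ R_ev])
    show "AE \<omega> in M. \<omega> \<in> ?X N \<longrightarrow> \<omega> \<in> ?R N"
      using AE_regular
    proof eventually_elim
      case (elim \<omega>)
      then show ?case using region_count_le_load[OF elim, of 0 "real N"]
        by (auto simp: max_load_less_iff intro: le_less_trans)
    qed
  qed
  have qp: "q N - prob (D N) \<le> p (real N)" for N
  proof -
    have "q N \<le> prob (?X N \<union> D N)"
      unfolding q_def
    proof (rule finite_measure_mono_AE)
      show "?X N \<union> D N \<in> events" using X_ev D_ev by blast
      show "AE \<omega> in M. \<omega> \<in> ?R N \<longrightarrow> \<omega> \<in> ?X N \<union> D N"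
        using AE_regular
      proof eventually_elim
        case (elim \<omega>)
        have "load S 1 (real N) \<omega> j = region_count (\<lambda>x. x) 0 (real N) j \<omega>" if "\<omega> \<notin> D N" "\<omega> \<in> space M" "j < n" for j
        proof -
          have "{i. i < init S \<omega> j \<and> real N < residual S j i \<omega>} = {}" using that by (auto simp: D_def)
          then show ?thesis unfolding load_eq present_eq_region_count[OF elim] by simp
        qed
        then show ?case by (auto simp: max_load_less_iff)
      qed
    qed
    also have "\<dots> \<le> p (real N) + prob (D N)"
      unfolding p_def by (rule measure_Un_le[OF X_ev D_ev])
    finally show ?thesis by simp
  qed
  have "p t \<le> poisson_cdf lam k ^ n"
    using pq const by (intro LIMSEQ_le_const[OF q_lim]) auto
  moreover have "poisson_cdf lam k ^ n - 0 \<le> p t"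
    using qp const by (intro LIMSEQ_le_const2[OF tendsto_diff[OF q_lim D_lim]]) auto
  ultimately show ?thesis by (simp add: p_def)
qed

lemma prob_max_load_less_le:
  assumes "stationary S n 1" "0 \<le> t"
  shows "prob {\<omega>\<in>space M. max_load S n 1 t \<omega> < k} \<le> exp (- (real n * (exp (-lam) * (lam ^ k / fact k))))"
  unfolding prob_max_load_less[OF assms] using lam_pos by (intro poisson_cdf_power_le) simp

lemma prob_max_load_ge_le:
  assumes "stationary S n 1" "0 \<le> t"
  shows "prob {\<omega>\<in>space M. k \<le> max_load S n 1 t \<omega>} \<le> real n * (lam ^ k / fact k)"
proof -
  have "{\<omega>\<in>space M. max_load S n 1 t \<omega> < k} \<in> events" by measurable
  then have "prob (space M - {\<omega>\<in>space M. max_load S n 1 t \<omega> < k}) = 1 - poisson_cdf lam k ^ n"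
    using prob_max_load_less[OF assms, of k] by (simp add: prob_compl)
  also have "space M - {\<omega>\<in>space M. max_load S n 1 t \<omega> < k} = {\<omega>\<in>space M. k \<le> max_load S n 1 t \<omega>}" by auto
  also have "1 - poisson_cdf lam k ^ n \<le> real n * (lam ^ k / fact k)"
    using lam_pos by (intro one_minus_poisson_cdf_power_le) simp
  finally show ?thesis .
qed

end

subsection \<open>Asymptotics of the typical maximum load\<close>

text \<open>The lower bound is k^k / k! \<le> e^k, here read off from the Poisson tail bound with
  mean \<open>k\<close>; the upper bound is k! \<le> k^k.\<close>

lemma ln_fact_bounds:
  assumes "k \<ge> 1"
  shows "real k * ln (real k) - real k \<le> ln (fact k)" "ln (fact k) \<le> real k * ln (real k)"
proof -
  have "exp (- real k) * (real k ^ k / fact k) \<le> 1"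
    using order_trans[OF poisson_cdf_tail_bounds(1)[of "real k" k], of 1] poisson_cdf_bounds(1)[of "real k" k] by simp
  then have "exp (- real k) * real k ^ k \<le> fact k" by (simp add: field_simps)
  then have "ln (exp (- real k) * real k ^ k) \<le> ln (fact k)" using assms by (subst ln_le_cancel_iff) auto
  then show "real k * ln (real k) - real k \<le> ln (fact k)" using assms by (simp add: ln_mult ln_realpow)
  have "fact k \<le> real k ^ k" using fact_le_power[of k, where 'a=real] by simp
  then have "ln (fact k) \<le> ln (real k ^ k)" using assms by (subst ln_le_cancel_iff) auto
  then show "ln (fact k) \<le> real k * ln (real k)" using assms by (simp add: ln_realpow)
qed

lemma ln_fact_asymp: "(\<lambda>k. ln (fact k) / (real k * ln (real k))) \<longlonglongrightarrow> 1"
proof (rule tendsto_sandwich)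
  show "(\<lambda>k::nat. (real k * ln (real k) - real k) / (real k * ln (real k))) \<longlonglongrightarrow> 1" by real_asymp
  show "\<forall>\<^sub>F k in sequentially. (real k * ln (real k) - real k) / (real k * ln (real k)) \<le> ln (fact k) / (real k * ln (real k))"
    using eventually_ge_at_top[of 2] by eventually_elim (intro divide_right_mono ln_fact_bounds, auto)
  show "\<forall>\<^sub>F k in sequentially. ln (fact k) / (real k * ln (real k)) \<le> 1"
    using eventually_ge_at_top[of 2]
  proof eventually_elim
    case (elim k)
    then show ?case using ln_fact_bounds(2)[of k] by (subst divide_le_eq_1_pos) auto
  qed
qed auto

text \<open>For k asymptotic to c ln n / ln ln n one has ln k asymptotic to ln ln n, so ln k! is
  asymptotic to k ln k and thus to c ln n, while k ln \<mu> is only o(ln n). Hence \<mu> drops out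
  of the exponent.\<close>

lemma poisson_weight_exponent:
  fixes k :: "nat \<Rightarrow> nat"
  assumes k: "(\<lambda>n. real (k n) * (ln (ln (real n)) / ln (real n))) \<longlonglongrightarrow> c" and c: "c > 0" and \<mu>: "\<mu> > 0"
  shows "(\<lambda>n. ln (\<mu> ^ k n / fact (k n)) / ln (real n)) \<longlonglongrightarrow> - c"
proof -
  define x where "x n = real (k n) * (ln (ln (real n)) / ln (real n))" for n
  have x: "x \<longlonglongrightarrow> c" using k unfolding x_def .
  have big: "\<forall>\<^sub>F n in sequentially. ln (ln (real n)) > 1" by real_asymp
  have big1: "\<forall>\<^sub>F n in sequentially. ln (real n) > 1" by real_asymp
  have xpos: "\<forall>\<^sub>F n in sequentially. x n > 0" using x c by (rule order_tendstoD)
  have k_eq: "\<forall>\<^sub>F n in sequentially. real (k n) = x n * (ln (real n) / ln (ln (real n)))"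
    using big big1 by eventually_elim (simp add: x_def)
  have "filterlim (\<lambda>n. x n * (ln (real n) / ln (ln (real n)))) at_top sequentially"
    by (rule filterlim_tendsto_pos_mult_at_top[OF x c]) real_asymp
  then have "filterlim (\<lambda>n. real (k n)) at_top sequentially"
    by (rule filterlim_cong[THEN iffD2, rotated -1]) (use k_eq in auto)
  then have k_top: "filterlim k at_top sequentially"
    by (simp add: filterlim_sequentially_iff_filterlim_real)
  have lnk: "(\<lambda>n. ln (real (k n)) / ln (ln (real n))) \<longlonglongrightarrow> 1"
  proof -
    have "(\<lambda>n. ln (x n) * (1 / ln (ln (real n))) + 1 - ln (ln (ln (real n))) / ln (ln (real n))) \<longlonglongrightarrow> ln c * 0 + 1 - 0"
      by (intro tendsto_intros x) (use c in auto, real_asymp+)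
    moreover have "\<forall>\<^sub>F n in sequentially. ln (x n) * (1 / ln (ln (real n))) + 1 - ln (ln (ln (real n))) / ln (ln (real n)) = ln (real (k n)) / ln (ln (real n))"
      using k_eq big big1 xpos
    proof eventually_elim
      case (elim n)
      then have "ln (real (k n)) = ln (x n) + (ln (ln (real n)) - ln (ln (ln (real n))))"
        by (simp add: ln_mult ln_div)
      then show ?case using elim(2) by (simp add: add_divide_distrib diff_divide_distrib)
    qed
    ultimately show ?thesis by (simp add: filterlim_cong)
  qed
  have f: "(\<lambda>n. ln (fact (k n)) / (real (k n) * ln (real (k n)))) \<longlonglongrightarrow> 1"
    by (rule filterlim_compose[OF ln_fact_asymp k_top])
  have "(\<lambda>n. x n * (1 / ln (ln (real n))) * ln \<mu> -
      ln (fact (k n)) / (real (k n) * ln (real (k n))) * (x n * (ln (real (k n)) / ln (ln (real n))))) \<longlonglongrightarrow> c * 0 * ln \<mu> - 1 * (c * 1)"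
    by (intro tendsto_intros x f lnk) real_asymp
  moreover have "\<forall>\<^sub>F n in sequentially. x n * (1 / ln (ln (real n))) * ln \<mu> -
      ln (fact (k n)) / (real (k n) * ln (real (k n))) * (x n * (ln (real (k n)) / ln (ln (real n)))) = ln (\<mu> ^ k n / fact (k n)) / ln (real n)"
    using big big1 filterlim_at_top[THEN iffD1, OF k_top, rule_format, of 2]
  proof eventually_elim
    case (elim n)
    then have "ln (real (k n)) > 0" "real (k n) > 0" by auto
    moreover have "ln (\<mu> ^ k n / fact (k n)) = real (k n) * ln \<mu> - ln (fact (k n))"
      using \<mu> by (simp add: ln_div ln_realpow)
    ultimately show ?case using elim by (simp add: x_def field_simps)
  qed
  ultimately show ?thesis by (simp add: filterlim_cong)
qed

text \<open>Since the weight is n^(-c + o(1)), there is a sharp change at \<open>e = c\<close>. It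
  is used with \<open>real n powr e\<close> counting bins and times together.\<close>

lemma powr_poisson_weight_asymp:
  fixes k :: "nat \<Rightarrow> nat"
  assumes k: "(\<lambda>n. real (k n) * (ln (ln (real n)) / ln (real n))) \<longlonglongrightarrow> c" and c: "c > 0" and \<mu>: "\<mu> > 0"
  shows "e < c \<Longrightarrow> (\<lambda>n. real n powr e * (\<mu> ^ k n / fact (k n))) \<longlonglongrightarrow> 0"
    and "e > c \<Longrightarrow> filterlim (\<lambda>n. real n powr e * (\<mu> ^ k n / fact (k n))) at_top sequentially"
proof -
  let ?r = "\<lambda>n. ln (\<mu> ^ k n / fact (k n)) / ln (real n)"
  have lim: "(\<lambda>n. e + ?r n) \<longlonglongrightarrow> e + - c" by (intro tendsto_intros poisson_weight_exponent assms)
  have L: "filterlim (\<lambda>n. ln (real n)) at_top sequentially" by real_asymp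
  have "\<forall>\<^sub>F n in sequentially. ln (real n) > 1" by real_asymp
  then have eq: "\<forall>\<^sub>F n in sequentially. exp ((e + ?r n) * ln (real n)) = real n powr e * (\<mu> ^ k n / fact (k n))"
    using eventually_gt_at_top[of 0]
  proof eventually_elim
    case (elim n)
    have "(e + q / l) * l = e * l + q" if "l > 1" for q l :: real using that by (simp add: field_simps)
    from this[OF elim(1)] have "(e + ?r n) * ln (real n) = e * ln (real n) + ln (\<mu> ^ k n / fact (k n))" .
    then show ?case using elim \<mu> by (simp add: exp_add powr_def)
  qed
  show "(\<lambda>n. real n powr e * (\<mu> ^ k n / fact (k n))) \<longlonglongrightarrow> 0" if "e < c"
  proof -
    have "filterlim (\<lambda>n. (e + ?r n) * ln (real n)) at_bot sequentially"
      by (rule filterlim_tendsto_neg_mult_at_bot[OF lim _ L]) (use that in simp)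
    from filterlim_compose[OF exp_at_bot this] show ?thesis using eq by (simp add: filterlim_cong)
  qed
  show "filterlim (\<lambda>n. real n powr e * (\<mu> ^ k n / fact (k n))) at_top sequentially" if "e > c"
  proof -
    have "filterlim (\<lambda>n. (e + ?r n) * ln (real n)) at_top sequentially"
      by (rule filterlim_tendsto_pos_mult_at_top[OF lim _ L]) (use that in simp)
    from filterlim_compose[OF exp_at_top this] show ?thesis using eq by (simp add: filterlim_cong)
  qed
qed

lemma nat_ceiling_ratio:
  assumes "a > 0"
  shows "(\<lambda>n. real (nat \<lceil>a * ln (real n) / ln (ln (real n))\<rceil>) * (ln (ln (real n)) / ln (real n))) \<longlonglongrightarrow> a"
proof (rule tendsto_sandwich)
  have ev: "\<forall>\<^sub>F n in sequentially. ln (ln (real n)) > 1 \<and> ln (real n) > 1"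
    by (intro eventually_conj) real_asymp+
  show "\<forall>\<^sub>F n in sequentially. a \<le> real (nat \<lceil>a * ln (real n) / ln (ln (real n))\<rceil>) * (ln (ln (real n)) / ln (real n))"
    using ev
  proof eventually_elim
    case (elim n)
    have "a * ln (real n) / ln (ln (real n)) * (ln (ln (real n)) / ln (real n)) \<le> real (nat \<lceil>a * ln (real n) / ln (ln (real n))\<rceil>) * (ln (ln (real n)) / ln (real n))"
      using elim by (intro mult_right_mono real_nat_ceiling_ge) auto
    then show ?case using elim by simp
  qed
  show "\<forall>\<^sub>F n in sequentially. real (nat \<lceil>a * ln (real n) / ln (ln (real n))\<rceil>) * (ln (ln (real n)) / ln (real n)) \<le> a + ln (ln (real n)) / ln (real n)"
    using ev
  proof eventually_elim
    case (elim n)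
    have "0 \<le> a * ln (real n) / ln (ln (real n))" using assms elim by simp
    then have "real (nat \<lceil>a * ln (real n) / ln (ln (real n))\<rceil>) \<le> a * ln (real n) / ln (ln (real n)) + 1"
      using of_int_ceiling_le_add_one[of "a * ln (real n) / ln (ln (real n))"] by (simp add: of_nat_nat)
    then have "real (nat \<lceil>a * ln (real n) / ln (ln (real n))\<rceil>) * (ln (ln (real n)) / ln (real n)) \<le> (a * ln (real n) / ln (ln (real n)) + 1) * (ln (ln (real n)) / ln (real n))"
      using elim by (intro mult_right_mono) auto
    also have "\<dots> = a + ln (ln (real n)) / ln (real n)" using elim by (simp add: field_simps)
    finally show ?case .
  qed
  have "(\<lambda>n. a + ln (ln (real n)) / ln (real n)) \<longlonglongrightarrow> a + 0" by (intro tendsto_intros) real_asymp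
  then show "(\<lambda>n. a + ln (ln (real n)) / ln (real n)) \<longlonglongrightarrow> a" by simp
qed auto

text \<open>Comparing \<open>n lam\<^sup>k / k!\<close> with \<open>1 / sqrt k\<close> rather than with a constant makes the expected number of bins
  of load at least \<open>m + 1\<close> vanish while that for \<open>m - 1\<close> diverges, so that two values suffice.\<close>

definition level :: "real \<Rightarrow> nat \<Rightarrow> nat" where
  "level lam n = (LEAST k. 1 \<le> k \<and> real n * (lam ^ k / fact k) * sqrt (real k) < 1) - 1"

context
  fixes lam :: real
  assumes lam: "lam > 0"
begin

lemma level_exists: "\<exists>k. 1 \<le> k \<and> real n * (lam ^ k / fact k) * sqrt (real k) < 1"
proof -
  have "summable (\<lambda>k. lam ^ k / fact k)" using summable_exp[of lam] by (simp add: field_simps)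
  then have "(\<lambda>k. lam ^ k / fact k) \<longlonglongrightarrow> 0" by (rule summable_LIMSEQ_zero)
  then have "(\<lambda>k. real n * lam * (lam ^ k / fact k)) \<longlonglongrightarrow> real n * lam * 0" by (intro tendsto_intros)
  then have "\<forall>\<^sub>F k in sequentially. real n * lam * (lam ^ k / fact k) < 1" by (rule order_tendstoD) simp
  then obtain k where k: "real n * lam * (lam ^ k / fact k) < 1" by (auto simp: eventually_sequentially)
  \<comment> \<open>The larger factor \<open>Suc k\<close> in place of the square root cancels
    against the factorial and leaves a weight known to vanish.\<close>
  have "real n * (lam ^ Suc k / fact (Suc k)) * sqrt (real (Suc k)) \<le> real n * (lam ^ Suc k / fact (Suc k)) * real (Suc k)"
  proof (rule mult_left_mono)
    show "sqrt (real (Suc k)) \<le> real (Suc k)" by (rule real_le_lsqrt) (auto simp: power2_eq_square algebra_simps)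
  qed (use lam in simp)
  also have "\<dots> = real n * ((lam ^ Suc k / fact (Suc k)) * real (Suc k))" by (simp only: mult.assoc)
  also have "(lam ^ Suc k / fact (Suc k)) * real (Suc k) = lam * (lam ^ k / fact k)" by (simp del: of_nat_Suc)
  also have "real n * (lam * (lam ^ k / fact k)) = real n * lam * (lam ^ k / fact k)" by (simp only: mult.assoc)
  finally have "real n * (lam ^ Suc k / fact (Suc k)) * sqrt (real (Suc k)) < 1" using k by (rule le_less_trans)
  moreover have "1 \<le> Suc k" by simp
  ultimately show ?thesis by blast
qed

lemma level_upper: "real n * (lam ^ Suc (level lam n) / fact (Suc (level lam n))) * sqrt (real (Suc (level lam n))) < 1"
proof -
  let ?P = "\<lambda>k. 1 \<le> k \<and> real n * (lam ^ k / fact k) * sqrt (real k) < 1"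
  have "?P (LEAST k. ?P k)" by (rule LeastI_ex) (rule level_exists)
  \<comment> \<open>The clause \<open>1 \<le> k\<close> keeps out \<open>k = 0\<close>, where the
    square root vanishes. So the least \<open>k\<close> is positive and the truncated subtraction in
    \<open>level\<close> loses nothing.\<close>
  moreover have "Suc (level lam n) = (LEAST k. ?P k)" using calculation by (simp add: level_def)
  ultimately show ?thesis by simp
qed

lemma level_lower:
  assumes "1 \<le> k" "k \<le> level lam n"
  shows "1 \<le> real n * (lam ^ k / fact k) * sqrt (real k)"
proof -
  let ?P = "\<lambda>k. 1 \<le> k \<and> real n * (lam ^ k / fact k) * sqrt (real k) < 1"
  have "k < (LEAST k. ?P k)" using assms by (simp add: level_def)
  then have "\<not> ?P k" by (rule not_less_Least)
  then show ?thesis using assms by auto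
qed

lemma level_at_top: "filterlim (level lam) at_top sequentially"
proof (rule filterlim_at_top[THEN iffD2], rule allI)
  fix K
  have "\<forall>\<^sub>F n in sequentially. \<forall>k\<in>{1..K}. 1 \<le> real n * (lam ^ k / fact k) * sqrt (real k)"
  proof (intro eventually_ball_finite ballI)
    fix k assume k: "k \<in> {1..K}"
    let ?c = "(lam ^ k / fact k) * sqrt (real k)"
    have "?c > 0" using lam k by simp
    then have "filterlim (\<lambda>n. ?c * real n) at_top sequentially"
      by (intro filterlim_tendsto_pos_mult_at_top[OF tendsto_const] filterlim_real_sequentially)
    from filterlim_at_top[THEN iffD1, OF this, rule_format, of 1]
    show "\<forall>\<^sub>F n in sequentially. 1 \<le> real n * (lam ^ k / fact k) * sqrt (real k)"
      by eventually_elim (simp add: mult_ac)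
  qed auto
  then show "\<forall>\<^sub>F n in sequentially. K \<le> level lam n"
  proof eventually_elim
    case (elim n)
    show ?case
    proof (rule ccontr)
      assume "\<not> K \<le> level lam n"
      then have "Suc (level lam n) \<in> {1..K}" by auto
      from bspec[OF elim this] level_upper[of n] show False by linarith
    qed
  qed
qed

text \<open>The logarithm of the quantity compared with 1 in \<open>level\<close> is
  \<open>ln (real n) - a k * (real k * ln (real k))\<close> with \<open>a\<close> tending to 1. It
  is nonnegative at the level and at most 0 one step higher, which squeezes the quotient.\<close>

lemma ln_over_level: "(\<lambda>n. ln (real n) / (real (level lam n) * ln (real (level lam n)))) \<longlonglongrightarrow> 1"
proof -
  let ?m = "level lam"
  define a where "a k = ln (fact k) / (real k * ln (real k)) - ln lam * (1 / ln (real k)) - 1 / (2 * real k)" for k :: nat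
  have "a \<longlonglongrightarrow> 1 - ln lam * 0 - 0"
    unfolding a_def by (intro tendsto_intros ln_fact_asymp) real_asymp+
  then have a: "a \<longlonglongrightarrow> 1" by simp
  have a_mult: "a k * (real k * ln (real k)) = ln (fact k) - real k * ln lam - ln (real k) / 2" if "k \<ge> 2" for k
  proof -
    have "ln (real k) > 0" using that by simp
    then show ?thesis using that by (simp add: a_def field_simps)
  qed
  have lnw: "ln (real n * (lam ^ k / fact k) * sqrt (real k)) = ln (real n) - a k * (real k * ln (real k))" if "n \<ge> 1" "k \<ge> 2" for n k
    using that lam by (simp add: a_mult ln_mult ln_div ln_realpow ln_sqrt)
  have r: "(\<lambda>k::nat. real (Suc k) * ln (real (Suc k)) / (real k * ln (real k))) \<longlonglongrightarrow> 1" by real_asymp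
  have ev: "\<forall>\<^sub>F n in sequentially. ?m n \<ge> 2" using level_at_top by (auto simp: filterlim_at_top)
  show ?thesis
  proof (rule tendsto_sandwich)
    show "(\<lambda>n. a (?m n)) \<longlonglongrightarrow> 1" by (rule filterlim_compose[OF a level_at_top])
    have "(\<lambda>k. a (Suc k) * (real (Suc k) * ln (real (Suc k)) / (real k * ln (real k)))) \<longlonglongrightarrow> 1 * 1"
      by (intro tendsto_mult r LIMSEQ_Suc a)
    from filterlim_compose[OF this level_at_top]
    show "(\<lambda>n. a (Suc (?m n)) * (real (Suc (?m n)) * ln (real (Suc (?m n))) / (real (?m n) * ln (real (?m n))))) \<longlonglongrightarrow> 1" by simp
    show "\<forall>\<^sub>F n in sequentially. a (?m n) \<le> ln (real n) / (real (?m n) * ln (real (?m n)))"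
      using ev eventually_ge_at_top[of 1]
    proof eventually_elim
      case (elim n)
      have pos: "real (?m n) * ln (real (?m n)) > 0" using elim by simp
      have "0 \<le> ln (real n * (lam ^ ?m n / fact (?m n)) * sqrt (real (?m n)))"
        using level_lower[of "?m n" n] elim by (intro ln_ge_zero) auto
      then show ?case using elim lnw[of n "?m n"] pos by (simp add: pos_le_divide_eq)
    qed
    show "\<forall>\<^sub>F n in sequentially. ln (real n) / (real (?m n) * ln (real (?m n))) \<le> a (Suc (?m n)) * (real (Suc (?m n)) * ln (real (Suc (?m n))) / (real (?m n) * ln (real (?m n))))"
      using ev eventually_ge_at_top[of 1]
    proof eventually_elim
      case (elim n)
      have pos: "real (?m n) * ln (real (?m n)) > 0" using elim by simp
      have "ln (real n * (lam ^ Suc (?m n) / fact (Suc (?m n))) * sqrt (real (Suc (?m n)))) \<le> ln 1"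
        using level_upper[of n] elim lam by (subst ln_le_cancel_iff) auto
      then have "ln (real n) \<le> a (Suc (?m n)) * (real (Suc (?m n)) * ln (real (Suc (?m n))))"
        using elim lnw[of n "Suc (?m n)"] by simp
      then have "ln (real n) / (real (?m n) * ln (real (?m n))) \<le> a (Suc (?m n)) * (real (Suc (?m n)) * ln (real (Suc (?m n)))) / (real (?m n) * ln (real (?m n)))"
        using pos by (intro divide_right_mono) auto
      then show ?case by simp
    qed
  qed
qed

text \<open>Inverts ln n = y m ln m with y tending to 1: taking logarithms, ln ln n = ln y + ln m +
  ln ln m, so ln ln n is asymptotic to ln m.\<close>

lemma level_asymp: "(\<lambda>n. real (level lam n)) \<sim>[at_top] (\<lambda>n. ln (real n) / ln (ln (real n)))"
proof (rule asymp_equivI')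
  let ?m = "level lam"
  define y where "y n = ln (real n) / (real (?m n) * ln (real (?m n)))" for n
  have y: "y \<longlonglongrightarrow> 1" using ln_over_level unfolding y_def .
  have ypos: "\<forall>\<^sub>F n in sequentially. y n > 0" using y by (rule order_tendstoD) simp
  have ev: "\<forall>\<^sub>F n in sequentially. ?m n \<ge> 4" using level_at_top by (auto simp: filterlim_at_top)
  have big: "\<forall>\<^sub>F n in sequentially. ln (ln (real n)) > 1 \<and> ln (real n) > 1"
    by (intro eventually_conj) real_asymp+
  have 1: "(\<lambda>n. 1 / ln (real (?m n))) \<longlonglongrightarrow> 0"
    by (rule filterlim_compose[OF _ level_at_top]) real_asymp
  have 2: "(\<lambda>n. ln (ln (real (?m n))) / ln (real (?m n))) \<longlonglongrightarrow> 0"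
    by (rule filterlim_compose[OF _ level_at_top]) real_asymp
  have "(\<lambda>n. (ln (y n) * (1 / ln (real (?m n))) + 1 + ln (ln (real (?m n))) / ln (real (?m n))) / y n) \<longlonglongrightarrow> (ln 1 * 0 + 1 + 0) / 1"
    by (intro tendsto_intros y 1 2) auto
  moreover have "\<forall>\<^sub>F n in sequentially. (ln (y n) * (1 / ln (real (?m n))) + 1 + ln (ln (real (?m n))) / ln (real (?m n))) / y n
      = real (?m n) / (ln (real n) / ln (ln (real n)))"
    using ypos ev big
  proof eventually_elim
    case (elim n)
    have l: "ln (real (?m n)) > 0" using elim by simp
    have eq: "ln (real n) = y n * (real (?m n) * ln (real (?m n)))" using elim l by (simp add: y_def)
    have "ln (ln (real n)) = ln (y n) + ln (real (?m n)) + ln (ln (real (?m n)))"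
      unfolding eq using elim l by (simp add: ln_mult)
    then have "ln (y n) * (1 / ln (real (?m n))) + 1 + ln (ln (real (?m n))) / ln (real (?m n)) = ln (ln (real n)) / ln (real (?m n))"
      using l by (simp add: field_simps)
    moreover have "real (?m n) / (ln (real n) / ln (ln (real n))) = ln (ln (real n)) / ln (real (?m n)) / y n"
      unfolding eq using elim l by (simp add: field_simps)
    ultimately show ?case by simp
  qed
  ultimately show "(\<lambda>n. real (?m n) / (ln (real n) / ln (ln (real n)))) \<longlonglongrightarrow> 1" by (simp add: filterlim_cong)
qed

lemma weight_above_level:
  "(\<lambda>n. real n * (lam ^ Suc (level lam n) / fact (Suc (level lam n)))) \<longlonglongrightarrow> 0"
proof (rule tendsto_sandwich[where f="\<lambda>_. 0"])
  have "(\<lambda>k::nat. 1 / sqrt (real (Suc k))) \<longlonglongrightarrow> 0" by real_asymp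
  from filterlim_compose[OF this level_at_top]
  show "(\<lambda>n. 1 / sqrt (real (Suc (level lam n)))) \<longlonglongrightarrow> 0" .
  show "\<forall>\<^sub>F n in sequentially. real n * (lam ^ Suc (level lam n) / fact (Suc (level lam n))) \<le> 1 / sqrt (real (Suc (level lam n)))"
    using level_upper by (intro always_eventually allI) (simp add: pos_le_divide_eq less_imp_le del: fact_Suc power_Suc of_nat_Suc)
qed (use lam in \<open>auto intro!: always_eventually\<close>)

text \<open>At the level m the weight is at least 1 / sqrt m, by minimality. One step down
  multiplies it by m / lam, the next one by (m - 1) / lam.\<close>

lemma weight_below_level:
  assumes "level lam n \<ge> 2"
  shows "sqrt (real (level lam n)) / lam \<le> real n * (lam ^ (level lam n - 1) / fact (level lam n - 1))"
    and "sqrt (real (level lam n)) * (real (level lam n) - 1) / lam\<^sup>2 \<le> real n * (lam ^ (level lam n - 2) / fact (level lam n - 2))"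
proof -
  obtain k where k: "level lam n = Suc (Suc k)" using assms by (metis One_nat_def Suc_1 add_2_eq_Suc le_Suc_ex)
  define s where "s = sqrt (real (Suc (Suc k)))"
  have s: "s > 0" "s * s = real (Suc (Suc k))" by (auto simp: s_def)
  define w where "w = real n * (lam ^ k / fact k)"
  have "1 \<le> real n * (lam ^ Suc (Suc k) / fact (Suc (Suc k))) * s"
    using level_lower[of "Suc (Suc k)" n] k by (simp add: s_def)
  also have "\<dots> = w * lam\<^sup>2 / (real (Suc k) * s)"
    using s(1) by (simp add: w_def power2_eq_square divide_simps s(2)[symmetric] del: of_nat_Suc)
  finally have le: "real (Suc k) * s \<le> w * lam\<^sup>2" using s(1) by (subst (asm) pos_le_divide_eq) auto
  have "real n * (lam ^ Suc k / fact (Suc k)) = w * lam / real (Suc k)" by (simp add: w_def mult_ac)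
  moreover have "s / lam \<le> w * lam / real (Suc k)"
    using le lam by (simp add: divide_simps power2_eq_square mult_ac del: of_nat_Suc)
  ultimately show "sqrt (real (level lam n)) / lam \<le> real n * (lam ^ (level lam n - 1) / fact (level lam n - 1))"
    unfolding k by (simp add: s_def del: of_nat_Suc fact_Suc power_Suc)
  have "s * real (Suc k) / lam\<^sup>2 \<le> w" using le lam by (simp add: divide_simps mult_ac del: of_nat_Suc)
  then show "sqrt (real (level lam n)) * (real (level lam n) - 1) / lam\<^sup>2 \<le> real n * (lam ^ (level lam n - 2) / fact (level lam n - 2))"
    unfolding k by (simp add: s_def w_def)
qed

lemma weight_below_level_at_top:
  "filterlim (\<lambda>n. real n * (lam ^ (level lam n - 1) / fact (level lam n - 1))) at_top sequentially"
proof (rule filterlim_at_top_mono)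
  have "filterlim (\<lambda>k::nat. sqrt (real k)) at_top sequentially" by real_asymp
  then have "filterlim (\<lambda>k::nat. sqrt (real k) * (1 / lam)) at_top sequentially"
    by (rule filterlim_at_top_mult_tendsto_pos[OF tendsto_const, rotated]) (use lam in simp)
  from filterlim_compose[OF this level_at_top]
  show "filterlim (\<lambda>n. sqrt (real (level lam n)) / lam) at_top sequentially" by simp
  have "\<forall>\<^sub>F n in sequentially. level lam n \<ge> 2" using level_at_top by (auto simp: filterlim_at_top)
  then show "\<forall>\<^sub>F n in sequentially. sqrt (real (level lam n)) / lam \<le> real n * (lam ^ (level lam n - 1) / fact (level lam n - 1))"
    by eventually_elim (rule weight_below_level(1))
qed

text \<open>The exponent is at least a constant times sqrt m (m - 1), which outgrows m ln m and
  hence every multiple of ln n. The bound 2 is just a constant above the limit 1 in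
  \<open>ln_over_level\<close>, and |e| covers both signs of \<open>e\<close>.\<close>

lemma powr_times_exp_weight:
  assumes c: "c > 0"
  shows "(\<lambda>n. real n powr e * exp (- (real n * (c * (lam ^ (level lam n - 2) / fact (level lam n - 2)))))) \<longlonglongrightarrow> 0"
proof (rule tendsto_sandwich[where f="\<lambda>_. 0"])
  let ?m = "level lam"
  define d where "d = c / lam\<^sup>2"
  have d: "d > 0" using c lam by (simp add: d_def)
  have "filterlim (\<lambda>k::nat. (d * (sqrt (real k) * (real k - 1) / (real k * ln (real k))) - 2 * \<bar>e\<bar>) * (real k * ln (real k))) at_top sequentially"
  proof (rule filterlim_at_top_mult_at_top)
    have "filterlim (\<lambda>k::nat. sqrt (real k) * (real k - 1) / (real k * ln (real k))) at_top sequentially" by real_asymp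
    then have "filterlim (\<lambda>k::nat. d * (sqrt (real k) * (real k - 1) / (real k * ln (real k)))) at_top sequentially"
      using d by (intro filterlim_tendsto_pos_mult_at_top[OF tendsto_const])
    then have "filterlim (\<lambda>k::nat. - (2 * \<bar>e\<bar>) + d * (sqrt (real k) * (real k - 1) / (real k * ln (real k)))) at_top sequentially"
      by (intro filterlim_tendsto_add_at_top[OF tendsto_const])
    then show "filterlim (\<lambda>k::nat. d * (sqrt (real k) * (real k - 1) / (real k * ln (real k))) - 2 * \<bar>e\<bar>) at_top sequentially"
      by (simp add: add.commute)
    show "filterlim (\<lambda>k::nat. real k * ln (real k)) at_top sequentially" by real_asymp
  qed
  from filterlim_compose[OF exp_at_bot filterlim_compose[OF filterlim_uminus_at_bot_at_top filterlim_compose[OF this level_at_top]]]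
  show "(\<lambda>n. exp (- ((d * (sqrt (real (?m n)) * (real (?m n) - 1) / (real (?m n) * ln (real (?m n)))) - 2 * \<bar>e\<bar>) * (real (?m n) * ln (real (?m n)))))) \<longlonglongrightarrow> 0" .
  have ev: "\<forall>\<^sub>F n in sequentially. ?m n \<ge> 2" using level_at_top by (auto simp: filterlim_at_top)
  have lt2: "\<forall>\<^sub>F n in sequentially. ln (real n) / (real (?m n) * ln (real (?m n))) < 2"
    using ln_over_level by (rule order_tendstoD) simp
  show "\<forall>\<^sub>F n in sequentially. real n powr e * exp (- (real n * (c * (lam ^ (?m n - 2) / fact (?m n - 2)))))
      \<le> exp (- ((d * (sqrt (real (?m n)) * (real (?m n) - 1) / (real (?m n) * ln (real (?m n)))) - 2 * \<bar>e\<bar>) * (real (?m n) * ln (real (?m n)))))"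
    using ev lt2 eventually_ge_at_top[of 1]
  proof eventually_elim
    case (elim n)
    let ?q = "real (?m n) * ln (real (?m n))"
    have q: "?q > 0" using elim by simp
    have "e * ln (real n) \<le> \<bar>e\<bar> * ln (real n)" using elim by (intro mult_right_mono) auto
    also have "\<dots> \<le> \<bar>e\<bar> * (2 * ?q)" using elim(2) q by (intro mult_left_mono) (auto simp: divide_less_eq)
    finally have 1: "e * ln (real n) \<le> 2 * \<bar>e\<bar> * ?q" by simp
    have "d * (sqrt (real (?m n)) * (real (?m n) - 1)) = c * (sqrt (real (?m n)) * (real (?m n) - 1) / lam\<^sup>2)" by (simp add: d_def)
    also have "\<dots> \<le> c * (real n * (lam ^ (?m n - 2) / fact (?m n - 2)))"
      using c weight_below_level(2)[OF elim(1)] by (intro mult_left_mono) auto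
    finally have 2: "d * (sqrt (real (?m n)) * (real (?m n) - 1)) \<le> real n * (c * (lam ^ (?m n - 2) / fact (?m n - 2)))" by (simp add: mult_ac)
    have "(d * (sqrt (real (?m n)) * (real (?m n) - 1) / ?q) - 2 * \<bar>e\<bar>) * ?q = d * (sqrt (real (?m n)) * (real (?m n) - 1)) - 2 * \<bar>e\<bar> * ?q"
    proof -
      have "(d * (x / y) - b) * y = d * x - b * y" if "y > 0" for x y b :: real using that by (simp add: field_simps)
      from this[OF q] show ?thesis .
    qed
    with 1 2 have "e * ln (real n) - real n * (c * (lam ^ (?m n - 2) / fact (?m n - 2))) \<le> - ((d * (sqrt (real (?m n)) * (real (?m n) - 1) / ?q) - 2 * \<bar>e\<bar>) * ?q)"
      by linarith
    moreover have "real n powr e * exp (- (real n * (c * (lam ^ (?m n - 2) / fact (?m n - 2))))) = exp (e * ln (real n) - real n * (c * (lam ^ (?m n - 2) / fact (?m n - 2))))"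
      using elim by (simp add: powr_def exp_diff exp_minus divide_inverse)
    ultimately show ?case by simp
  qed
qed (auto intro!: always_eventually)

end

subsection \<open>The maximum load over time\<close>

text \<open>Probabilities are estimated for a measurable exceptional set \<open>B\<close> in the
  original space, while the event itself is measurable only in the completion and is known only
  almost everywhere off \<open>B\<close>.\<close>

lemma aasI:
  assumes ev: "\<forall>\<^sub>F n in sequentially. prob_space (M n) \<and> {\<omega>\<in>space (M n). E n \<omega>} \<in> sets (completion (M n)) \<and>
      (\<exists>B\<in>sets (M n). measure (M n) B \<le> \<beta> n \<and> (AE \<omega> in M n. \<omega> \<notin> B \<longrightarrow> E n \<omega>))"
    and \<beta>: "\<beta> \<longlonglongrightarrow> 0"
  shows "aas M E"
  unfolding aas_def
proof (rule tendsto_sandwich)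
  let ?p = "\<lambda>n. measure (completion (M n)) {\<omega>\<in>space (M n). E n \<omega>}"
  show "(\<lambda>n. 1 - \<beta> n) \<longlonglongrightarrow> 1" using tendsto_diff[OF tendsto_const \<beta>, of 1] by simp
  show "(\<lambda>_. 1) \<longlonglongrightarrow> (1::real)" by simp
  show "\<forall>\<^sub>F n in sequentially. ?p n \<le> 1"
    using ev
  proof eventually_elim
    case (elim n)
    then interpret C: prob_space "completion (M n)" by (auto intro: prob_space.prob_space_completion)
    show ?case by (rule C.prob_le_1)
  qed
  show "\<forall>\<^sub>F n in sequentially. 1 - \<beta> n \<le> ?p n"
    using ev
  proof eventually_elim
    case (elim n)
    then interpret prob_space "M n" by simp
    interpret C: prob_space "completion (M n)" by (rule prob_space_completion)
    from elim obtain B where B: "B \<in> sets (M n)" "measure (M n) B \<le> \<beta> n" "AE \<omega> in M n. \<omega> \<notin> B \<longrightarrow> E n \<omega>" by blast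
    have "1 - \<beta> n \<le> measure (M n) (space (M n) - B)" using prob_compl[OF B(1)] B(2) by simp
    also have "\<dots> = measure (completion (M n)) (space (M n) - B)" using B(1) by (intro measure_completion[symmetric]) auto
    also have "\<dots> \<le> ?p n"
    proof (rule C.finite_measure_mono_AE)
      have "AE \<omega> in completion (M n). \<omega> \<notin> B \<longrightarrow> E n \<omega>" by (rule AE_completion[OF B(3)])
      then show "AE \<omega> in completion (M n). \<omega> \<in> space (M n) - B \<longrightarrow> \<omega> \<in> {\<omega>\<in>space (M n). E n \<omega>}"
        by eventually_elim auto
    qed (use elim in blast)
    finally show ?case .
  qed
qed

context one_choice_system begin

text \<open>Only upward changes are controlled by arrivals. A lower bound at \<open>t\<close>
  therefore comes from the right end of its cell, an upper bound from the left end.\<close>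

lemma grid_sandwich:
  assumes reg: "regular \<omega>" and h: "0 < h" and t: "0 \<le> t" "t \<le> T" "T < h * real G"
    and c: "\<And>i j. i < G \<Longrightarrow> j < n \<Longrightarrow> region_count (\<lambda>_. 0) (h * real i) (h * real (Suc i)) j \<omega> \<le> c"
  obtains i where "i < G" "max_load S n 1 (h * real (Suc i)) \<omega> \<le> max_load S n 1 t \<omega> + c"
    "max_load S n 1 t \<omega> \<le> max_load S n 1 (h * real i) \<omega> + c"
proof -
  \<comment> \<open>The cell containing \<open>t\<close>. The strict inequality
    \<open>T < h * real G\<close> guarantees that it is among the first \<open>G\<close> cells even
    for \<open>t = T\<close>.\<close>
  define i where "i = nat \<lfloor>t / h\<rfloor>"
  have i: "real i = of_int \<lfloor>t / h\<rfloor>" using t h by (simp add: i_def)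
  then have "real i \<le> t / h" "t / h < real i + 1" by linarith+
  then have bnd: "h * real i \<le> t" "t \<le> h * real (Suc i)" using h by (auto simp: field_simps)
  have iG: "i < G"
  proof -
    have "h * real i < h * real G" using bnd t by linarith
    then show ?thesis using h by simp
  qed
  show ?thesis
  proof (rule that[OF iG])
    show "max_load S n 1 (h * real (Suc i)) \<omega> \<le> max_load S n 1 t \<omega> + c"
    proof (rule max_load_le_plus[OF reg bnd(2)])
      fix j assume "j < n"
      from order_trans[OF region_count_mono[OF reg bnd(1) order_refl] c[OF iG this]]
      show "region_count (\<lambda>_. 0) t (h * real (Suc i)) j \<omega> \<le> c" .
    qed
    show "max_load S n 1 t \<omega> \<le> max_load S n 1 (h * real i) \<omega> + c"
    proof (rule max_load_le_plus[OF reg bnd(1)])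
      fix j assume "j < n"
      from order_trans[OF region_count_mono[OF reg order_refl bnd(2)] c[OF iG this]]
      show "region_count (\<lambda>_. 0) (h * real i) t j \<omega> \<le> c" .
    qed
  qed
qed

lemma grid_arrivals_event:
  "{\<omega>\<in>space M. \<exists>i<G. \<exists>j<n. b \<le> region_count (\<lambda>_. 0) (h * real i) (h * real (Suc i)) j \<omega>} \<in> events"
proof -
  have "region_count (\<lambda>_. 0) v u j \<in> measurable M (count_space UNIV)" for v u j by (rule region_count_measurable) simp
  then have "{\<omega>\<in>space M. b \<le> region_count (\<lambda>_. 0) v u j \<omega>} \<in> events" for v u j by simp
  then have "{\<omega>\<in>space M. \<exists>i\<in>{..<G}. \<exists>j\<in>{..<n}. b \<le> region_count (\<lambda>_. 0) (h * real i) (h * real (Suc i)) j \<omega>} \<in> events"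
    by (intro sets.sets_Collect_finite_Ex) auto
  then show ?thesis by (simp only: Bex_def lessThan_iff)
qed

text \<open>The exceptional set collects a maximum load below \<open>k\<close> at the right end of
  some cell, and two arrivals in the same bin within one cell. Off it at most one ball per bin
  separates \<open>t\<close> from the next grid point.\<close>

lemma max_load_lower_on_interval:
  assumes stat: "stationary S n 1" and h: "0 < h" and T: "T < h * real G"
  shows "\<exists>B\<in>events. prob B \<le> real G * exp (- (real n * (exp (-lam) * (lam ^ k / fact k)))) + real G * real n * (lam * h) ^ 2
     \<and> (AE \<omega> in M. \<omega> \<notin> B \<longrightarrow> (\<forall>t\<in>{0..T}. k \<le> max_load S n 1 t \<omega> + 1))"
proof -
  let ?A = "\<lambda>i. {\<omega>\<in>space M. max_load S n 1 (h * real (Suc i)) \<omega> < k}"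
  let ?D = "{\<omega>\<in>space M. \<exists>i<G. \<exists>j<n. 2 \<le> region_count (\<lambda>_. 0) (h * real i) (h * real (Suc i)) j \<omega>}"
  have A: "?A i \<in> events" for i by measurable
  have D: "?D \<in> events" by (rule grid_arrivals_event)
  have "prob (\<Union>i\<in>{..<G}. ?A i) \<le> (\<Sum>i\<in>{..<G}. prob (?A i))"
    using A by (intro finite_measure_subadditive_finite) auto
  also have "\<dots> \<le> (\<Sum>i\<in>{..<G}. exp (- (real n * (exp (-lam) * (lam ^ k / fact k)))))"
    using h by (intro sum_mono prob_max_load_less_le stat) simp
  finally have 1: "prob (\<Union>i\<in>{..<G}. ?A i) \<le> real G * exp (- (real n * (exp (-lam) * (lam ^ k / fact k))))" by simp
  have 2: "prob ?D \<le> real G * real n * (lam * h) ^ 2" using h by (intro prob_grid_arrivals_ge) simp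
  have ev: "(\<Union>i\<in>{..<G}. ?A i) \<in> events" using A by blast
  show ?thesis
  proof (intro bexI conjI)
    show "(\<Union>i\<in>{..<G}. ?A i) \<union> ?D \<in> events" using ev D by (rule sets.Un)
    show "prob ((\<Union>i\<in>{..<G}. ?A i) \<union> ?D) \<le> real G * exp (- (real n * (exp (-lam) * (lam ^ k / fact k)))) + real G * real n * (lam * h) ^ 2"
      using measure_Un_le[OF ev D] 1 2 by linarith
    show "AE \<omega> in M. \<omega> \<notin> (\<Union>i\<in>{..<G}. ?A i) \<union> ?D \<longrightarrow> (\<forall>t\<in>{0..T}. k \<le> max_load S n 1 t \<omega> + 1)"
      using AE_regular AE_space
    proof eventually_elim
      case (elim \<omega>)
      show ?case
      proof (intro impI ballI)
        fix t assume \<omega>: "\<omega> \<notin> (\<Union>i\<in>{..<G}. ?A i) \<union> ?D" and t: "t \<in> {0..T}"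
        have c: "region_count (\<lambda>_. 0) (h * real i) (h * real (Suc i)) j \<omega> \<le> 1" if "i < G" "j < n" for i j
        proof -
          have "\<not> 2 \<le> region_count (\<lambda>_. 0) (h * real i) (h * real (Suc i)) j \<omega>"
            using \<omega> elim(2) that by blast
          then show ?thesis by linarith
        qed
        obtain i where i: "i < G" "max_load S n 1 (h * real (Suc i)) \<omega> \<le> max_load S n 1 t \<omega> + 1"
          using grid_sandwich[OF elim(1) h _ _ T c, of t] t by auto
        have "\<not> max_load S n 1 (h * real (Suc i)) \<omega> < k" using \<omega> elim(2) i(1) by blast
        then show "k \<le> max_load S n 1 t \<omega> + 1" using i(2) by linarith
      qed
    qed
  qed
qed

text \<open>As for the lower bound, but with left ends and up to \<open>c\<close> arrivals per bin
  and cell; a larger \<open>c\<close> permits a coarser grid.\<close>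

lemma max_load_upper_on_interval:
  assumes stat: "stationary S n 1" and h: "0 < h" and T: "T < h * real G"
  shows "\<exists>B\<in>events. prob B \<le> real G * (real n * (lam ^ k / fact k)) + real G * real n * (lam * h) ^ Suc c
     \<and> (AE \<omega> in M. \<omega> \<notin> B \<longrightarrow> (\<forall>t\<in>{0..T}. max_load S n 1 t \<omega> < k + c))"
proof -
  let ?A = "\<lambda>i. {\<omega>\<in>space M. k \<le> max_load S n 1 (h * real i) \<omega>}"
  let ?D = "{\<omega>\<in>space M. \<exists>i<G. \<exists>j<n. Suc c \<le> region_count (\<lambda>_. 0) (h * real i) (h * real (Suc i)) j \<omega>}"
  have A: "?A i \<in> events" for i by measurable
  have D: "?D \<in> events" by (rule grid_arrivals_event)
  have "prob (\<Union>i\<in>{..<G}. ?A i) \<le> (\<Sum>i\<in>{..<G}. prob (?A i))"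
    using A by (intro finite_measure_subadditive_finite) auto
  also have "\<dots> \<le> (\<Sum>i\<in>{..<G}. real n * (lam ^ k / fact k))"
    using h by (intro sum_mono prob_max_load_ge_le stat) simp
  finally have 1: "prob (\<Union>i\<in>{..<G}. ?A i) \<le> real G * (real n * (lam ^ k / fact k))" by simp
  have 2: "prob ?D \<le> real G * real n * (lam * h) ^ Suc c" using h by (intro prob_grid_arrivals_ge) simp
  have ev: "(\<Union>i\<in>{..<G}. ?A i) \<in> events" using A by blast
  show ?thesis
  proof (intro bexI conjI)
    show "(\<Union>i\<in>{..<G}. ?A i) \<union> ?D \<in> events" using ev D by (rule sets.Un)
    show "prob ((\<Union>i\<in>{..<G}. ?A i) \<union> ?D) \<le> real G * (real n * (lam ^ k / fact k)) + real G * real n * (lam * h) ^ Suc c"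
      using measure_Un_le[OF ev D] 1 2 by linarith
    show "AE \<omega> in M. \<omega> \<notin> (\<Union>i\<in>{..<G}. ?A i) \<union> ?D \<longrightarrow> (\<forall>t\<in>{0..T}. max_load S n 1 t \<omega> < k + c)"
      using AE_regular AE_space
    proof eventually_elim
      case (elim \<omega>)
      show ?case
      proof (intro impI ballI)
        fix t assume \<omega>: "\<omega> \<notin> (\<Union>i\<in>{..<G}. ?A i) \<union> ?D" and t: "t \<in> {0..T}"
        have c: "region_count (\<lambda>_. 0) (h * real i) (h * real (Suc i)) j \<omega> \<le> c" if "i < G" "j < n" for i j
        proof -
          have "\<not> Suc c \<le> region_count (\<lambda>_. 0) (h * real i) (h * real (Suc i)) j \<omega>"
            using \<omega> elim(2) that by blast
          then show ?thesis by linarith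
        qed
        obtain i where i: "i < G" "max_load S n 1 t \<omega> \<le> max_load S n 1 (h * real i) \<omega> + c"
          using grid_sandwich[OF elim(1) h _ _ T c, of t] t by auto
        have "\<not> k \<le> max_load S n 1 (h * real i) \<omega>" using \<omega> elim(2) i(1) by blast
        then show "max_load S n 1 t \<omega> < k + c" using i(2) by linarith
      qed
    qed
  qed
qed

text \<open>Off the exceptional set some bin retains at least \<open>k\<close> balls from a unit
  window at its end, and they form part of its load at that integer time.\<close>

lemma max_load_attained_on_interval:
  assumes G: "real G \<le> T"
  defines "\<mu> \<equiv> lam * (1 - exp (- 1))"
  shows "\<exists>B\<in>events. prob B \<le> exp (- (real (G * n) * (exp (- \<mu>) * (\<mu> ^ k / fact k))))
     \<and> (AE \<omega> in M. \<omega> \<notin> B \<longrightarrow> (\<exists>t\<in>{0..T}. k \<le> max_load S n 1 t \<omega>))"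
proof (intro bexI conjI)
  let ?B = "{\<omega>\<in>space M. \<forall>i<G. \<forall>j<n. region_count (\<lambda>x. x) (real i) (real (Suc i)) j \<omega> < k}"
  have "0 \<le> \<mu>" using lam_pos by (simp add: \<mu>_def)
  then show "prob ?B \<le> exp (- (real (G * n) * (exp (- \<mu>) * (\<mu> ^ k / fact k))))"
    unfolding prob_no_large_batch \<mu>_def[symmetric] by (rule poisson_cdf_power_le)
  have "region_count (\<lambda>x. x) v u j \<in> measurable M (count_space UNIV)" for v u j by (rule region_count_measurable) simp
  then have "{\<omega>\<in>space M. region_count (\<lambda>x. x) v u j \<omega> < k} \<in> events" for v u j by simp
  then have "{\<omega>\<in>space M. \<forall>i\<in>{..<G}. \<forall>j\<in>{..<n}. region_count (\<lambda>x. x) (real i) (real (Suc i)) j \<omega> < k} \<in> events"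
    by (intro sets.sets_Collect_finite_All) auto
  then show "?B \<in> events" by (simp only: Ball_def lessThan_iff)
  show "AE \<omega> in M. \<omega> \<notin> ?B \<longrightarrow> (\<exists>t\<in>{0..T}. k \<le> max_load S n 1 t \<omega>)"
    using AE_regular AE_space
  proof eventually_elim
    case (elim \<omega>)
    show ?case
    proof
      assume "\<omega> \<notin> ?B"
      then obtain i j where ij: "i < G" "j < n" "k \<le> region_count (\<lambda>x. x) (real i) (real (Suc i)) j \<omega>"
        using elim(2) not_less by blast
      have "k \<le> load S 1 (real (Suc i)) \<omega> j" using ij(3) region_count_le_load[OF elim(1)] by (rule order_trans)
      also have "\<dots> \<le> max_load S n 1 (real (Suc i)) \<omega>" using ij(2) max_load_le_iff[of "real (Suc i)" \<omega>] by blast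
      finally have "k \<le> max_load S n 1 (real (Suc i)) \<omega>" .
      moreover have "real (Suc i) \<le> T" using ij(1) G by linarith
      ultimately show "\<exists>t\<in>{0..T}. k \<le> max_load S n 1 t \<omega>" by (intro bexI[of _ "real (Suc i)"]) auto
    qed
  qed
qed

end

section \<open>Grids on the time interval and their exponents\<close>

lemma half_le_nat_floor:
  assumes "1 \<le> (x::real)" shows "x / 2 \<le> real (nat \<lfloor>x\<rfloor>)"
proof -
  have "1 \<le> \<lfloor>x\<rfloor>" using assms by (simp add: le_floor_iff)
  then have "real (nat \<lfloor>x\<rfloor>) = of_int \<lfloor>x\<rfloor>" "1 \<le> real_of_int \<lfloor>x\<rfloor>" by auto
  moreover have "x < real_of_int \<lfloor>x\<rfloor> + 1" by linarith
  ultimately show ?thesis by linarith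
qed

text \<open>The number of cells of length \<open>n powr - \<eta>\<close> used to cover times up to
  \<open>n powr K\<close>; the successor makes the covering strict.\<close>

definition grid_size :: "real \<Rightarrow> real \<Rightarrow> nat \<Rightarrow> nat" where
  "grid_size K \<eta> n = Suc (nat \<lfloor>real n powr (K + \<eta>)\<rfloor>)"

lemma grid_size_covers:
  assumes "n \<ge> 1"
  shows "real n powr K < real n powr - \<eta> * real (grid_size K \<eta> n)"
proof -
  have "real n powr (K + \<eta>) < real (grid_size K \<eta> n)" unfolding grid_size_def by linarith
  then have "real n powr - \<eta> * real n powr (K + \<eta>) < real n powr - \<eta> * real (grid_size K \<eta> n)"
    using assms by (intro mult_strict_left_mono) auto
  then show ?thesis by (simp flip: powr_add)
qed

lemma grid_size_le:
  assumes "n \<ge> 1" "K + \<eta> \<ge> 0"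
  shows "real (grid_size K \<eta> n) \<le> 2 * real n powr (K + \<eta>)"
proof -
  have "1 \<le> real n powr (K + \<eta>)" using assms by (intro ge_one_powr_ge_zero) auto
  moreover have "real (nat \<lfloor>real n powr (K + \<eta>)\<rfloor>) \<le> real n powr (K + \<eta>)" by simp
  ultimately show ?thesis unfolding grid_size_def of_nat_Suc by linarith
qed

text \<open>Exponent count for \<open>b\<close> arrivals in one bin and cell: K + \<eta> from the
  cells, 1 from the bins, and -\<eta> b from the arrivals.\<close>

lemma grid_arrivals_tendsto_0:
  assumes "K + \<eta> + 1 < \<eta> * real b"
  shows "(\<lambda>n. 2 * real n powr (K + \<eta>) * real n * (lam * real n powr - \<eta>) ^ b) \<longlonglongrightarrow> 0"
proof -
  have "(\<lambda>n. 2 * lam ^ b * real n powr (K + \<eta> + 1 - \<eta> * real b)) \<longlonglongrightarrow> 2 * lam ^ b * 0"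
    using assms by (intro tendsto_mult tendsto_const tendsto_neg_powr filterlim_real_sequentially) auto
  moreover have "\<forall>\<^sub>F n in sequentially. 2 * lam ^ b * real n powr (K + \<eta> + 1 - \<eta> * real b)
      = 2 * real n powr (K + \<eta>) * real n * (lam * real n powr - \<eta>) ^ b"
    using eventually_ge_at_top[of 1]
  proof eventually_elim
    case (elim n)
    have "(real n powr - \<eta>) ^ b = real n powr (- \<eta> * real b)"
      using elim by (subst powr_realpow[symmetric]) (auto simp: powr_powr)
    moreover have "real n powr (K + \<eta> + 1 - \<eta> * real b) = real n powr (K + \<eta>) * real n * real n powr (- \<eta> * real b)"
      using elim by (simp add: powr_add powr_diff powr_minus divide_inverse)
    ultimately show ?case by (simp add: power_mult_distrib)
  qed
  ultimately show ?thesis by (simp add: filterlim_cong)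
qed

context
  fixes lam :: real and S :: "nat \<Rightarrow> 'a bin_data"
  assumes lam: "lam > 0"
    and sys: "\<And>n. n \<ge> 1 \<Longrightarrow> bin_system lam n 1 (S n)"
    and stat: "\<And>n. n \<ge> 1 \<Longrightarrow> stationary (S n) n 1"
begin

lemma aas_two_values:
  assumes t: "t \<ge> 0"
  shows "aas (\<lambda>n. pspace (S n))
     (\<lambda>n \<omega>. int (max_load (S n) n 1 t \<omega>) = int (level lam n) \<or> int (max_load (S n) n 1 t \<omega>) = int (level lam n) - 1)"
proof (rule aasI)
  let ?m = "level lam"
  let ?\<beta> = "\<lambda>n. exp (- (exp (-lam) * (real n * (lam ^ (?m n - 1) / fact (?m n - 1))))) + real n * (lam ^ Suc (?m n) / fact (Suc (?m n)))"
  have "filterlim (\<lambda>n. exp (-lam) * (real n * (lam ^ (?m n - 1) / fact (?m n - 1)))) at_top sequentially"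
    by (rule filterlim_tendsto_pos_mult_at_top[OF tendsto_const _ weight_below_level_at_top[OF lam]]) simp
  from filterlim_compose[OF exp_at_bot filterlim_compose[OF filterlim_uminus_at_bot_at_top this]]
  show "?\<beta> \<longlonglongrightarrow> 0" using tendsto_add[OF _ weight_above_level[OF lam]] by fastforce
  show "\<forall>\<^sub>F n in sequentially. prob_space (pspace (S n)) \<and>
      {\<omega>\<in>space (pspace (S n)). int (max_load (S n) n 1 t \<omega>) = int (?m n) \<or> int (max_load (S n) n 1 t \<omega>) = int (?m n) - 1} \<in> sets (completion (pspace (S n))) \<and>
      (\<exists>B\<in>sets (pspace (S n)). measure (pspace (S n)) B \<le> ?\<beta> n \<and>
         (AE \<omega> in pspace (S n). \<omega> \<notin> B \<longrightarrow> int (max_load (S n) n 1 t \<omega>) = int (?m n) \<or> int (max_load (S n) n 1 t \<omega>) = int (?m n) - 1))"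
    using eventually_ge_at_top[of 1]
  proof eventually_elim
    case (elim n)
    interpret one_choice_system lam n "S n" using sys[OF elim] by unfold_locales
    \<comment> \<open>The truncated \<open>?m n - 1\<close> is harmless: if the level is 0, the only
      load left outside both sets is 0, the first of the two values.\<close>
    let ?A = "{\<omega>\<in>space M. max_load (S n) n 1 t \<omega> < ?m n - 1}" and ?A' = "{\<omega>\<in>space M. Suc (?m n) \<le> max_load (S n) n 1 t \<omega>}"
    have ev: "?A \<in> events" "?A' \<in> events" by measurable
    have "prob ?A \<le> exp (- (exp (-lam) * (real n * (lam ^ (?m n - 1) / fact (?m n - 1)))))"
      using prob_max_load_less_le[OF stat[OF elim] t, of "?m n - 1"] by (simp add: mult.left_commute)
    moreover have "prob ?A' \<le> real n * (lam ^ Suc (?m n) / fact (Suc (?m n)))"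
      by (rule prob_max_load_ge_le[OF stat[OF elim] t])
    ultimately have le: "prob (?A \<union> ?A') \<le> ?\<beta> n" using measure_Un_le[OF ev] by linarith
    have meas: "{\<omega>\<in>space M. int (max_load (S n) n 1 t \<omega>) = int (?m n) \<or> int (max_load (S n) n 1 t \<omega>) = int (?m n) - 1} \<in> events"
      by measurable
    have ae: "AE \<omega> in M. \<omega> \<notin> ?A \<union> ?A' \<longrightarrow> int (max_load (S n) n 1 t \<omega>) = int (?m n) \<or> int (max_load (S n) n 1 t \<omega>) = int (?m n) - 1"
    proof (rule AE_I2, rule impI)
      fix \<omega> assume "\<omega> \<in> space M" "\<omega> \<notin> ?A \<union> ?A'"
      then have "\<not> max_load (S n) n 1 t \<omega> < ?m n - 1" "\<not> Suc (?m n) \<le> max_load (S n) n 1 t \<omega>" by blast+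
      then show "int (max_load (S n) n 1 t \<omega>) = int (?m n) \<or> int (max_load (S n) n 1 t \<omega>) = int (?m n) - 1" by linarith
    qed
    show ?case
      by (intro conjI bexI[of _ "?A \<union> ?A'"])
         (fact prob_space_axioms sets_completionI_sets[OF meas] le ae sets.Un[OF ev])+
  qed
qed

lemma aas_min_over_time:
  assumes K: "K > 0"
  shows "aas (\<lambda>n. pspace (S n))
     (\<lambda>n \<omega>. int (MIN t\<in>{0..real n powr K}. max_load (S n) n 1 t \<omega>) \<ge> int (level lam n) - 3)"
proof (rule aasI)
  \<comment> \<open>Cells of length \<open>n powr - (K + 2)\<close> make two arrivals in one bin and
    cell improbable, since 2 K + 3 < 2 (K + 2). The resulting order n^(2 K + 2) of grid points is
    absorbed by the superpolynomial bound at level m - 2.\<close>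
  let ?m = "level lam" and ?G = "grid_size K (K + 2)"
  let ?e = "\<lambda>n. exp (- (real n * (exp (-lam) * (lam ^ (?m n - 2) / fact (?m n - 2)))))"
  let ?\<beta> = "\<lambda>n. 2 * (real n powr (2 * K + 2) * ?e n) + 2 * real n powr (K + (K + 2)) * real n * (lam * real n powr - (K + 2)) ^ 2"
  have "?\<beta> \<longlonglongrightarrow> 2 * 0 + 0"
    by (intro tendsto_intros powr_times_exp_weight[OF lam] grid_arrivals_tendsto_0) auto
  then show "?\<beta> \<longlonglongrightarrow> 0" by simp
  show "\<forall>\<^sub>F n in sequentially. prob_space (pspace (S n)) \<and>
      {\<omega>\<in>space (pspace (S n)). int (MIN t\<in>{0..real n powr K}. max_load (S n) n 1 t \<omega>) \<ge> int (?m n) - 3} \<in> sets (completion (pspace (S n))) \<and>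
      (\<exists>B\<in>sets (pspace (S n)). measure (pspace (S n)) B \<le> ?\<beta> n \<and>
         (AE \<omega> in pspace (S n). \<omega> \<notin> B \<longrightarrow> int (MIN t\<in>{0..real n powr K}. max_load (S n) n 1 t \<omega>) \<ge> int (?m n) - 3))"
    using eventually_ge_at_top[of 1]
  proof eventually_elim
    case (elim n)
    interpret one_choice_system lam n "S n" using sys[OF elim] by unfold_locales
    let ?h = "real n powr - (K + 2)"
    have h: "?h > 0" using elim by simp
    obtain B where B: "B \<in> events" "prob B \<le> real (?G n) * ?e n + real (?G n) * real n * (lam * ?h) ^ 2"
      "AE \<omega> in M. \<omega> \<notin> B \<longrightarrow> (\<forall>t\<in>{0..real n powr K}. ?m n - 2 \<le> max_load (S n) n 1 t \<omega> + 1)"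
      using max_load_lower_on_interval[OF stat[OF elim] h grid_size_covers[OF elim, where K=K], where k="?m n - 2"]
      by (elim bexE conjE) (rule that)
    have "real (?G n) * ?e n + real (?G n) * real n * (lam * ?h) ^ 2 \<le>
       2 * real n powr (K + (K + 2)) * ?e n + 2 * real n powr (K + (K + 2)) * real n * (lam * ?h) ^ 2"
      using elim K by (intro add_mono mult_right_mono grid_size_le) auto
    also have "\<dots> = ?\<beta> n" by simp
    finally have le: "prob B \<le> ?\<beta> n" using B(2) by linarith
    have ae: "AE \<omega> in M. \<omega> \<notin> B \<longrightarrow> int (MIN t\<in>{0..real n powr K}. max_load (S n) n 1 t \<omega>) \<ge> int (?m n) - 3"
      using B(3) AE_regular
    proof eventually_elim
      case (elim \<omega>)
      show ?case
      proof
        assume \<omega>: "\<omega> \<notin> B"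
        let ?I = "(\<lambda>t. max_load (S n) n 1 t \<omega>) ` {0..real n powr K}"
        have "Min ?I \<in> ?I" using finite_range_max_load[OF elim(2)] by (intro Min_in) auto
        then have "?m n - 2 \<le> Min ?I + 1" using elim(1) \<omega> by auto
        then show "int (Min ?I) \<ge> int (?m n) - 3" by linarith
      qed
    qed
    have meas: "{\<omega>\<in>space M. int (MIN t\<in>{0..real n powr K}. max_load (S n) n 1 t \<omega>) \<ge> int (?m n) - 3} \<in> sets (completion M)"
      by (rule measurable_MIN_max_load) simp
    show ?case
      by (intro conjI bexI[of _ B]) (fact prob_space_axioms meas le ae B(1))+
  qed
qed

lemma max_over_time_tendsto:
  assumes K: "K > 0"
  shows "tendsto_in_prob (\<lambda>n. pspace (S n))
     (\<lambda>n \<omega>. real (MAX t\<in>{0..real n powr K}. max_load (S n) n 1 t \<omega>) * (ln (ln (real n)) / ln (real n))) (K + 1)"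
  unfolding tendsto_in_prob_def
proof (intro allI impI aasI)
  fix \<epsilon> :: real assume \<epsilon>: "\<epsilon> > 0"
  \<comment> \<open>Half of a margin is always left: 2 \<delta> stays below \<epsilon>, and
    \<open>K + 1 - 2 * \<delta>\<close> stays positive. Above, the exponent K + 1 + 2 \<delta> of
    \<open>ku\<close> beats the K + 1 + \<delta> coming from bins and grid points.\<close>
  define \<delta> where "\<delta> = min \<epsilon> (K + 1) / 4"
  have \<delta>: "\<delta> > 0" "2 * \<delta> < \<epsilon>" "2 * \<delta> < K + 1" using \<epsilon> K by (auto simp: \<delta>_def min_def)
  define \<mu> where "\<mu> = lam * (1 - exp (- 1))"
  have \<mu>: "\<mu> > 0" using lam by (simp add: \<mu>_def)
  define kl where "kl n = nat \<lceil>(K + 1 - 2 * \<delta>) * ln (real n) / ln (ln (real n))\<rceil>" for n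
  define ku where "ku n = nat \<lceil>(K + 1 + 2 * \<delta>) * ln (real n) / ln (ln (real n))\<rceil>" for n
  \<comment> \<open>Chosen so that \<delta> (c + 1) exceeds K + \<delta> + 1, which rules out
    \<open>Suc c\<close> arrivals in one bin and cell. Being constant, \<open>c\<close> vanishes
    after scaling by ln ln n / ln n.\<close>
  define c where "c = nat \<lceil>(K + \<delta> + 1) / \<delta>\<rceil>"
  let ?\<rho> = "\<lambda>n. ln (ln (real n)) / ln (real n)"
  have kl: "(\<lambda>n. real (kl n) * ?\<rho> n) \<longlonglongrightarrow> K + 1 - 2 * \<delta>" unfolding kl_def using \<delta> by (intro nat_ceiling_ratio) simp
  have ku: "(\<lambda>n. real (ku n) * ?\<rho> n) \<longlonglongrightarrow> K + 1 + 2 * \<delta>" unfolding ku_def using \<delta> K by (intro nat_ceiling_ratio) simp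
  have "(\<lambda>n. real (ku n) * ?\<rho> n + real c * ?\<rho> n) \<longlonglongrightarrow> K + 1 + 2 * \<delta> + real c * 0"
    by (intro tendsto_intros ku) real_asymp
  then have "(\<lambda>n. real (ku n + c) * ?\<rho> n) \<longlonglongrightarrow> K + 1 + 2 * \<delta>" 
    by (simp only: of_nat_add distrib_right mult_zero_right add_0_right)
  then have ev_u: "\<forall>\<^sub>F n in sequentially. real (ku n + c) * ?\<rho> n < K + 1 + \<epsilon>" by (rule order_tendstoD) (use \<delta> in simp)
  have ev_l: "\<forall>\<^sub>F n in sequentially. K + 1 - \<epsilon> < real (kl n) * ?\<rho> n" using kl by (rule order_tendstoD) (use \<delta> in simp)
  have ev_\<rho>: "\<forall>\<^sub>F n in sequentially. 0 < ?\<rho> n" by real_asymp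
  have c: "K + \<delta> + 1 < \<delta> * real (Suc c)"
  proof -
    have "(K + \<delta> + 1) / \<delta> < real (Suc c)" unfolding c_def by linarith
    then show ?thesis using \<delta> by (simp add: divide_less_eq mult.commute)
  qed
  let ?G = "grid_size K \<delta>"
  let ?G' = "\<lambda>n. nat \<lfloor>real n powr K\<rfloor>"
  \<comment> \<open>Up to a constant, the expected number of pairs of a bin and a unit window
    reaching \<open>kl n\<close>. It diverges because the weight has exponent -(K + 1 - 2 \<delta>);
    the later factor 1/2 pays for rounding \<open>n powr K\<close> down.\<close>
  let ?q = "\<lambda>n. real n powr (K + 1) * (\<mu> ^ kl n / fact (kl n))"
  let ?\<beta> = "\<lambda>n. 2 * (real n powr (K + 1 + \<delta>) * (lam ^ ku n / fact (ku n))) + 2 * real n powr (K + \<delta>) * real n * (lam * real n powr - \<delta>) ^ Suc c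
       + exp (- (exp (- \<mu>) / 2 * ?q n))"
  have "filterlim ?q at_top sequentially"
    by (rule powr_poisson_weight_asymp(2)[OF kl _ \<mu>]) (use \<delta> in auto)
  then have "filterlim (\<lambda>n. exp (- \<mu>) / 2 * ?q n) at_top sequentially"
    by (intro filterlim_tendsto_pos_mult_at_top[OF tendsto_const]) auto
  from filterlim_compose[OF exp_at_bot filterlim_compose[OF filterlim_uminus_at_bot_at_top this]]
  have "?\<beta> \<longlonglongrightarrow> 2 * 0 + 0 + 0"
    by (intro tendsto_intros grid_arrivals_tendsto_0 c powr_poisson_weight_asymp(1)[OF ku _ lam]) (use \<delta> K in auto)
  then show "?\<beta> \<longlonglongrightarrow> 0" by simp
  show "\<forall>\<^sub>F n in sequentially. prob_space (pspace (S n)) \<and>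
      {\<omega>\<in>space (pspace (S n)). \<bar>real (MAX t\<in>{0..real n powr K}. max_load (S n) n 1 t \<omega>) * ?\<rho> n - (K + 1)\<bar> < \<epsilon>} \<in> sets (completion (pspace (S n))) \<and>
      (\<exists>B\<in>sets (pspace (S n)). measure (pspace (S n)) B \<le> ?\<beta> n \<and>
         (AE \<omega> in pspace (S n). \<omega> \<notin> B \<longrightarrow> \<bar>real (MAX t\<in>{0..real n powr K}. max_load (S n) n 1 t \<omega>) * ?\<rho> n - (K + 1)\<bar> < \<epsilon>))"
    using eventually_ge_at_top[of 1] ev_u ev_l ev_\<rho>
  proof eventually_elim
    case (elim n)
    interpret one_choice_system lam n "S n" using sys[OF elim(1)] by unfold_locales
    let ?h = "real n powr - \<delta>"
    have h: "?h > 0" using elim by simp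
    obtain B where B: "B \<in> events" "prob B \<le> real (?G n) * (real n * (lam ^ ku n / fact (ku n))) + real (?G n) * real n * (lam * ?h) ^ Suc c"
      "AE \<omega> in M. \<omega> \<notin> B \<longrightarrow> (\<forall>t\<in>{0..real n powr K}. max_load (S n) n 1 t \<omega> < ku n + c)"
      using max_load_upper_on_interval[OF stat[OF elim(1)] h grid_size_covers[OF elim(1), where K=K], where k="ku n" and c=c]
      by (elim bexE conjE) (rule that)
    have "real (?G' n) \<le> real n powr K" by simp
    from max_load_attained_on_interval[OF this, where k="kl n", folded \<mu>_def]
    obtain B' where B': "B' \<in> events" "prob B' \<le> exp (- (real (?G' n * n) * (exp (- \<mu>) * (\<mu> ^ kl n / fact (kl n)))))"
      "AE \<omega> in M. \<omega> \<notin> B' \<longrightarrow> (\<exists>t\<in>{0..real n powr K}. kl n \<le> max_load (S n) n 1 t \<omega>)"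
      by (elim bexE conjE) (rule that)
    have "real (?G n) * (real n * (lam ^ ku n / fact (ku n))) + real (?G n) * real n * (lam * ?h) ^ Suc c
       \<le> 2 * real n powr (K + \<delta>) * (real n * (lam ^ ku n / fact (ku n))) + 2 * real n powr (K + \<delta>) * real n * (lam * ?h) ^ Suc c"
      using elim(1) K \<delta> lam by (intro add_mono mult_right_mono grid_size_le) auto
    also have "2 * real n powr (K + \<delta>) * (real n * (lam ^ ku n / fact (ku n))) = 2 * (real n powr (K + 1 + \<delta>) * (lam ^ ku n / fact (ku n)))"
      using elim(1) by (simp add: powr_add)
    finally have le: "prob B \<le> 2 * (real n powr (K + 1 + \<delta>) * (lam ^ ku n / fact (ku n))) + 2 * real n powr (K + \<delta>) * real n * (lam * ?h) ^ Suc c"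
      using B(2) by linarith
    have "1 \<le> real n powr K" using elim(1) K by (intro ge_one_powr_ge_zero) auto
    then have "real n powr K / 2 \<le> real (?G' n)" by (rule half_le_nat_floor)
    then have "real n powr K / 2 * real n * (exp (- \<mu>) * (\<mu> ^ kl n / fact (kl n))) \<le> real (?G' n) * real n * (exp (- \<mu>) * (\<mu> ^ kl n / fact (kl n)))"
      using \<mu> by (intro mult_right_mono) auto
    also have "real n powr K / 2 * real n * (exp (- \<mu>) * (\<mu> ^ kl n / fact (kl n))) = exp (- \<mu>) / 2 * ?q n"
      using elim(1) by (simp add: powr_add)
    finally have "exp (- (real (?G' n * n) * (exp (- \<mu>) * (\<mu> ^ kl n / fact (kl n))))) \<le> exp (- (exp (- \<mu>) / 2 * ?q n))"
      by simp
    with le B'(2) measure_Un_le[OF B(1) B'(1)] have le': "prob (B \<union> B') \<le> ?\<beta> n" by linarith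
    have ae: "AE \<omega> in M. \<omega> \<notin> B \<union> B' \<longrightarrow> \<bar>real (MAX t\<in>{0..real n powr K}. max_load (S n) n 1 t \<omega>) * ?\<rho> n - (K + 1)\<bar> < \<epsilon>"
      using B(3) B'(3) AE_regular
    proof eventually_elim
      fix \<omega> assume up: "\<omega> \<notin> B \<longrightarrow> (\<forall>t\<in>{0..real n powr K}. max_load (S n) n 1 t \<omega> < ku n + c)"
        and low: "\<omega> \<notin> B' \<longrightarrow> (\<exists>t\<in>{0..real n powr K}. kl n \<le> max_load (S n) n 1 t \<omega>)" and reg: "regular \<omega>"
      show "\<omega> \<notin> B \<union> B' \<longrightarrow> \<bar>real (MAX t\<in>{0..real n powr K}. max_load (S n) n 1 t \<omega>) * ?\<rho> n - (K + 1)\<bar> < \<epsilon>"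
      proof
        assume \<omega>: "\<omega> \<notin> B \<union> B'"
        let ?I = "(\<lambda>t. max_load (S n) n 1 t \<omega>) ` {0..real n powr K}"
        have fin: "finite ?I" by (rule finite_range_max_load[OF reg])
        have "Max ?I \<in> ?I" using fin by (intro Max_in) auto
        then have "Max ?I \<le> ku n + c" using up \<omega> by auto
        then have "real (Max ?I) * ?\<rho> n \<le> real (ku n + c) * ?\<rho> n" using elim(4) by (intro mult_right_mono) auto
        then have 1: "real (Max ?I) * ?\<rho> n < K + 1 + \<epsilon>" using elim(2) by linarith
        obtain t where t: "t \<in> {0..real n powr K}" "kl n \<le> max_load (S n) n 1 t \<omega>" using low \<omega> by blast
        have "kl n \<le> Max ?I" using t Max_ge[OF fin, of "max_load (S n) n 1 t \<omega>"] by (meson imageI order_trans)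
        then have "real (kl n) * ?\<rho> n \<le> real (Max ?I) * ?\<rho> n" using elim(4) by (intro mult_right_mono) auto
        then have 2: "K + 1 - \<epsilon> < real (Max ?I) * ?\<rho> n" using elim(3) by linarith
        show "\<bar>real (Max ?I) * ?\<rho> n - (K + 1)\<bar> < \<epsilon>" using 1 2 by linarith
      qed
    qed
    have meas: "{\<omega>\<in>space M. \<bar>real (MAX t\<in>{0..real n powr K}. max_load (S n) n 1 t \<omega>) * ?\<rho> n - (K + 1)\<bar> < \<epsilon>} \<in> sets (completion M)"
      by (rule measurable_MAX_max_load) simp
    show ?case
      by (intro conjI bexI[of _ "B \<union> B'"]) (fact prob_space_axioms meas le' ae sets.Un[OF B(1) B'(1)])+
  qed
qed

end

theorem theorem1p2:
  fixes lam :: real and S :: "nat \<Rightarrow> 'a bin_data"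
  assumes "lam > 0"
    and "\<And>n. n \<ge> 1 \<Longrightarrow> bin_system lam n 1 (S n)"
    and "\<And>n. n \<ge> 1 \<Longrightarrow> stationary (S n) n 1"
  shows "\<exists>m :: nat \<Rightarrow> int.
    (\<lambda>n. real_of_int (m n)) \<sim>[at_top] (\<lambda>n. ln (real n) / ln (ln (real n))) \<and>
    (\<forall>t\<ge>0. aas (\<lambda>n. pspace (S n))
       (\<lambda>n \<omega>. int (max_load (S n) n 1 t \<omega>) = m n \<or> int (max_load (S n) n 1 t \<omega>) = m n - 1)) \<and>
    (\<forall>K>0. aas (\<lambda>n. pspace (S n))
       (\<lambda>n \<omega>. int (MIN t\<in>{0..real n powr K}. max_load (S n) n 1 t \<omega>) \<ge> m n - 3)) \<and>
    (\<forall>K>0. tendsto_in_prob (\<lambda>n. pspace (S n))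
       (\<lambda>n \<omega>. real (MAX t\<in>{0..real n powr K}. max_load (S n) n 1 t \<omega>)
                 * (ln (ln (real n)) / ln (real n))) (K + 1))"
proof (intro exI[of _ "\<lambda>n. int (level lam n)"] conjI allI impI)
  show "(\<lambda>n. real_of_int (int (level lam n))) \<sim>[at_top] (\<lambda>n. ln (real n) / ln (ln (real n)))"
    using level_asymp[OF assms(1)] by simp
qed (rule aas_two_values[OF assms] aas_min_over_time[OF assms] max_over_time_tendsto[OF assms]; assumption)+

end
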